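(* Let $(X_n)_{n\ge 1}$ be a sequence of i.i.d. random vectors with the same law as $X$, let $(\widehat\theta_n)_{n\ge1}$ be the projected Robbins-Monro sequence defined in the context, with step sequence of the form $\gamma_n=c_\gamma n^{-\alpha}$, where $c_\gamma>0$ and $\alpha\in(1/2,1)$, and let $\overline\theta_n=\frac1n\sum_{k=1}^n\widehat\theta_k$ for $n\ge1$. Assume that [A1], [A2], [A3] and [A4] hold and that $\mathbb E[\|X-\mu\|^{12}]<\infty$. Then there is a positive constant $C$ such that for all $n\ge1$, $$\mathbb E\left[\|\overline\theta_n-\theta\|^2\right]\le\frac Cn.$$
   Context: Model. Let $d\ge2$ and let $X$ be a random vector of $\mathbb R^d$ of the form $X=\mu+r\,W\,U_\Omega$, where $\mu\in\mathbb R^d$, $r>0$, $W$ is a positive real continuous random variable (with a bounded density if $d=2$), $U_\Omega$ is uniformly distributed on a measurable subset $\Omega$ (of positive surface measure) of the unit sphere of $\mathbb R^d$, and $W$ and $U_\Omega$ are independent. Set $r^\star:=r\,\mathbb E[W]$ and $\theta:=(\mu,r^\star)\in\mathbb R^d\times\mathbb R$. Norms are Euclidean, $\langle\cdot,\cdot\rangle$ is the usual inner product, $\mathcal B(x,\rho)$ is the ball of center $x$ and radius $\rho$, and $\lambda_{\max}(M)$ is the largest eigenvalue of the matrix $M$. Assumptions. [A1] $\mathbb E[\|X-\mu\|^{-2}]<\infty$. [A2] $\mathbb E[\|X-\mu\|^{2}]<\infty$. [A3] There are positive constants $R_\mu,R_r$ such that $$\sup_{z\in\overline{\mathcal B(\mu,R_\mu)}}\lambda_{\max}(\Gamma(z))<\frac{1-\|\mathbb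 E[U_\Omega]\|^2/A}{r^\star+\frac32R_r}$$ for some $A$ with $\|\mathbb E[U_\Omega]\|^2<A<1$, where $$\Gamma(z):=\mathbb E\left[\frac1{\|X-z\|}\left(I_d-\frac{(X-z)(X-z)^T}{\|X-z\|^2}\right)\right].$$ [A4] The matrix (Hessian at $\theta$ of $G(z,a)=\frac12\mathbb E[(\|X-z\|-a)^2]$) $$\Gamma_\theta:=\begin{pmatrix}I_d-r^\star\,\mathbb E\left[\frac1{\|X-\mu\|}\left(I_d-\frac{(X-\mu)(X-\mu)^T}{\|X-\mu\|^2}\right)\right]&\mathbb E\left[\frac{X-\mu}{\|X-\mu\|}\right]\\ \mathbb E\left[\frac{X-\mu}{\|X-\mu\|}\right]^T&1\end{pmatrix}$$ is positive definite. Compact set and projection. With $R_\mu,R_r$ the constants of [A3], $\mathcal K$ is a compact convex subset of $\mathbb R^d\times(0,\infty)$ contained in $\overline{\mathcal B(\mu,R_\mu)}\times\overline{\mathcal B(r^\star,R_r)}$ such that $\theta\in\mathcal K\setminus\partial\mathcal K$ ($\partial\mathcal K$ is the boundary of $\mathcal K$ in $\mathbb R^d\times\mathbb R$). The map $\pi:\mathbb R^d\times\mathbb R\to\mathcal K$ is a projection onto $\mathcal K$ satisfying: $\pi(y)=y$ for $y\in\mathcal K$; $\|\pi(y)-\pi(y')\|\le\|y-y'\|$ for all $y,y'$; and $\pi(y)\in\partial\mathcal K$ for all $y\notin\mathcal K$. Projected Robbins-Monro algorithm. For $x\in\mathbb R^d$ and $y=(z,a)\in\mathbb R^d\times(0,\infty)$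 let $g(x,y):=\frac12(\|x-z\|-a)^2$, so that for $x\neq z$ $$\nabla_yg(x,y)=\begin{pmatrix}z-x-a\,\frac{z-x}{\|z-x\|}\\ a-\|z-x\|\end{pmatrix}.$$ (For each fixed $z$, $X\ne z$ almost surely.) The sequence is defined by $\widehat\theta_1$ arbitrarily chosen in $\mathcal K$ and, for $n\ge1$, $$\widehat\theta_{n+1}=\pi\left(\widehat\theta_n-\gamma_n\nabla_yg(X_{n+1},\widehat\theta_n)\right).$$ *)

theory Defs
  imports "HOL-Probability.Probability"
begin

text \<open>
  Surface measure on the unit sphere, as a Borel measure on the ambient space that is carried by
  the sphere: the polar-coordinate definition \<open>\<sigma>(A) = d * Leb {t u | 0 < t < 1, u \<in> A}\<close>, see
  \<open>emeasure_sphere_surface\<close> below. Recall that \<open>sgn x = x / norm x\<close>; the value \<open>sgn 0 = 0\<close> only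
  concerns a Lebesgue null set.
\<close>

definition sphere_surface :: "'a::euclidean_space measure" where
  "sphere_surface =
     scale_measure (of_nat DIM('a)) (distr (restrict_space lborel (ball 0 1)) borel sgn)"

lemma sets_sphere_surface [simp, measurable_cong]: "sets sphere_surface = sets borel"
  by (simp add: sphere_surface_def)

lemma emeasure_sphere_surface:
  fixes A :: "'a::euclidean_space set"
  assumes "A \<in> sets borel" "A \<subseteq> sphere 0 1"
  shows "emeasure sphere_surface A =
    of_nat DIM('a) * emeasure lborel {t *\<^sub>R u | t u. 0 < t \<and> t < 1 \<and> u \<in> A}"
proof -
  have [measurable]: "sgn \<in> borel_measurable (restrict_space lborel (ball (0::'a) 1))"
    unfolding sgn_div_norm by (intro measurable_restrict_space1) simp
  have "sgn -` A \<inter> ball 0 1 = {t *\<^sub>R u | t u. 0 < t \<and> t < 1 \<and> u \<in> A}" (is "?L = ?R")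
  proof
    show "?L \<subseteq> ?R"
    proof
      fix x assume x: "x \<in> ?L"
      then have "x \<noteq> 0" using assms(2) by auto
      then have "x = norm x *\<^sub>R sgn x" "0 < norm x" "norm x < 1" "sgn x \<in> A"
        using x by (auto simp: sgn_div_norm)
      then show "x \<in> ?R" by blast
    qed
    show "?R \<subseteq> ?L"
    proof
      fix x assume "x \<in> ?R"
      then obtain t u where tu: "x = t *\<^sub>R u" "0 < t" "t < 1" "u \<in> A" by blast
      then have "norm u = 1" using assms(2) by auto
      then show "x \<in> ?L" using tu by (simp add: sgn_div_norm)
    qed
  qed
  moreover have "?R \<subseteq> ball 0 1" using calculation by blast
  ultimately show ?thesis
    using assms(1)
    by (simp add: sphere_surface_def emeasure_distr emeasure_restrict_space space_restrict_space)
qed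

definition outer :: "real^'n \<Rightarrow> real^'n \<Rightarrow> real^'n^'n" where
  "outer x y = (\<chi> i j. x $ i * y $ j)"

text \<open>Largest real eigenvalue; only meaningful when there is one, e.g. for symmetric \<open>A\<close>.\<close>

definition lambda_max :: "real^'n^'n \<Rightarrow> real" where
  "lambda_max A = Max {l. \<exists>v. v \<noteq> 0 \<and> A *v v = l *\<^sub>R v}"

definition positive_definite :: "real^'n^'n \<Rightarrow> bool" where
  "positive_definite A \<longleftrightarrow> transpose A = A \<and> (\<forall>v. v \<noteq> 0 \<longrightarrow> v \<bullet> (A *v v) > 0)"

definition Gamma_mat :: "'b measure \<Rightarrow> ('b \<Rightarrow> real^'n) \<Rightarrow> real^'n \<Rightarrow> real^'n^'n" where
  "Gamma_mat N X z =
     (\<integral>\<omega>. (1 / norm (X \<omega> - z)) *\<^sub>R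
        (mat 1 - (1 / (norm (X \<omega> - z))\<^sup>2) *\<^sub>R outer (X \<omega> - z) (X \<omega> - z)) \<partial>N)"

text \<open>The symmetric block matrix with diagonal blocks \<open>A\<close>, \<open>c\<close> and off-diagonal column \<open>b\<close>.\<close>

definition bordered_mat :: "real^'n^'n \<Rightarrow> real^'n \<Rightarrow> real \<Rightarrow> real^('n + unit)^('n + unit)" where
  "bordered_mat A b c = (\<chi> i j. case i of
       Inl k \<Rightarrow> (case j of Inl l \<Rightarrow> A $ k $ l | Inr _ \<Rightarrow> b $ k)
     | Inr _ \<Rightarrow> (case j of Inl l \<Rightarrow> b $ l | Inr _ \<Rightarrow> c))"

definition Gamma_theta ::
  "'b measure \<Rightarrow> ('b \<Rightarrow> real^'n) \<Rightarrow> (real^'n) \<times> real \<Rightarrow> real^('n + unit)^('n + unit)" where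
  "Gamma_theta N X \<theta> =
     bordered_mat
       (mat 1 - snd \<theta> *\<^sub>R Gamma_mat N X (fst \<theta>))
       (\<integral>\<omega>. (1 / norm (X \<omega> - fst \<theta>)) *\<^sub>R (X \<omega> - fst \<theta>) \<partial>N)
       1"

definition loss :: "real^'n \<Rightarrow> (real^'n) \<times> real \<Rightarrow> real" where
  "loss x y = (norm (x - fst y) - snd y)\<^sup>2 / 2"

text \<open>
  The gradient of the loss in its second argument for \<open>x \<noteq> fst y\<close>, see \<open>GDERIV_loss\<close>. When
  \<open>x = fst y\<close> division by zero makes the unit-vector term vanish; this happens with probability 0.
\<close>

definition grad_loss :: "real^'n \<Rightarrow> (real^'n) \<times> real \<Rightarrow> (real^'n) \<times> real" where
  "grad_loss x y =
     (fst y - x - snd y *\<^sub>R ((1 / norm (fst y - x)) *\<^sub>R (fst y - x)), snd y - norm (fst y - x))"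

lemma GDERIV_loss:
  assumes "x \<noteq> fst y"
  shows "GDERIV (loss x) y :> grad_loss x y"
proof -
  define n where "n = norm (x - fst y)"
  have n: "n > 0" "norm (fst y - x) = n" using assms by (auto simp: n_def norm_minus_commute)
  have "((\<lambda>y. x - fst y) has_derivative (\<lambda>h. - fst h)) (at y)"
    by (auto intro!: derivative_eq_intros)
  from has_derivative_compose[OF this, of norm "\<lambda>h. h \<bullet> sgn (x - fst y)"]
  have "((\<lambda>y. norm (x - fst y)) has_derivative (\<lambda>h. (- fst h) \<bullet> sgn (x - fst y))) (at y)"
    using GDERIV_norm[of "x - fst y"] assms by (simp add: gderiv_def)
  then have "(loss x has_derivative
      (\<lambda>h. (norm (x - fst y) - snd y) * ((- fst h) \<bullet> sgn (x - fst y) - snd h))) (at y)"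
    unfolding loss_def by (auto intro!: derivative_eq_intros simp: field_simps)
  moreover have "(norm (x - fst y) - snd y) * ((- fst h) \<bullet> sgn (x - fst y) - snd h)
      = h \<bullet> grad_loss x y" for h
    using n unfolding grad_loss_def inner_prod_def n(2) n_def[symmetric]
    by (simp add: sgn_div_norm n_def[symmetric] inner_diff_right algebra_simps)
       (simp add: divide_simps algebra_simps)
  ultimately show ?thesis
    unfolding gderiv_def by simp
qed

end

(*
The theorem splits into a general result on averaged projected stochastic gradient iterates and a
verification of its hypotheses for the spherical model.

General result. Let Phi be the mean gradient and T_n the error of the n-th iterate. Strong
monotonicity of Phi at theta and non-expansiveness of the projection give
E|T_(n+1)|^4 <= (1 - 2 kappa gamma_n) E|T_n|^4 + C gamma_n^3, hence E|T_n|^4 = O(n^(-2 alpha)).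
Summing the identity
  L T_n = (T_n - T_(n+1)) / gamma_n + (projection error) / gamma_n - (martingale increment)
          - (linearization error)
and bounding each of the four sums in L^2 by O(sqrt n) yields the rate 1/n for the averages. The
projection error is negligible because the projection acts only when |T_n| or gamma_n |gradient|
exceeds a fixed threshold.

Spherical model. The expansion of z -> (z - x) / |z - x| around mu has a remainder bounded by
|h|^2 / |x - mu|^2 for every h, so [A1] suffices for the linearization. Strong monotonicity follows
from [A3] by integrating the Hessian of z -> E|X - z| along segments. Since E(1 / |X - z|) is finite
for Lebesgue almost every z, and X almost surely avoids the line through mu and mu + h for almost
every h, this works on almost every segment, and continuity of the gradient of z -> E|X - z|
(X has no atoms) covers the others. Invertibility of the linear part is read off from strong monotonicity near theta.
*)

theory Submission
  imports Defs
begin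

text \<open>Fourth moments are used because the linearization error is quadratic in T_n: its mean
  square is controlled by E|T_n|^4 = O(n^(-2 alpha)), which is O(1/n) because alpha > 1/2. A term
  with mean square O(1/k) has L^2 norm O(k^(-1/2)), and these norms sum to O(sqrt n).

  No conditional expectation occurs. The pair of the iterate and the accumulated noise is a function
  of the samples already drawn, so its joint law with the next sample is a product measure, and
  Fubini replaces conditioning.

  The obstacle in the spherical model is that [A3] speaks of Gamma(z) as a Bochner integral, which
  has the value 0 where it diverges, while [A1] secures convergence only at mu. The eigenvalue bound
  is therefore used only at points z with finite E(1 / |X - z|), and avoiding the other points
  forces the detour through almost every segment.\<close>

section \<open>Averaging of projected stochastic gradient iterates\<close>

text \<open>The sequence D s_n^2 with s_n = n^(-alpha) is a supersolution. Passing from s_n^2 to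
  s_(n+1)^2 costs at most a factor 1 - 2/n, and since alpha < 1 the loss 2/n is eventually at most
  half of the contraction a c s_n; the other half absorbs the cubic term once D is large. The bound
  \<open>S\<close> covers the finitely many indices before that.\<close>

lemma robbins_monro_rate:
  fixes \<delta> :: "nat \<Rightarrow> real"
  assumes c: "c > 0" and \<alpha>: "0 < \<alpha>" "\<alpha> < 1" and a: "a > 0" and B: "B \<ge> 0"
    and bnd: "\<And>n. n \<ge> 1 \<Longrightarrow> \<delta> n \<le> S"
    and rec: "\<And>n. n \<ge> 1 \<Longrightarrow>
      \<delta> (n + 1) \<le> (1 - a * (c * real n powr - \<alpha>)) * \<delta> n + B * (c * real n powr - \<alpha>) ^ 3"
  shows "\<exists>D>0. \<forall>n\<ge>1. \<delta> n \<le> D * (real n powr - \<alpha>)\<^sup>2"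
proof -
  define s where "s n = real n powr - \<alpha>" for n :: nat
  have "(\<lambda>n::nat. 2 / real n / (real n powr - \<alpha>)) \<longlonglongrightarrow> 0"
    using \<alpha> by real_asymp
  then have e1: "\<forall>\<^sub>F n in sequentially. 2 / real n / s n < a * c / 2"
    unfolding s_def by (rule order_tendstoD) (use a c in simp)
  have "(\<lambda>n::nat. real n powr - \<alpha>) \<longlonglongrightarrow> 0"
    using \<alpha> by real_asymp
  then have e2: "\<forall>\<^sub>F n in sequentially. s n < 1 / (a * c)"
    unfolding s_def by (rule order_tendstoD) (use a c in simp)
  from eventually_conj[OF e1 e2] obtain n0 where
    n0: "\<And>n. n \<ge> n0 \<Longrightarrow> 2 / real n / s n < a * c / 2 \<and> s n < 1 / (a * c)"
    unfolding eventually_sequentially by blast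
  define m where "m = max 1 n0"
  \<comment> \<open>The summand with \<open>S\<close> starts the induction at m, the last summand
    lets half of the contraction absorb \<open>B * (c * s n) ^ 3\<close>, and 1 keeps D
    positive.\<close>
  define D where "D = 1 + \<bar>S\<bar> / (s m)\<^sup>2 + 2 * B * c\<^sup>2 / a"
  have s_pos: "s n > 0" if "n \<ge> 1" for n using that by (simp add: s_def)
  have m1: "m \<ge> 1" "m \<ge> n0" by (auto simp: m_def)
  have B0: "0 \<le> 2 * B * c\<^sup>2 / a" using B a by simp
  have D: "D > 0" "D \<ge> 2 * B * c\<^sup>2 / a"
    using B0 unfolding D_def by (smt (verit) divide_nonneg_nonneg zero_le_power2)+
  have D_S: "S \<le> D * (s m)\<^sup>2"
  proof -
    have "\<bar>S\<bar> / (s m)\<^sup>2 \<le> D" using B0 by (simp add: D_def)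
    then show ?thesis using s_pos[OF m1(1)] by (simp add: divide_le_eq)
  qed
  have "\<delta> n \<le> D * (s n)\<^sup>2" if "n \<ge> 1" for n
  proof (cases "n \<le> m")
    case True
    have "s m \<le> s n" unfolding s_def
      using True that \<alpha> by (intro powr_mono2') auto
    then have "(s m)\<^sup>2 \<le> (s n)\<^sup>2" using s_pos[OF m1(1)] by (intro power_mono) auto
    then have "D * (s m)\<^sup>2 \<le> D * (s n)\<^sup>2" using D by simp
    then show ?thesis using bnd[OF that] D_S by linarith
  next
    case False
    then have "m \<le> n" by simp
    then show ?thesis
    proof (induction n rule: dec_induct)
      case base
      show ?case using bnd[OF m1(1)] D_S by simp
    next
      case (step n)
      have n: "n \<ge> 1" "n \<ge> n0" using step m1 by auto
      have sn: "s n > 0" using s_pos n by auto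
      have "0 < a * c" using a c by simp
      with n0[OF n(2)] have "2 / real n < a * c / 2 * s n" "s n * (a * c) < 1"
        by (simp_all only: pos_divide_less_eq[OF sn] pos_less_divide_eq)
      then have q: "2 / real n \<le> a * c * s n / 2" "a * (c * s n) \<le> 1"
        by (simp_all add: mult_ac)
      \<comment> \<open>The ratio q = n / (n + 1) is below 1, so alpha < 1 gives q <= q^alpha =
        s_(n+1) / s_n.\<close>
      have "1 - 1 / real n \<le> real n / real (n + 1)"
        using n by (simp add: field_simps)
      also have "\<dots> = (real n / real (n + 1)) powr 1" using n by simp
      also have "\<dots> \<le> (real n / real (n + 1)) powr \<alpha>"
        using n \<alpha> by (intro powr_mono') auto
      also have "\<dots> = s (n + 1) / s n"
        using n unfolding s_def by (simp add: powr_divide powr_minus field_simps)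
      finally have "(1 - 1 / real n) * s n \<le> s (n + 1)"
        using sn by (simp add: field_simps)
      moreover have "0 \<le> (1 - 1 / real n) * s n" using n sn by simp
      ultimately have "((1 - 1 / real n) * s n)\<^sup>2 \<le> (s (n + 1))\<^sup>2" by (intro power_mono)
      moreover have "(1 - 2 / real n) * (s n)\<^sup>2 \<le> ((1 - 1 / real n) * s n)\<^sup>2"
        unfolding power_mult_distrib
        by (intro mult_right_mono) (use n in \<open>auto simp: power2_eq_square field_simps\<close>)
      ultimately have s2: "(1 - 2 / real n) * (s n)\<^sup>2 \<le> (s (n + 1))\<^sup>2" by linarith
      have "\<delta> (n + 1) \<le> (1 - a * (c * s n)) * \<delta> n + B * (c * s n) ^ 3"
        using rec[OF n(1)] by (simp add: s_def)
      also have "\<dots> \<le> (1 - a * (c * s n)) * (D * (s n)\<^sup>2) + B * (c * s n) ^ 3"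
        using step.IH q by (intro add_right_mono mult_left_mono) auto
      also have "\<dots> = (1 - 2 / real n) * (D * (s n)\<^sup>2)
          + (s n)\<^sup>2 * ((2 / real n - a * c * s n) * D + B * c ^ 3 * s n)"
        by (simp add: algebra_simps power2_eq_square power3_eq_cube)
      also have "\<dots> \<le> (1 - 2 / real n) * (D * (s n)\<^sup>2)"
      proof -
        have "(2 / real n - a * c * s n) * D \<le> (- a * c * s n / 2) * D"
          using q D by (intro mult_right_mono) auto
        also have "\<dots> = - (a * c * s n / 2 * D)" by simp
        also have "\<dots> \<le> - (a * c * s n / 2 * (2 * B * c\<^sup>2 / a))"
          using D a c sn by (intro le_imp_neg_le mult_left_mono) auto
        also have "\<dots> = - (B * c ^ 3 * s n)"
          using a by (simp add: power2_eq_square power3_eq_cube)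
        finally have "(2 / real n - a * c * s n) * D + B * c ^ 3 * s n \<le> 0" by simp
        then show ?thesis
          by (simp add: mult_nonneg_nonpos)
      qed
      also have "\<dots> = D * ((1 - 2 / real n) * (s n)\<^sup>2)" by simp
      also have "\<dots> \<le> D * (s (n + 1))\<^sup>2" using s2 D by simp
      finally show ?case by simp
    qed
  qed
  then show ?thesis using D unfolding s_def by blast
qed

section \<open>Mean squares of sums from mean squares of the summands\<close>

lemma sum_inverse_sqrt_le: "(\<Sum>k=1..n. 1 / sqrt (real k)) \<le> 2 * sqrt (real n)"
proof (induction n)
  case (Suc n)
  define p q where "p = sqrt (real (Suc n))" and "q = sqrt (real n)"
  have pq: "0 < p" "0 \<le> q" "q \<le> p" "p * p = 1 + q * q" by (simp_all add: p_def q_def)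
  have "1 = (p - q) * (p + q)" using pq by (simp add: algebra_simps)
  also have "\<dots> \<le> (p - q) * (2 * p)" using pq by (intro mult_left_mono) auto
  finally have "1 \<le> 2 * (p - q) * p" by (simp add: mult_ac)
  then have "1 / p \<le> 2 * (p - q)" using pq by (subst pos_divide_le_eq)
  then have "1 / sqrt (real (Suc n)) \<le> 2 * (sqrt (real (Suc n)) - sqrt (real n))"
    unfolding p_def q_def .
  then show ?case using Suc by simp
qed simp

text \<open>Cauchy-Schwarz after writing |a_k| as k^(-1/4) times k^(1/4) |a_k|. If E|a_k|^2 is
  O(1/k), both factors of the resulting bound have order sqrt n.\<close>

lemma norm_sum_squared_le_weighted:
  fixes a :: "nat \<Rightarrow> 'e::real_normed_vector"
  shows "(norm (\<Sum>k=1..n. a k))\<^sup>2 \<le> 2 * sqrt (real n) * (\<Sum>k=1..n. sqrt (real k) * (norm (a k))\<^sup>2)"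
proof -
  have "(norm (\<Sum>k=1..n. a k))\<^sup>2 \<le> (\<Sum>k=1..n. norm (a k))\<^sup>2"
    by (intro power_mono norm_sum) simp
  also have "(\<Sum>k=1..n. norm (a k))
      = (\<Sum>k=1..n. sqrt (1 / sqrt (real k)) * (sqrt (sqrt (real k)) * norm (a k)))"
    by (intro sum.cong) (auto simp: real_sqrt_divide)
  also have "\<dots>\<^sup>2 \<le> (\<Sum>k=1..n. (sqrt (1 / sqrt (real k)))\<^sup>2)
      * (\<Sum>k=1..n. (sqrt (sqrt (real k)) * norm (a k))\<^sup>2)"
    by (rule Cauchy_Schwarz_ineq_sum)
  also have "\<dots> = (\<Sum>k=1..n. 1 / sqrt (real k)) * (\<Sum>k=1..n. sqrt (real k) * (norm (a k))\<^sup>2)"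
    by (simp add: power_mult_distrib)
  also have "\<dots> \<le> 2 * sqrt (real n) * (\<Sum>k=1..n. sqrt (real k) * (norm (a k))\<^sup>2)"
    by (intro mult_right_mono sum_inverse_sqrt_le sum_nonneg) auto
  finally show ?thesis .
qed

text \<open>Minkowski's inequality in disguise: the \<open>L\<^sup>2\<close> norms are at most \<open>sqrt (C / k)\<close>,
  and these sum to \<open>2 * sqrt (C * n)\<close>.\<close>

lemma second_moment_sum_le:
  fixes a :: "nat \<Rightarrow> 'a \<Rightarrow> 'e::euclidean_space"
  assumes [measurable]: "\<And>k. k \<ge> 1 \<Longrightarrow> a k \<in> borel_measurable M"
    and int: "\<And>k. k \<ge> 1 \<Longrightarrow> integrable M (\<lambda>\<omega>. (norm (a k \<omega>))\<^sup>2)"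
    and le: "\<And>k. k \<ge> 1 \<Longrightarrow> (\<integral>\<omega>. (norm (a k \<omega>))\<^sup>2 \<partial>M) \<le> C / real k"
  shows "integrable M (\<lambda>\<omega>. (norm (\<Sum>k=1..n. a k \<omega>))\<^sup>2)" (is ?int)
    and "(\<integral>\<omega>. (norm (\<Sum>k=1..n. a k \<omega>))\<^sup>2 \<partial>M) \<le> 4 * C * real n" (is ?le)
proof -
  let ?b = "\<lambda>\<omega>. 2 * sqrt (real n) * (\<Sum>k=1..n. sqrt (real k) * (norm (a k \<omega>))\<^sup>2)"
  have C: "C \<ge> 0"
    using order_trans[OF integral_nonneg_AE le[of 1]] by simp
  have b: "integrable M ?b"
    using int by (intro integrable_mult_right integrable_sum) auto
  show ?int
    by (rule Bochner_Integration.integrable_bound[OF b])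
       (use norm_sum_squared_le_weighted in \<open>auto intro!: AE_I2 order_trans[OF _ abs_ge_self]\<close>)
  then have "(\<integral>\<omega>. (norm (\<Sum>k=1..n. a k \<omega>))\<^sup>2 \<partial>M) \<le> (\<integral>\<omega>. ?b \<omega> \<partial>M)"
    using b by (intro integral_mono norm_sum_squared_le_weighted)
  also have "\<dots> = 2 * sqrt (real n) * (\<Sum>k=1..n. sqrt (real k) * (\<integral>\<omega>. (norm (a k \<omega>))\<^sup>2 \<partial>M))"
    using int by (subst integral_mult_right_zero, subst Bochner_Integration.integral_sum) auto
  also have "\<dots> \<le> 2 * sqrt (real n) * (\<Sum>k=1..n. C * (1 / sqrt (real k)))"
  proof (intro mult_left_mono sum_mono)
    fix k assume "k \<in> {1..n}"
    then have "k \<ge> 1" by simp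
    have "sqrt (real k) * (\<integral>\<omega>. (norm (a k \<omega>))\<^sup>2 \<partial>M) \<le> sqrt (real k) * (C / real k)"
      using le[OF \<open>k \<ge> 1\<close>] by (intro mult_left_mono) auto
    also have "\<dots> = C * (1 / sqrt (real k))"
      using \<open>k \<ge> 1\<close> by (simp add: field_simps)
    finally show "sqrt (real k) * (\<integral>\<omega>. (norm (a k \<omega>))\<^sup>2 \<partial>M) \<le> C * (1 / sqrt (real k))" .
  qed auto
  also have "\<dots> \<le> 2 * sqrt (real n) * (C * (2 * sqrt (real n)))"
    unfolding sum_distrib_left[symmetric]
    using C by (intro mult_left_mono sum_inverse_sqrt_le) auto
  also have "\<dots> = 4 * C * real n" by simp
  finally show ?le .
qed

section \<open>Independence of the current state and the next sample\<close>

text \<open>Induction writes \<open>Z n\<close> as a measurable function of the samples with index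
  in {1..n}. The blocks {1..n} and {n + 1} are independent, and a map acting on each factor
  separately sends a product measure to a product measure.\<close>

lemma (in prob_space) recursive_state_indep:
  fixes X :: "nat \<Rightarrow> 'a \<Rightarrow> 'x" and Z :: "nat \<Rightarrow> 'a \<Rightarrow> 'z"
  assumes indep: "indep_vars (\<lambda>_. S) X {1..}"
    and step: "\<And>n. n \<ge> 1 \<Longrightarrow> (\<lambda>(z, x). \<Psi> n z x) \<in> T \<Otimes>\<^sub>M S \<rightarrow>\<^sub>M T"
    and init: "z1 \<in> space T" "\<And>\<omega>. \<omega> \<in> space M \<Longrightarrow> Z 1 \<omega> = z1"
    and rec: "\<And>n \<omega>. n \<ge> 1 \<Longrightarrow> \<omega> \<in> space M \<Longrightarrow> Z (n + 1) \<omega> = \<Psi> n (Z n \<omega>) (X (n + 1) \<omega>)"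
    and "n \<ge> 1"
  shows "Z n \<in> M \<rightarrow>\<^sub>M T" (is ?meas)
    and "distr M (T \<Otimes>\<^sub>M S) (\<lambda>\<omega>. (Z n \<omega>, X (n + 1) \<omega>))
      = distr M T (Z n) \<Otimes>\<^sub>M distr M S (X (n + 1))" (is ?eq)
proof -
  have "\<exists>F \<in> PiM {1..n} (\<lambda>_. S) \<rightarrow>\<^sub>M T.
      \<forall>\<omega>\<in>space M. Z n \<omega> = F (restrict (\<lambda>i. X i \<omega>) {1..n})"
    using \<open>n \<ge> 1\<close>
  proof (induction n rule: dec_induct)
    case base
    show ?case using init by (intro bexI[of _ "\<lambda>_. z1"]) auto
  next
    case (step n)
    then obtain F where F[measurable]: "F \<in> PiM {1..n} (\<lambda>_. S) \<rightarrow>\<^sub>M T"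
      and Z: "\<And>\<omega>. \<omega> \<in> space M \<Longrightarrow> Z n \<omega> = F (restrict (\<lambda>i. X i \<omega>) {1..n})"
      by blast
    have [measurable]: "(\<lambda>(z, x). \<Psi> n z x) \<in> T \<Otimes>\<^sub>M S \<rightarrow>\<^sub>M T"
      using step assms(2) by blast
    have [measurable]: "(\<lambda>f. f (n + 1)) \<in> PiM {1..Suc n} (\<lambda>_. S) \<rightarrow>\<^sub>M S"
      by (rule measurable_component_singleton) simp
    have [measurable]: "(\<lambda>f. restrict f {1..n}) \<in> PiM {1..Suc n} (\<lambda>_. S) \<rightarrow>\<^sub>M PiM {1..n} (\<lambda>_. S)"
      by (rule measurable_restrict_subset) auto
    let ?F = "\<lambda>f. (\<lambda>(z, x). \<Psi> n z x) (F (restrict f {1..n}), f (n + 1))"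
    have "?F \<in> PiM {1..Suc n} (\<lambda>_. S) \<rightarrow>\<^sub>M T" by measurable
    moreover have "Z (Suc n) \<omega> = ?F (restrict (\<lambda>i. X i \<omega>) {1..Suc n})" if "\<omega> \<in> space M" for \<omega>
    proof -
      have "restrict (restrict (\<lambda>i. X i \<omega>) {1..Suc n}) {1..n} = restrict (\<lambda>i. X i \<omega>) {1..n}"
        by (auto simp: restrict_def fun_eq_iff)
      then show ?thesis using rec[of n \<omega>] step that Z[OF that] by simp
    qed
    ultimately show ?case by (intro bexI[of _ ?F] ballI)
  qed
  then obtain F where F[measurable]: "F \<in> PiM {1..n} (\<lambda>_. S) \<rightarrow>\<^sub>M T"
    and Z: "\<And>\<omega>. \<omega> \<in> space M \<Longrightarrow> Z n \<omega> = F (restrict (\<lambda>i. X i \<omega>) {1..n})"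
    by blast
  let ?A = "PiM {1..n} (\<lambda>_. S)" and ?B = "PiM {n + 1} (\<lambda>_. S)"
  let ?a = "\<lambda>\<omega>. restrict (\<lambda>i. X i \<omega>) {1..n}" and ?b = "\<lambda>\<omega>. restrict (\<lambda>i. X i \<omega>) {n + 1}"
  let ?H = "\<lambda>(p, q). (F p, q (n + 1))"
  have "indep_var ?A ?a ?B ?b"
    by (rule indep_var_restrict[OF indep]) auto
  then have a_meas [measurable]: "?a \<in> M \<rightarrow>\<^sub>M ?A" and b_meas [measurable]: "?b \<in> M \<rightarrow>\<^sub>M ?B"
    and ab: "distr M ?A ?a \<Otimes>\<^sub>M distr M ?B ?b = distr M (?A \<Otimes>\<^sub>M ?B) (\<lambda>\<omega>. (?a \<omega>, ?b \<omega>))"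
    unfolding indep_var_distribution_eq by auto
  have c_meas [measurable]: "(\<lambda>f. f (n + 1)) \<in> ?B \<rightarrow>\<^sub>M S"
    by (rule measurable_component_singleton) simp
  have X: "X (n + 1) = (\<lambda>\<omega>. ?b \<omega> (n + 1))" by simp
  have X_meas [measurable]: "X (n + 1) \<in> M \<rightarrow>\<^sub>M S" by (subst X) measurable
  have "(\<lambda>\<omega>. F (?a \<omega>)) \<in> M \<rightarrow>\<^sub>M T" by (rule measurable_compose[OF a_meas F])
  then show ?meas by (simp add: Z cong: measurable_cong)
  have dZ: "distr (distr M ?A ?a) T F = distr M T (Z n)"
    unfolding distr_distr[OF F a_meas] by (intro distr_cong) (simp_all add: Z)
  have dX: "distr (distr M ?B ?b) S (\<lambda>q. q (n + 1)) = distr M S (X (n + 1))"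
    unfolding distr_distr[OF c_meas b_meas] by (simp add: o_def)
  have "distr M T (Z n) \<Otimes>\<^sub>M distr M S (X (n + 1))
      = distr (distr M ?A ?a) T F \<Otimes>\<^sub>M distr (distr M ?B ?b) S (\<lambda>q. q (n + 1))"
    unfolding dZ dX ..
  also have "\<dots> = distr (distr M ?A ?a \<Otimes>\<^sub>M distr M ?B ?b) (T \<Otimes>\<^sub>M S) ?H"
  proof (rule pair_measure_distr)
    have "prob_space (distr M S (X (n + 1)))" by (rule prob_space_distr) measurable
    then show "sigma_finite_measure (distr (distr M ?B ?b) S (\<lambda>q. q (n + 1)))"
      unfolding dX by (rule prob_space_imp_sigma_finite)
  qed (simp_all only: measurable_distr_eq1 F c_meas)
  also have "\<dots> = distr M (T \<Otimes>\<^sub>M S) (\<lambda>\<omega>. ?H (?a \<omega>, ?b \<omega>))"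
    unfolding ab by (subst distr_distr) (measurable, simp add: o_def)
  also have "\<dots> = distr M (T \<Otimes>\<^sub>M S) (\<lambda>\<omega>. (Z n \<omega>, X (n + 1) \<omega>))"
    by (intro distr_cong) (simp_all add: Z)
  finally show ?eq ..
qed

section \<open>The abstract projected algorithm and its state\<close>

locale projected_robbins_monro = prob_space M for M :: "'c measure" +
  fixes P :: "'x::euclidean_space measure" and X :: "nat \<Rightarrow> 'c \<Rightarrow> 'x"
    and g :: "'x \<Rightarrow> 'e::euclidean_space \<Rightarrow> 'e" and L :: "'e \<Rightarrow> 'e"
    and K :: "'e set" and \<theta> :: 'e and proj :: "'e \<Rightarrow> 'e"
    and c \<alpha> \<kappa> B \<rho> R :: real and \<theta>\<^sub>1 :: 'e and Z :: "nat \<Rightarrow> 'c \<Rightarrow> 'e"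
  assumes indep: "indep_vars (\<lambda>_. borel) X {1..}"
    and law: "\<And>n. n \<ge> 1 \<Longrightarrow> distr M borel (X n) = P"
    and g_measurable [measurable]: "(\<lambda>(x, y). g x y) \<in> borel_measurable (borel \<Otimes>\<^sub>M borel)"
    and bounded_K: "bounded K"
    and \<rho>: "\<rho> > 0" "ball \<theta> \<rho> \<subseteq> K"
    and proj_in: "\<And>y. proj y \<in> K"
    and proj_id: "\<And>y. y \<in> K \<Longrightarrow> proj y = y"
    and proj_nonexpansive: "\<And>y y'. norm (proj y - proj y') \<le> norm (y - y')"
    and moment_integrable: "\<And>y. y \<in> K \<Longrightarrow> integrable P (\<lambda>x. norm (g x y) ^ 4)"
    and moment: "\<And>y. y \<in> K \<Longrightarrow> (\<integral>x. norm (g x y) ^ 4 \<partial>P) \<le> B"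
    and \<kappa>: "\<kappa> > 0"
    and monotone: "\<And>y. y \<in> K \<Longrightarrow> (\<integral>x. g x y \<partial>P) \<bullet> (y - \<theta>) \<ge> \<kappa> * (norm (y - \<theta>))\<^sup>2"
    and L: "linear L"
    and linearization: "\<And>y. y \<in> K \<Longrightarrow>
      norm ((\<integral>x. g x y \<partial>P) - L (y - \<theta>)) \<le> R * (norm (y - \<theta>))\<^sup>2"
    and c: "c > 0" and \<alpha>: "1 / 2 < \<alpha>" "\<alpha> < 1"
    and \<theta>\<^sub>1: "\<theta>\<^sub>1 \<in> K"
    and Z_1: "\<And>\<omega>. \<omega> \<in> space M \<Longrightarrow> Z 1 \<omega> = \<theta>\<^sub>1"
    and Z_Suc: "\<And>n \<omega>. n \<ge> 1 \<Longrightarrow> \<omega> \<in> space M \<Longrightarrow>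
      Z (n + 1) \<omega> = proj (Z n \<omega> - (c * real n powr - \<alpha>) *\<^sub>R g (X (n + 1) \<omega>) (Z n \<omega>))"
begin

definition \<gamma> :: "nat \<Rightarrow> real" where "\<gamma> n = c * real n powr - \<alpha>"

definition \<Phi> :: "'e \<Rightarrow> 'e" where "\<Phi> y = (\<integral>x. g x y \<partial>P)"

definition G :: "nat \<Rightarrow> 'c \<Rightarrow> 'e" where "G n \<omega> = g (X (n + 1) \<omega>) (Z n \<omega>)"

text \<open>Stopping at n - 1 makes \<open>S n\<close> a function of the samples with index at most
  n, because \<open>G k\<close> uses \<open>X (k + 1)\<close>. Hence \<open>S n\<close> is
  independent of the sample that enters \<open>G n\<close>.\<close>

definition S :: "nat \<Rightarrow> 'c \<Rightarrow> 'e" where "S n \<omega> = (\<Sum>k=1..<n. G k \<omega> - \<Phi> (Z k \<omega>))"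

lemma X_measurable [measurable]: "n \<ge> 1 \<Longrightarrow> X n \<in> borel_measurable M"
  using indep unfolding indep_vars_def2 by auto

lemma sets_P [measurable_cong, simp]: "sets P = sets borel"
  using law[of 1] by (metis order_refl sets_distr)

lemma prob_space_P: "prob_space P"
  using law[of 1] prob_space_distr[OF X_measurable[of 1]] by simp

sublocale P: prob_space P by (rule prob_space_P)

lemma g_measurable' [measurable]:
  assumes "f \<in> borel_measurable A" "h \<in> borel_measurable A"
  shows "(\<lambda>x. g (f x) (h x)) \<in> borel_measurable A"
  using measurable_compose[OF measurable_Pair[OF assms] g_measurable] by simp

lemma \<Phi>_measurable [measurable]: "\<Phi> \<in> borel_measurable borel"
  unfolding \<Phi>_def by measurable

lemma proj_measurable [measurable]: "proj \<in> borel_measurable borel"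
proof (rule borel_measurable_continuous_onI)
  show "continuous_on UNIV proj"
    by (rule lipschitz_on_continuous_on[of 1])
       (auto simp: lipschitz_on_def dist_norm proj_nonexpansive)
qed

lemma Z_in_K: "n \<ge> 1 \<Longrightarrow> \<omega> \<in> space M \<Longrightarrow> Z n \<omega> \<in> K"
proof (induction n rule: dec_induct)
  case (step n)
  then show ?case using Z_Suc[of n \<omega>] proj_in by simp
qed (simp add: Z_1 \<theta>\<^sub>1 del: One_nat_def)

lemma theta_in_K: "\<theta> \<in> K"
  using \<rho> by auto

lemma
  assumes "n \<ge> 1"
  shows state_measurable: "(\<lambda>\<omega>. (Z n \<omega>, S n \<omega>)) \<in> borel_measurable M"
    and state_indep: "distr M (borel \<Otimes>\<^sub>M borel) (\<lambda>\<omega>. ((Z n \<omega>, S n \<omega>), X (n + 1) \<omega>))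
      = distr M borel (\<lambda>\<omega>. (Z n \<omega>, S n \<omega>)) \<Otimes>\<^sub>M P"
proof -
  \<comment> \<open>Iterate and noise sum together follow one recursion driven by the fresh sample,
    so they are jointly independent of \<open>X (n + 1)\<close>; orthogonality of the noise
    increments needs this for the sum.\<close>
  let ?\<Psi> = "\<lambda>n (z, s) x. (proj (z - \<gamma> n *\<^sub>R g x z), s + (g x z - \<Phi> z))"
  have \<Psi>: "(\<lambda>(z, x). ?\<Psi> n z x) \<in> borel \<Otimes>\<^sub>M borel \<rightarrow>\<^sub>M borel" for n
    by (simp add: borel_prod[symmetric] case_prod_beta')
  have init: "(Z 1 \<omega>, S 1 \<omega>) = (\<theta>\<^sub>1, 0)" if "\<omega> \<in> space M" for \<omega>
    using Z_1[OF that] by (simp add: S_def)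
  have step: "(Z (n + 1) \<omega>, S (n + 1) \<omega>) = ?\<Psi> n (Z n \<omega>, S n \<omega>) (X (n + 1) \<omega>)"
    if "n \<ge> 1" "\<omega> \<in> space M" for n \<omega>
    using Z_Suc[OF that] that by (simp add: S_def G_def \<gamma>_def)
  note * = recursive_state_indep[where Z="\<lambda>n \<omega>. (Z n \<omega>, S n \<omega>)" and T=borel and \<Psi>="?\<Psi>"
      and n=n, OF indep \<Psi> _ init step assms]
  show "(\<lambda>\<omega>. (Z n \<omega>, S n \<omega>)) \<in> borel_measurable M" using *(1) by simp
  show "distr M (borel \<Otimes>\<^sub>M borel) (\<lambda>\<omega>. ((Z n \<omega>, S n \<omega>), X (n + 1) \<omega>))
      = distr M borel (\<lambda>\<omega>. (Z n \<omega>, S n \<omega>)) \<Otimes>\<^sub>M P"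
    using *(2) law[of "n + 1"] by simp
qed

lemma Z_measurable [measurable]: "n \<ge> 1 \<Longrightarrow> Z n \<in> borel_measurable M"
  using measurable_compose[OF state_measurable, of n fst borel]
  by (simp add: borel_measurable_continuous_onI continuous_on_fst continuous_on_id)

lemma S_measurable [measurable]: "n \<ge> 1 \<Longrightarrow> S n \<in> borel_measurable M"
  using measurable_compose[OF state_measurable, of n snd borel]
  by (simp add: borel_measurable_continuous_onI continuous_on_snd continuous_on_id)

lemma G_measurable [measurable]: "n \<ge> 1 \<Longrightarrow> G n \<in> borel_measurable M"
  unfolding G_def by measurable

text \<open>The product form of the joint law lets Tonelli integrate out the fresh sample with the
  state frozen, in place of conditioning on the past. The version for nonnegative integrands is also
  what establishes integrability later.\<close>

lemma nn_integral_fresh: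
  assumes n: "n \<ge> 1" and [measurable]: "\<phi> \<in> borel_measurable (borel \<Otimes>\<^sub>M borel)"
  shows "(\<integral>\<^sup>+\<omega>. \<phi> ((Z n \<omega>, S n \<omega>), X (n + 1) \<omega>) \<partial>M)
    = (\<integral>\<^sup>+\<omega>. \<integral>\<^sup>+x. \<phi> ((Z n \<omega>, S n \<omega>), x) \<partial>P \<partial>M)"
proof -
  note [measurable] = state_measurable[OF n]
  have [measurable]: "\<phi> \<in> borel_measurable (borel \<Otimes>\<^sub>M P)" by simp
  have "(\<integral>\<^sup>+\<omega>. \<phi> ((Z n \<omega>, S n \<omega>), X (n + 1) \<omega>) \<partial>M)
      = (\<integral>\<^sup>+p. \<phi> p \<partial>distr M (borel \<Otimes>\<^sub>M borel) (\<lambda>\<omega>. ((Z n \<omega>, S n \<omega>), X (n + 1) \<omega>)))"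
    by (subst nn_integral_distr) auto
  also have "\<dots> = (\<integral>\<^sup>+s. \<integral>\<^sup>+x. \<phi> (s, x) \<partial>P \<partial>distr M borel (\<lambda>\<omega>. (Z n \<omega>, S n \<omega>)))"
    unfolding state_indep[OF n]
    by (subst P.nn_integral_fst) (auto cong: measurable_cong_sets)
  also have "\<dots> = (\<integral>\<^sup>+\<omega>. \<integral>\<^sup>+x. \<phi> ((Z n \<omega>, S n \<omega>), x) \<partial>P \<partial>M)"
    by (subst nn_integral_distr) auto
  finally show ?thesis .
qed

lemma integral_fresh:
  fixes \<phi> :: "('e \<times> 'e) \<times> 'x \<Rightarrow> real"
  assumes n: "n \<ge> 1" and [measurable]: "\<phi> \<in> borel_measurable (borel \<Otimes>\<^sub>M borel)"
    and int: "integrable M (\<lambda>\<omega>. \<phi> ((Z n \<omega>, S n \<omega>), X (n + 1) \<omega>))"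
  shows "(\<integral>\<omega>. \<phi> ((Z n \<omega>, S n \<omega>), X (n + 1) \<omega>) \<partial>M)
    = (\<integral>\<omega>. \<integral>x. \<phi> ((Z n \<omega>, S n \<omega>), x) \<partial>P \<partial>M)"
    and "integrable M (\<lambda>\<omega>. \<integral>x. \<phi> ((Z n \<omega>, S n \<omega>), x) \<partial>P)"
proof -
  note [measurable] = state_measurable[OF n]
  let ?Q = "distr M borel (\<lambda>\<omega>. (Z n \<omega>, S n \<omega>))"
  interpret Q: prob_space ?Q by (rule prob_space_distr) fact
  interpret QP: pair_sigma_finite ?Q P ..
  have "integrable (distr M (borel \<Otimes>\<^sub>M borel) (\<lambda>\<omega>. ((Z n \<omega>, S n \<omega>), X (n + 1) \<omega>))) \<phi>"
    using int by (subst integrable_distr_eq) auto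
  then have i: "integrable (?Q \<Otimes>\<^sub>M P) \<phi>" unfolding state_indep[OF n] .
  have "(\<integral>\<omega>. \<phi> ((Z n \<omega>, S n \<omega>), X (n + 1) \<omega>) \<partial>M)
      = (\<integral>p. \<phi> p \<partial>distr M (borel \<Otimes>\<^sub>M borel) (\<lambda>\<omega>. ((Z n \<omega>, S n \<omega>), X (n + 1) \<omega>)))"
    by (subst integral_distr) auto
  also have "\<dots> = (\<integral>s. \<integral>x. \<phi> (s, x) \<partial>P \<partial>?Q)"
    unfolding state_indep[OF n] by (rule QP.integral_fst'[OF i, symmetric])
  also have "\<dots> = (\<integral>\<omega>. \<integral>x. \<phi> ((Z n \<omega>, S n \<omega>), x) \<partial>P \<partial>M)"
    by (subst integral_distr) (auto intro!: P.borel_measurable_lebesgue_integral)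
  finally show "(\<integral>\<omega>. \<phi> ((Z n \<omega>, S n \<omega>), X (n + 1) \<omega>) \<partial>M)
    = (\<integral>\<omega>. \<integral>x. \<phi> ((Z n \<omega>, S n \<omega>), x) \<partial>P \<partial>M)" .
  have "integrable ?Q (\<lambda>s. \<integral>x. \<phi> (s, x) \<partial>P)"
    using QP.integrable_fst'[OF i] .
  then show "integrable M (\<lambda>\<omega>. \<integral>x. \<phi> ((Z n \<omega>, S n \<omega>), x) \<partial>P)"
    by (subst (asm) integrable_distr_eq) (auto intro!: P.borel_measurable_lebesgue_integral)
qed

end

text \<open>The cross term is kept exact because its mean is the drift. The remaining terms are
  absorbed by Young's inequality into 2 kappa gamma |T|^4 and a cubic term in gamma. The drift
  contributes at most -4 kappa gamma E|T|^4, so half of it survives.\<close>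

lemma norm_diff_power4_le:
  fixes T G :: "'e::real_inner"
  assumes \<gamma>: "0 < \<gamma>" "\<gamma> \<le> c" and \<kappa>: "\<kappa> > 0"
  shows "norm (T - \<gamma> *\<^sub>R G) ^ 4 \<le> (1 + 2 * \<kappa> * \<gamma>) * norm T ^ 4
    - 4 * \<gamma> * ((norm T)\<^sup>2 * (T \<bullet> G)) + (8 / \<kappa> + 3 * c) * \<gamma> ^ 3 * norm G ^ 4"
proof -
  define t u p where "t = norm T" and "u = norm G" and "p = T \<bullet> G"
  have tu: "t \<ge> 0" "u \<ge> 0" "\<bar>p\<bar> \<le> t * u"
    unfolding t_def u_def p_def by (auto intro: Cauchy_Schwarz_ineq2)
  have "(norm (T - \<gamma> *\<^sub>R G))\<^sup>2 = t\<^sup>2 - 2 * \<gamma> * p + \<gamma>\<^sup>2 * u\<^sup>2"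
    unfolding t_def u_def p_def power2_norm_eq_inner
    by (simp add: inner_diff_left inner_diff_right inner_commute power2_eq_square algebra_simps)
  then have "norm (T - \<gamma> *\<^sub>R G) ^ 4 = (t\<^sup>2 - 2 * \<gamma> * p + \<gamma>\<^sup>2 * u\<^sup>2)\<^sup>2"
    by (metis power_even_eq mult_2 numeral_Bit0)
  also have "\<dots> = t ^ 4 - 4 * \<gamma> * (t\<^sup>2 * p) + 4 * \<gamma>\<^sup>2 * p\<^sup>2 + 2 * \<gamma>\<^sup>2 * t\<^sup>2 * u\<^sup>2
      + \<gamma> ^ 4 * u ^ 4 + 4 * \<gamma> ^ 3 * u\<^sup>2 * (- p)"
    by algebra
  also have "\<dots> \<le> t ^ 4 - 4 * \<gamma> * (t\<^sup>2 * p) + 4 * \<gamma>\<^sup>2 * (t * u)\<^sup>2 + 2 * \<gamma>\<^sup>2 * t\<^sup>2 * u\<^sup>2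
      + \<gamma> ^ 4 * u ^ 4 + 4 * \<gamma> ^ 3 * u\<^sup>2 * (t * u)"
  proof -
    have "p\<^sup>2 \<le> (t * u)\<^sup>2" using tu by (metis abs_ge_zero power2_abs power_mono)
    then have "4 * \<gamma>\<^sup>2 * p\<^sup>2 \<le> 4 * \<gamma>\<^sup>2 * (t * u)\<^sup>2" by (intro mult_left_mono) auto
    moreover have "4 * \<gamma> ^ 3 * u\<^sup>2 * (- p) \<le> 4 * \<gamma> ^ 3 * u\<^sup>2 * (t * u)"
      using tu \<gamma> by (intro mult_left_mono) auto
    ultimately show ?thesis by linarith
  qed
  \<comment> \<open>The square is chosen so that -2 times it contains the mixed term 4 gamma^3 t
    u^3; dropping it bounds that term by 2 gamma^2 t^2 u^2 + 2 gamma^4 u^4.\<close>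
  also have "\<dots> = t ^ 4 - 4 * \<gamma> * (t\<^sup>2 * p) + 8 * \<gamma>\<^sup>2 * t\<^sup>2 * u\<^sup>2 + 3 * \<gamma> ^ 4 * u ^ 4
      - 2 * (\<gamma> * t * u - \<gamma>\<^sup>2 * u\<^sup>2)\<^sup>2"
    by algebra
  also have "\<dots> \<le> t ^ 4 - 4 * \<gamma> * (t\<^sup>2 * p) + 8 * \<gamma>\<^sup>2 * t\<^sup>2 * u\<^sup>2 + 3 * \<gamma> ^ 4 * u ^ 4"
    by simp
  \<comment> \<open>Weighted Young inequality: the square of kappa t^2 - 2 gamma u^2, scaled by 2
    gamma / kappa, puts exactly 2 kappa gamma in front of t^4.\<close>
  also have "8 * \<gamma>\<^sup>2 * t\<^sup>2 * u\<^sup>2 \<le> 2 * \<kappa> * \<gamma> * t ^ 4 + 8 / \<kappa> * \<gamma> ^ 3 * u ^ 4"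
  proof -
    have "0 \<le> 2 * \<gamma> / \<kappa> * (\<kappa> * t\<^sup>2 - 2 * \<gamma> * u\<^sup>2)\<^sup>2" using \<gamma> \<kappa> by simp
    also have "\<dots> = 2 * \<kappa> * \<gamma> * t ^ 4 + 8 / \<kappa> * \<gamma> ^ 3 * u ^ 4 - 8 * \<gamma>\<^sup>2 * t\<^sup>2 * u\<^sup>2"
      using \<kappa> by (simp add: field_simps power2_eq_square power3_eq_cube power4_eq_xxxx)
    finally show ?thesis by simp
  qed
  also have "3 * \<gamma> ^ 4 * u ^ 4 \<le> 3 * c * \<gamma> ^ 3 * u ^ 4"
  proof -
    have "\<gamma> * (\<gamma> ^ 3 * u ^ 4) \<le> c * (\<gamma> ^ 3 * u ^ 4)" using \<gamma> by (intro mult_right_mono) auto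
    then show ?thesis by (simp add: power4_eq_xxxx power3_eq_cube mult_ac)
  qed
  finally show ?thesis unfolding t_def u_def p_def by (simp add: algebra_simps)
qed

section \<open>Sums with mean square of order n\<close>

text \<open>The constant is quantified inside the predicate, so that the error sums can be added and
  subtracted without tracking a constant for each of them.\<close>

definition linear_second_moment :: "'a measure \<Rightarrow> (nat \<Rightarrow> 'a \<Rightarrow> 'e::euclidean_space) \<Rightarrow> bool" where
  "linear_second_moment M Y \<longleftrightarrow> (\<exists>C. \<forall>n\<ge>1. Y n \<in> borel_measurable M \<and>
     integrable M (\<lambda>\<omega>. (norm (Y n \<omega>))\<^sup>2) \<and> (\<integral>\<omega>. (norm (Y n \<omega>))\<^sup>2 \<partial>M) \<le> C * real n)"

lemma norm_add_squared_le:
  "(norm (a + b))\<^sup>2 \<le> 2 * (norm a)\<^sup>2 + 2 * (norm (b :: 'e::real_normed_vector))\<^sup>2"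
proof -
  have "(norm (a + b))\<^sup>2 \<le> (norm a + norm b)\<^sup>2" by (intro power_mono norm_triangle_ineq) simp
  also have "\<dots> \<le> 2 * (norm a)\<^sup>2 + 2 * (norm b)\<^sup>2"
    using sum_squares_bound[of "norm a" "norm b"] by (simp add: power2_sum)
  finally show ?thesis .
qed

lemma linear_second_moment_add:
  assumes "linear_second_moment M Y" "linear_second_moment M Y'"
  shows "linear_second_moment M (\<lambda>n \<omega>. Y n \<omega> + Y' n \<omega>)"
proof -
  obtain C C' where Y: "\<And>n. n \<ge> 1 \<Longrightarrow> Y n \<in> borel_measurable M"
      "\<And>n. n \<ge> 1 \<Longrightarrow> integrable M (\<lambda>\<omega>. (norm (Y n \<omega>))\<^sup>2)"
      "\<And>n. n \<ge> 1 \<Longrightarrow> (\<integral>\<omega>. (norm (Y n \<omega>))\<^sup>2 \<partial>M) \<le> C * real n"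
    and Y': "\<And>n. n \<ge> 1 \<Longrightarrow> Y' n \<in> borel_measurable M"
      "\<And>n. n \<ge> 1 \<Longrightarrow> integrable M (\<lambda>\<omega>. (norm (Y' n \<omega>))\<^sup>2)"
      "\<And>n. n \<ge> 1 \<Longrightarrow> (\<integral>\<omega>. (norm (Y' n \<omega>))\<^sup>2 \<partial>M) \<le> C' * real n"
    using assms unfolding linear_second_moment_def by blast
  have "(\<lambda>\<omega>. Y n \<omega> + Y' n \<omega>) \<in> borel_measurable M \<and>
      integrable M (\<lambda>\<omega>. (norm (Y n \<omega> + Y' n \<omega>))\<^sup>2) \<and>
      (\<integral>\<omega>. (norm (Y n \<omega> + Y' n \<omega>))\<^sup>2 \<partial>M) \<le> (2 * C + 2 * C') * real n" if n: "n \<ge> 1" for n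
  proof (intro conjI)
    note [measurable] = Y(1)[OF n] Y'(1)[OF n]
    have b: "integrable M (\<lambda>\<omega>. 2 * (norm (Y n \<omega>))\<^sup>2 + 2 * (norm (Y' n \<omega>))\<^sup>2)"
      using Y(2)[OF n] Y'(2)[OF n] by simp
    show "(\<lambda>\<omega>. Y n \<omega> + Y' n \<omega>) \<in> borel_measurable M" by measurable
    show i: "integrable M (\<lambda>\<omega>. (norm (Y n \<omega> + Y' n \<omega>))\<^sup>2)"
      by (rule Bochner_Integration.integrable_bound[OF b])
         (auto intro!: order_trans[OF norm_add_squared_le])
    have "(\<integral>\<omega>. (norm (Y n \<omega> + Y' n \<omega>))\<^sup>2 \<partial>M)
        \<le> (\<integral>\<omega>. 2 * (norm (Y n \<omega>))\<^sup>2 + 2 * (norm (Y' n \<omega>))\<^sup>2 \<partial>M)"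
      by (intro integral_mono i b norm_add_squared_le)
    also have "\<dots> \<le> (2 * C + 2 * C') * real n"
      using Y(2,3)[OF n] Y'(2,3)[OF n] by (simp add: algebra_simps)
    finally show "(\<integral>\<omega>. (norm (Y n \<omega> + Y' n \<omega>))\<^sup>2 \<partial>M) \<le> (2 * C + 2 * C') * real n" .
  qed
  then show ?thesis unfolding linear_second_moment_def by blast
qed

lemma linear_second_moment_uminus:
  assumes "linear_second_moment M Y"
  shows "linear_second_moment M (\<lambda>n \<omega>. - Y n \<omega>)"
  using assms unfolding linear_second_moment_def by auto

lemma linear_second_moment_diff:
  assumes "linear_second_moment M Y" "linear_second_moment M Y'"
  shows "linear_second_moment M (\<lambda>n \<omega>. Y n \<omega> - Y' n \<omega>)"
  using linear_second_moment_add[OF assms(1) linear_second_moment_uminus[OF assms(2)]] by simp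

lemma linear_second_moment_sum:
  assumes "\<And>k. k \<ge> 1 \<Longrightarrow> a k \<in> borel_measurable M"
    and "\<And>k. k \<ge> 1 \<Longrightarrow> integrable M (\<lambda>\<omega>. (norm (a k \<omega>))\<^sup>2)"
    and "\<And>k. k \<ge> 1 \<Longrightarrow> (\<integral>\<omega>. (norm (a k \<omega>))\<^sup>2 \<partial>M) \<le> C / real k"
  shows "linear_second_moment M (\<lambda>n \<omega>. \<Sum>k=1..n. a k \<omega>)"
  unfolding linear_second_moment_def
  using second_moment_sum_le[of a M C, OF assms]
    borel_measurable_sum[of "{1.._}" a M] assms(1) by (intro exI[of _ "4 * C"]) auto

lemma square_le_one_plus_power4: "(a::real)\<^sup>2 \<le> 1 + a ^ 4"
proof -
  have "0 \<le> (a\<^sup>2 - 1)\<^sup>2 + 1 + (a\<^sup>2)\<^sup>2" by simp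
  moreover have "(a\<^sup>2)\<^sup>2 = a ^ 4" by simp
  ultimately show ?thesis by (simp add: power2_diff)
qed

lemma abs_le_one_plus_power4: "\<bar>a::real\<bar> \<le> 1 + a ^ 4"
proof (cases "\<bar>a\<bar> \<le> 1")
  case True
  have "0 \<le> a ^ 4" by simp
  with True show ?thesis by linarith
next
  case False
  then have "\<bar>a\<bar> ^ 1 \<le> \<bar>a\<bar> ^ 4" by (intro power_increasing) auto
  then show ?thesis by simp
qed

section \<open>Moments of the gradient samples and of the iterates\<close>

context projected_robbins_monro
begin

lemma \<gamma>_pos: "n \<ge> 1 \<Longrightarrow> \<gamma> n > 0"
  using c by (simp add: \<gamma>_def)

lemma \<gamma>_le: "n \<ge> 1 \<Longrightarrow> \<gamma> n \<le> c"
  using c \<alpha> powr_mono[of "- \<alpha>" 0 "real n"] by (simp add: \<gamma>_def)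

lemma B_nonneg: "B \<ge> 0"
  using moment[OF theta_in_K] by (intro order_trans[OF integral_nonneg_AE]) auto

lemma g_integrable:
  assumes "y \<in> K" shows "integrable P (\<lambda>x. g x y)"
  by (rule Bochner_Integration.integrable_bound[of P "\<lambda>x. 1 + norm (g x y) ^ 4"])
     (use moment_integrable[OF assms] abs_le_one_plus_power4[of "norm (g _ y)"] in auto)

lemma norm_\<Phi>_le:
  assumes "y \<in> K" shows "norm (\<Phi> y) \<le> 1 + B"
proof -
  have "norm (\<Phi> y) \<le> (\<integral>x. norm (g x y) \<partial>P)"
    unfolding \<Phi>_def by (rule integral_norm_bound)
  also have "\<dots> \<le> (\<integral>x. 1 + norm (g x y) ^ 4 \<partial>P)"
    using g_integrable[OF assms] moment_integrable[OF assms]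
      abs_le_one_plus_power4[of "norm (g _ y)"] by (intro integral_mono) auto
  also have "\<dots> \<le> 1 + B"
    using moment_integrable[OF assms] moment[OF assms] by (simp add: P.prob_space)
  finally show ?thesis .
qed

lemma K_bound: obtains b where "b > 0" "\<And>y. y \<in> K \<Longrightarrow> norm (y - \<theta>) \<le> b"
proof -
  obtain a where "\<And>y. y \<in> K \<Longrightarrow> norm y \<le> a"
    using bounded_K unfolding bounded_iff by blast
  then have "norm (y - \<theta>) \<le> \<bar>a\<bar> + norm \<theta> + 1" if "y \<in> K" for y
    using norm_triangle_ineq4[of y \<theta>] that by (smt (verit))
  then show ?thesis
    by (intro that[of "\<bar>a\<bar> + norm \<theta> + 1"]) (auto intro: add_nonneg_pos)
qed

lemma integrable_function_of_Z:
  fixes w :: "'e \<Rightarrow> real"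
  assumes "n \<ge> 1" and [measurable]: "w \<in> borel_measurable borel" and "\<And>y. y \<in> K \<Longrightarrow> \<bar>w y\<bar> \<le> b"
  shows "integrable M (\<lambda>\<omega>. w (Z n \<omega>))"
proof (rule integrable_const_bound[of _ b])
  note [measurable] = Z_measurable[OF \<open>n \<ge> 1\<close>]
  show "(\<lambda>\<omega>. w (Z n \<omega>)) \<in> borel_measurable M" by measurable
qed (use assms Z_in_K in auto)

lemma integrable_norm_Z_power:
  assumes "n \<ge> 1" shows "integrable M (\<lambda>\<omega>. norm (Z n \<omega> - \<theta>) ^ p)"
proof -
  obtain b where b: "b > 0" "\<And>y. y \<in> K \<Longrightarrow> norm (y - \<theta>) \<le> b" using K_bound by blast
  show ?thesis
    by (rule integrable_function_of_Z[OF assms, where b="b ^ p"]) (use b in \<open>auto intro: power_mono\<close>)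
qed

text \<open>With \<open>Z n\<close> frozen the weight is a constant and the fourth moment of
  \<open>g\<close> is at most \<open>B\<close>. Weights are allowed because the projection error
  leads to mixed moments of \<open>Z n\<close> and \<open>G n\<close>.\<close>

lemma
  fixes w :: "'e \<Rightarrow> real"
  assumes n: "n \<ge> 1" and [measurable]: "w \<in> borel_measurable borel"
    and w: "\<And>y. y \<in> K \<Longrightarrow> 0 \<le> w y" "\<And>y. y \<in> K \<Longrightarrow> w y \<le> b"
  shows integrable_weighted_G4: "integrable M (\<lambda>\<omega>. w (Z n \<omega>) * norm (G n \<omega>) ^ 4)"
    and weighted_G4_le:
      "(\<integral>\<omega>. w (Z n \<omega>) * norm (G n \<omega>) ^ 4 \<partial>M) \<le> B * (\<integral>\<omega>. w (Z n \<omega>) \<partial>M)"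
proof -
  note [measurable] = Z_measurable[OF n] G_measurable[OF n]
  have iw: "integrable M (\<lambda>\<omega>. w (Z n \<omega>))"
    by (rule integrable_function_of_Z[OF n, where b=b]) (use w in auto)
  have "(\<integral>\<^sup>+\<omega>. ennreal (w (Z n \<omega>) * norm (G n \<omega>) ^ 4) \<partial>M)
      = (\<integral>\<^sup>+\<omega>. \<integral>\<^sup>+x. ennreal (w (Z n \<omega>) * norm (g x (Z n \<omega>)) ^ 4) \<partial>P \<partial>M)"
    using nn_integral_fresh[OF n,
        of "\<lambda>p. ennreal (w (fst (fst p)) * norm (g (snd p) (fst (fst p))) ^ 4)"]
    by (simp add: G_def borel_prod[symmetric])
  also have "\<dots> \<le> (\<integral>\<^sup>+\<omega>. ennreal (B * w (Z n \<omega>)) \<partial>M)"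
  proof (intro nn_integral_mono)
    fix \<omega> assume "\<omega> \<in> space M"
    then have zK: "Z n \<omega> \<in> K" using Z_in_K n by blast
    have "(\<integral>\<^sup>+x. ennreal (w (Z n \<omega>) * norm (g x (Z n \<omega>)) ^ 4) \<partial>P)
        = ennreal (\<integral>x. w (Z n \<omega>) * norm (g x (Z n \<omega>)) ^ 4 \<partial>P)"
      using moment_integrable[OF zK] w(1)[OF zK] by (intro nn_integral_eq_integral) auto
    also have "\<dots> \<le> ennreal (B * w (Z n \<omega>))"
      using mult_right_mono[OF moment[OF zK] w(1)[OF zK]] by (intro ennreal_leI) (simp add: mult_ac)
    finally show "(\<integral>\<^sup>+x. ennreal (w (Z n \<omega>) * norm (g x (Z n \<omega>)) ^ 4) \<partial>P) \<le> ennreal (B * w (Z n \<omega>))" .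
  qed
  also have eq: "\<dots> = ennreal (B * (\<integral>\<omega>. w (Z n \<omega>) \<partial>M))"
    using iw w Z_in_K n B_nonneg by (subst nn_integral_eq_integral) auto
  finally have le: "(\<integral>\<^sup>+\<omega>. ennreal (w (Z n \<omega>) * norm (G n \<omega>) ^ 4) \<partial>M)
      \<le> ennreal (B * (\<integral>\<omega>. w (Z n \<omega>) \<partial>M))" .
  show i: "integrable M (\<lambda>\<omega>. w (Z n \<omega>) * norm (G n \<omega>) ^ 4)"
    by (rule integrableI_nonneg) (use w Z_in_K n le_less_trans[OF le] in auto)
  have "ennreal (\<integral>\<omega>. w (Z n \<omega>) * norm (G n \<omega>) ^ 4 \<partial>M) \<le> ennreal (B * (\<integral>\<omega>. w (Z n \<omega>) \<partial>M))"
    using le i w Z_in_K n by (subst (asm) nn_integral_eq_integral) auto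
  moreover have "0 \<le> B * (\<integral>\<omega>. w (Z n \<omega>) \<partial>M)"
    using B_nonneg w Z_in_K n by (intro mult_nonneg_nonneg integral_nonneg_AE) auto
  ultimately show "(\<integral>\<omega>. w (Z n \<omega>) * norm (G n \<omega>) ^ 4 \<partial>M) \<le> B * (\<integral>\<omega>. w (Z n \<omega>) \<partial>M)"
    by (simp add: ennreal_le_iff)
qed

lemma
  fixes w :: "'e \<Rightarrow> real"
  assumes n: "n \<ge> 1" and [measurable]: "w \<in> borel_measurable borel"
    and w: "\<And>y. y \<in> K \<Longrightarrow> 0 \<le> w y" "\<And>y. y \<in> K \<Longrightarrow> w y \<le> b"
  shows integrable_weighted_G2: "integrable M (\<lambda>\<omega>. w (Z n \<omega>) * (norm (G n \<omega>))\<^sup>2)"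
    and weighted_G2_le:
      "(\<integral>\<omega>. w (Z n \<omega>) * (norm (G n \<omega>))\<^sup>2 \<partial>M) \<le> (1 + B) * (\<integral>\<omega>. w (Z n \<omega>) \<partial>M)"
proof -
  note [measurable] = Z_measurable[OF n] G_measurable[OF n]
  have iw: "integrable M (\<lambda>\<omega>. w (Z n \<omega>))"
    by (rule integrable_function_of_Z[OF n, where b=b]) (use w in auto)
  have i: "integrable M (\<lambda>\<omega>. w (Z n \<omega>) + w (Z n \<omega>) * norm (G n \<omega>) ^ 4)"
    using iw integrable_weighted_G4[OF n assms(2) w] by simp
  have le: "w (Z n \<omega>) * (norm (G n \<omega>))\<^sup>2 \<le> w (Z n \<omega>) + w (Z n \<omega>) * norm (G n \<omega>) ^ 4"
    if "\<omega> \<in> space M" for \<omega>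
    using mult_left_mono[OF square_le_one_plus_power4[of "norm (G n \<omega>)"] w(1)[OF Z_in_K[OF n that]]]
    by (simp add: algebra_simps)
  show i2: "integrable M (\<lambda>\<omega>. w (Z n \<omega>) * (norm (G n \<omega>))\<^sup>2)"
    by (rule Bochner_Integration.integrable_bound[OF i])
       (use w Z_in_K n le in \<open>auto simp: abs_mult intro!: AE_I2 order_trans[OF _ abs_ge_self]\<close>)
  have "(\<integral>\<omega>. w (Z n \<omega>) * (norm (G n \<omega>))\<^sup>2 \<partial>M)
      \<le> (\<integral>\<omega>. w (Z n \<omega>) + w (Z n \<omega>) * norm (G n \<omega>) ^ 4 \<partial>M)"
    using le by (intro integral_mono i i2) auto
  also have "\<dots> \<le> (1 + B) * (\<integral>\<omega>. w (Z n \<omega>) \<partial>M)"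
    using weighted_G4_le[OF n assms(2) w] iw integrable_weighted_G4[OF n assms(2) w]
    by (simp add: algebra_simps)
  finally show "(\<integral>\<omega>. w (Z n \<omega>) * (norm (G n \<omega>))\<^sup>2 \<partial>M) \<le> (1 + B) * (\<integral>\<omega>. w (Z n \<omega>) \<partial>M)" .
qed

lemma
  assumes n: "n \<ge> 1"
  shows integrable_G4: "integrable M (\<lambda>\<omega>. norm (G n \<omega>) ^ 4)"
    and G4_le: "(\<integral>\<omega>. norm (G n \<omega>) ^ 4 \<partial>M) \<le> B"
    and integrable_G2: "integrable M (\<lambda>\<omega>. (norm (G n \<omega>))\<^sup>2)"
    and G2_le: "(\<integral>\<omega>. (norm (G n \<omega>))\<^sup>2 \<partial>M) \<le> 1 + B"
  using integrable_weighted_G4[OF n, of "\<lambda>_. 1" 1] weighted_G4_le[OF n, of "\<lambda>_. 1" 1]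
    integrable_weighted_G2[OF n, of "\<lambda>_. 1" 1] weighted_G2_le[OF n, of "\<lambda>_. 1" 1]
  by (simp_all add: prob_space)

text \<open>This is the martingale property of \<open>G n\<close> minus \<open>\<Phi> (Z n)\<close>,
  tested against functions of the state: the drift estimate uses a function of \<open>Z n\<close>,
  the orthogonality of the noise increments uses \<open>S n\<close>.\<close>

lemma
  fixes v :: "'e \<times> 'e \<Rightarrow> 'e"
  assumes n: "n \<ge> 1" and [measurable]: "v \<in> borel_measurable borel"
    and i: "integrable M (\<lambda>\<omega>. v (Z n \<omega>, S n \<omega>) \<bullet> G n \<omega>)"
  shows integral_inner_G: "(\<integral>\<omega>. v (Z n \<omega>, S n \<omega>) \<bullet> G n \<omega> \<partial>M)
      = (\<integral>\<omega>. v (Z n \<omega>, S n \<omega>) \<bullet> \<Phi> (Z n \<omega>) \<partial>M)"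
    and integrable_inner_\<Phi>: "integrable M (\<lambda>\<omega>. v (Z n \<omega>, S n \<omega>) \<bullet> \<Phi> (Z n \<omega>))"
proof -
  let ?\<phi> = "\<lambda>p. v (fst p) \<bullet> g (snd p) (fst (fst p))"
  have [measurable]: "v \<in> borel_measurable (borel \<Otimes>\<^sub>M borel)"
    using assms(2) by (simp add: borel_prod)
  have "?\<phi> \<in> borel_measurable ((borel \<Otimes>\<^sub>M borel) \<Otimes>\<^sub>M borel)" by measurable
  then have [measurable]: "?\<phi> \<in> borel_measurable (borel \<Otimes>\<^sub>M borel)"
    by (simp add: borel_prod)
  have inner: "(\<integral>x. v (Z n \<omega>, S n \<omega>) \<bullet> g x (Z n \<omega>) \<partial>P) = v (Z n \<omega>, S n \<omega>) \<bullet> \<Phi> (Z n \<omega>)"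
    if "\<omega> \<in> space M" for \<omega>
    unfolding \<Phi>_def using g_integrable[OF Z_in_K[OF n that]] by simp
  have "(\<integral>\<omega>. v (Z n \<omega>, S n \<omega>) \<bullet> G n \<omega> \<partial>M) = (\<integral>\<omega>. \<integral>x. v (Z n \<omega>, S n \<omega>) \<bullet> g x (Z n \<omega>) \<partial>P \<partial>M)"
    using integral_fresh(1)[OF n, of ?\<phi>] i by (simp add: G_def)
  also have "\<dots> = (\<integral>\<omega>. v (Z n \<omega>, S n \<omega>) \<bullet> \<Phi> (Z n \<omega>) \<partial>M)"
    by (intro Bochner_Integration.integral_cong refl inner)
  finally show "(\<integral>\<omega>. v (Z n \<omega>, S n \<omega>) \<bullet> G n \<omega> \<partial>M) = (\<integral>\<omega>. v (Z n \<omega>, S n \<omega>) \<bullet> \<Phi> (Z n \<omega>) \<partial>M)" .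
  have "integrable M (\<lambda>\<omega>. \<integral>x. v (Z n \<omega>, S n \<omega>) \<bullet> g x (Z n \<omega>) \<partial>P)"
    using integral_fresh(2)[OF n, of ?\<phi>] i by (simp add: G_def)
  then show "integrable M (\<lambda>\<omega>. v (Z n \<omega>, S n \<omega>) \<bullet> \<Phi> (Z n \<omega>))"
    using inner by (simp cong: Bochner_Integration.integrable_cong)
qed

lemma fourth_moment_step:
  assumes n: "n \<ge> 1"
  shows "(\<integral>\<omega>. norm (Z (n + 1) \<omega> - \<theta>) ^ 4 \<partial>M)
    \<le> (1 - 2 * \<kappa> * \<gamma> n) * (\<integral>\<omega>. norm (Z n \<omega> - \<theta>) ^ 4 \<partial>M) + (8 / \<kappa> + 3 * c) * B * \<gamma> n ^ 3"
proof -
  note [measurable] = Z_measurable[OF n] G_measurable[OF n] S_measurable[OF n]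
  \<comment> \<open>Chosen so that its inner product with \<open>G n\<close> is the cross term of
    \<open>norm_diff_power4_le\<close>.\<close>
  let ?v = "\<lambda>p. (norm (fst p - \<theta>))\<^sup>2 *\<^sub>R (fst p - \<theta>) :: 'e"
  have [measurable]: "?v \<in> borel_measurable borel"
    by (auto intro!: borel_measurable_continuous_onI continuous_intros)
  let ?C = "8 / \<kappa> + 3 * c"
  have C: "?C > 0" using \<kappa> c by (simp add: add_pos_pos)
  obtain b where b: "b > 0" "\<And>y. y \<in> K \<Longrightarrow> norm (y - \<theta>) \<le> b" using K_bound by blast
  have iv: "integrable M (\<lambda>\<omega>. ?v (Z n \<omega>, S n \<omega>) \<bullet> G n \<omega>)"
  proof (rule Bochner_Integration.integrable_bound[of _ "\<lambda>\<omega>. b ^ 3 * (1 + norm (G n \<omega>) ^ 4)"])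
    show "integrable M (\<lambda>\<omega>. b ^ 3 * (1 + norm (G n \<omega>) ^ 4))"
      using integrable_G4[OF n] by simp
    show "AE \<omega> in M. norm (?v (Z n \<omega>, S n \<omega>) \<bullet> G n \<omega>) \<le> norm (b ^ 3 * (1 + norm (G n \<omega>) ^ 4))"
    proof (rule AE_I2)
      fix \<omega> assume "\<omega> \<in> space M"
      have "norm (?v (Z n \<omega>, S n \<omega>) \<bullet> G n \<omega>) \<le> norm (?v (Z n \<omega>, S n \<omega>)) * norm (G n \<omega>)"
        by (simp only: real_norm_def Cauchy_Schwarz_ineq2)
      also have "norm (?v (Z n \<omega>, S n \<omega>)) = norm (Z n \<omega> - \<theta>) ^ 3"
        by (simp add: power2_eq_square power3_eq_cube)
      also have "norm (Z n \<omega> - \<theta>) ^ 3 * norm (G n \<omega>) \<le> b ^ 3 * (1 + norm (G n \<omega>) ^ 4)"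
        using b Z_in_K[OF n \<open>\<omega> \<in> space M\<close>] abs_le_one_plus_power4[of "norm (G n \<omega>)"]
        by (intro mult_mono power_mono) auto
      also have "\<dots> \<le> norm (b ^ 3 * (1 + norm (G n \<omega>) ^ 4))" by simp
      finally show "norm (?v (Z n \<omega>, S n \<omega>) \<bullet> G n \<omega>) \<le> norm (b ^ 3 * (1 + norm (G n \<omega>) ^ 4))" .
    qed
  qed simp
  have drift: "\<kappa> * (\<integral>\<omega>. norm (Z n \<omega> - \<theta>) ^ 4 \<partial>M) \<le> (\<integral>\<omega>. ?v (Z n \<omega>, S n \<omega>) \<bullet> G n \<omega> \<partial>M)"
  proof -
    have "\<kappa> * (\<integral>\<omega>. norm (Z n \<omega> - \<theta>) ^ 4 \<partial>M) = (\<integral>\<omega>. \<kappa> * norm (Z n \<omega> - \<theta>) ^ 4 \<partial>M)" by simp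
    also have "\<dots> \<le> (\<integral>\<omega>. ?v (Z n \<omega>, S n \<omega>) \<bullet> \<Phi> (Z n \<omega>) \<partial>M)"
    proof (intro integral_mono)
      show "integrable M (\<lambda>\<omega>. ?v (Z n \<omega>, S n \<omega>) \<bullet> \<Phi> (Z n \<omega>))"
        by (rule integrable_inner_\<Phi>[OF n _ iv]) simp
      show "integrable M (\<lambda>\<omega>. \<kappa> * norm (Z n \<omega> - \<theta>) ^ 4)"
        using integrable_norm_Z_power[OF n] by simp
      fix \<omega> assume "\<omega> \<in> space M"
      then have "\<kappa> * (norm (Z n \<omega> - \<theta>))\<^sup>2 \<le> (Z n \<omega> - \<theta>) \<bullet> \<Phi> (Z n \<omega>)"
        using monotone[OF Z_in_K[OF n]] by (simp add: \<Phi>_def inner_commute)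
      then have "(norm (Z n \<omega> - \<theta>))\<^sup>2 * (\<kappa> * (norm (Z n \<omega> - \<theta>))\<^sup>2)
          \<le> (norm (Z n \<omega> - \<theta>))\<^sup>2 * ((Z n \<omega> - \<theta>) \<bullet> \<Phi> (Z n \<omega>))"
        by (intro mult_left_mono) auto
      then show "\<kappa> * norm (Z n \<omega> - \<theta>) ^ 4 \<le> ?v (Z n \<omega>, S n \<omega>) \<bullet> \<Phi> (Z n \<omega>)"
        by (simp add: power2_eq_square power4_eq_xxxx mult_ac)
    qed
    also have "\<dots> = (\<integral>\<omega>. ?v (Z n \<omega>, S n \<omega>) \<bullet> G n \<omega> \<partial>M)"
      by (rule integral_inner_G[OF n _ iv, symmetric]) simp
    finally show ?thesis .
  qed
  have "(\<integral>\<omega>. norm (Z (n + 1) \<omega> - \<theta>) ^ 4 \<partial>M)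
      \<le> (\<integral>\<omega>. (1 + 2 * \<kappa> * \<gamma> n) * norm (Z n \<omega> - \<theta>) ^ 4
          - 4 * \<gamma> n * (?v (Z n \<omega>, S n \<omega>) \<bullet> G n \<omega>) + ?C * \<gamma> n ^ 3 * norm (G n \<omega>) ^ 4 \<partial>M)"
  proof (intro integral_mono)
    show "integrable M (\<lambda>\<omega>. norm (Z (n + 1) \<omega> - \<theta>) ^ 4)"
      by (rule integrable_norm_Z_power) simp
    show "integrable M (\<lambda>\<omega>. (1 + 2 * \<kappa> * \<gamma> n) * norm (Z n \<omega> - \<theta>) ^ 4
          - 4 * \<gamma> n * (?v (Z n \<omega>, S n \<omega>) \<bullet> G n \<omega>) + ?C * \<gamma> n ^ 3 * norm (G n \<omega>) ^ 4)"
      by (intro Bochner_Integration.integrable_add Bochner_Integration.integrable_diff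
          integrable_mult_right integrable_norm_Z_power n iv integrable_G4)
    fix \<omega> assume \<omega>: "\<omega> \<in> space M"
    \<comment> \<open>\<open>\<theta>\<close> is a fixed point of \<open>proj\<close>, so
      non-expansiveness allows the projection to be dropped from the error.\<close>
    have "norm (Z (n + 1) \<omega> - \<theta>) = norm (proj (Z n \<omega> - \<gamma> n *\<^sub>R G n \<omega>) - proj \<theta>)"
      using Z_Suc[OF n \<omega>] by (simp add: proj_id theta_in_K \<gamma>_def G_def)
    also have "\<dots> \<le> norm (Z n \<omega> - \<theta> - \<gamma> n *\<^sub>R G n \<omega>)"
      using proj_nonexpansive[of "Z n \<omega> - \<gamma> n *\<^sub>R G n \<omega>" \<theta>] by (simp add: algebra_simps)
    finally have "norm (Z (n + 1) \<omega> - \<theta>) ^ 4 \<le> norm (Z n \<omega> - \<theta> - \<gamma> n *\<^sub>R G n \<omega>) ^ 4"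
      by (intro power_mono) auto
    also have "\<dots> \<le> (1 + 2 * \<kappa> * \<gamma> n) * norm (Z n \<omega> - \<theta>) ^ 4
          - 4 * \<gamma> n * ((norm (Z n \<omega> - \<theta>))\<^sup>2 * ((Z n \<omega> - \<theta>) \<bullet> G n \<omega>)) + ?C * \<gamma> n ^ 3 * norm (G n \<omega>) ^ 4"
      by (rule norm_diff_power4_le[OF \<gamma>_pos[OF n] \<gamma>_le[OF n] \<kappa>])
    finally show "norm (Z (n + 1) \<omega> - \<theta>) ^ 4 \<le> (1 + 2 * \<kappa> * \<gamma> n) * norm (Z n \<omega> - \<theta>) ^ 4
          - 4 * \<gamma> n * (?v (Z n \<omega>, S n \<omega>) \<bullet> G n \<omega>) + ?C * \<gamma> n ^ 3 * norm (G n \<omega>) ^ 4"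
      by simp
  qed
  also have "\<dots> = (1 + 2 * \<kappa> * \<gamma> n) * (\<integral>\<omega>. norm (Z n \<omega> - \<theta>) ^ 4 \<partial>M)
          - 4 * \<gamma> n * (\<integral>\<omega>. ?v (Z n \<omega>, S n \<omega>) \<bullet> G n \<omega> \<partial>M)
          + ?C * \<gamma> n ^ 3 * (\<integral>\<omega>. norm (G n \<omega>) ^ 4 \<partial>M)"
    using integrable_norm_Z_power[OF n, of 4] iv integrable_G4[OF n]
    by (subst Bochner_Integration.integral_add, simp, simp,
        subst Bochner_Integration.integral_diff, simp, simp, simp del: inner_scaleR_left)
  also have "\<dots> \<le> (1 + 2 * \<kappa> * \<gamma> n) * (\<integral>\<omega>. norm (Z n \<omega> - \<theta>) ^ 4 \<partial>M)
          - 4 * \<gamma> n * (\<kappa> * (\<integral>\<omega>. norm (Z n \<omega> - \<theta>) ^ 4 \<partial>M)) + ?C * \<gamma> n ^ 3 * B"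
    using drift G4_le[OF n] \<gamma>_pos[OF n] C by (intro add_mono diff_mono mult_left_mono order_refl) auto
  also have "\<dots> = (1 - 2 * \<kappa> * \<gamma> n) * (\<integral>\<omega>. norm (Z n \<omega> - \<theta>) ^ 4 \<partial>M) + ?C * B * \<gamma> n ^ 3"
    by (simp add: algebra_simps)
  finally show ?thesis .
qed

lemma fourth_moment_rate:
  "\<exists>D>0. \<forall>n\<ge>1. (\<integral>\<omega>. norm (Z n \<omega> - \<theta>) ^ 4 \<partial>M) \<le> D * (real n powr - \<alpha>)\<^sup>2"
proof -
  obtain b where b: "b > 0" "\<And>y. y \<in> K \<Longrightarrow> norm (y - \<theta>) \<le> b" using K_bound by blast
  have "(\<integral>\<omega>. norm (Z n \<omega> - \<theta>) ^ 4 \<partial>M) \<le> b ^ 4" if "n \<ge> 1" for n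
  proof -
    have "(\<integral>\<omega>. norm (Z n \<omega> - \<theta>) ^ 4 \<partial>M) \<le> (\<integral>\<omega>. b ^ 4 \<partial>M)"
      using b Z_in_K[OF that] integrable_norm_Z_power[OF that]
      by (intro integral_mono power_mono) auto
    then show ?thesis by (simp add: prob_space)
  qed
  moreover have "(8 / \<kappa> + 3 * c) * B \<ge> 0" using \<kappa> c B_nonneg by simp
  ultimately show ?thesis
    using \<alpha> \<kappa> c fourth_moment_step unfolding \<gamma>_def
    by (intro robbins_monro_rate[where a="2 * \<kappa>" and c=c and B="(8 / \<kappa> + 3 * c) * B" and S="b ^ 4"]) auto
qed


text \<open>Here alpha > 1/2 enters: it makes the squared step sizes, and with them the fourth
  moments of the error, O(1/n).\<close>

lemma powr_\<alpha>_squared_le: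
  assumes "n \<ge> 1" shows "(real n powr - \<alpha>)\<^sup>2 \<le> 1 / real n"
proof -
  have "(real n powr - \<alpha>)\<^sup>2 = real n powr (- 2 * \<alpha>)"
    using assms by (simp add: power2_eq_square flip: powr_add)
  also have "\<dots> \<le> real n powr - 1" using assms \<alpha> by (intro powr_mono) auto
  also have "\<dots> = 1 / real n" using assms by (simp add: powr_minus_divide)
  finally show ?thesis .
qed

text \<open>Young's inequality x^2 <= s + x^4 / s with s = n^(-alpha) transfers the rate of the
  fourth moment; s is chosen so that both summands have the same order.\<close>

lemma second_moment_rate:
  "\<exists>D>0. \<forall>n\<ge>1. (\<integral>\<omega>. (norm (Z n \<omega> - \<theta>))\<^sup>2 \<partial>M) \<le> D * real n powr - \<alpha>"
proof -
  obtain D where D: "D > 0"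
    "\<And>n. n \<ge> 1 \<Longrightarrow> (\<integral>\<omega>. norm (Z n \<omega> - \<theta>) ^ 4 \<partial>M) \<le> D * (real n powr - \<alpha>)\<^sup>2"
    using fourth_moment_rate by blast
  have "(\<integral>\<omega>. (norm (Z n \<omega> - \<theta>))\<^sup>2 \<partial>M) \<le> (1 + D) * real n powr - \<alpha>" if n: "n \<ge> 1" for n
  proof -
    define s where "s = real n powr - \<alpha>"
    have s: "s > 0" using n by (simp add: s_def)
    have "(\<integral>\<omega>. (norm (Z n \<omega> - \<theta>))\<^sup>2 \<partial>M) \<le> (\<integral>\<omega>. s + norm (Z n \<omega> - \<theta>) ^ 4 / s \<partial>M)"
    proof (intro integral_mono)
      fix \<omega>
      have "0 \<le> ((norm (Z n \<omega> - \<theta>))\<^sup>2 - s)\<^sup>2 + (norm (Z n \<omega> - \<theta>))\<^sup>2 * s" using s by simp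
      then have "(norm (Z n \<omega> - \<theta>))\<^sup>2 * s \<le> s * s + norm (Z n \<omega> - \<theta>) ^ 4"
        by (simp add: power2_eq_square power4_eq_xxxx algebra_simps)
      then show "(norm (Z n \<omega> - \<theta>))\<^sup>2 \<le> s + norm (Z n \<omega> - \<theta>) ^ 4 / s"
        using s by (simp add: field_simps)
    qed (use integrable_norm_Z_power[OF n] in auto)
    also have "\<dots> = s + (\<integral>\<omega>. norm (Z n \<omega> - \<theta>) ^ 4 \<partial>M) / s"
      using integrable_norm_Z_power[OF n] by (simp add: prob_space)
    also have "\<dots> \<le> s + D * s\<^sup>2 / s"
      using D(2)[OF n] s unfolding s_def by (intro add_left_mono divide_right_mono) auto
    also have "\<dots> = (1 + D) * s" using s by (simp add: power2_eq_square algebra_simps)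
    finally show ?thesis unfolding s_def .
  qed
  then show ?thesis using D(1) by (intro exI[of _ "1 + D"]) auto
qed

text \<open>Positive definiteness of \<open>L\<close> comes from the monotonicity of \<open>\<Phi>\<close> by letting the
  point approach \<open>\<theta>\<close> along a line.\<close>

lemma L_lower_bound: "\<kappa> / 2 * norm v \<le> norm (L v)"
proof (cases "v = 0")
  case False
  \<comment> \<open>The first bound keeps theta + t v inside the ball of radius rho. The second
    makes the linearization error, tested against t v, cost at most half of the monotonicity term
    kappa |t v|^2.\<close>
  define t where "t = min (\<rho> / (2 * norm v)) (\<kappa> / (2 * (\<bar>R\<bar> + 1) * norm v))"
  have v: "norm v > 0" using False by simp
  have t: "t > 0" using v \<rho> \<kappa> by (simp add: t_def)
  have "t * norm v \<le> \<rho> / (2 * norm v) * norm v" using v by (intro mult_right_mono) (auto simp: t_def)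
  then have tv: "t * norm v < \<rho>" using v \<rho> by simp
  have "t * norm v \<le> \<kappa> / (2 * (\<bar>R\<bar> + 1) * norm v) * norm v"
    using v by (intro mult_right_mono) (auto simp: t_def)
  also have "\<dots> = \<kappa> / (2 * (\<bar>R\<bar> + 1))" using v by simp
  finally have "(\<bar>R\<bar> + 1) * (t * norm v) \<le> (\<bar>R\<bar> + 1) * (\<kappa> / (2 * (\<bar>R\<bar> + 1)))"
    by (intro mult_left_mono) auto
  also have "\<dots> = \<kappa> / 2" by (simp add: field_simps)
  finally have "(\<bar>R\<bar> + 1) * (t * norm v) \<le> \<kappa> / 2" .
  moreover have "\<bar>R\<bar> * (t * norm v) \<le> (\<bar>R\<bar> + 1) * (t * norm v)"
    using t by (intro mult_right_mono) auto
  ultimately have Rt: "\<bar>R\<bar> * (t * norm v) \<le> \<kappa> / 2" by linarith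
  define y where "y = \<theta> + t *\<^sub>R v"
  have y: "y - \<theta> = t *\<^sub>R v" "norm (y - \<theta>) = t * norm v" using t by (auto simp: y_def)
  have yK: "y \<in> K" using \<rho> tv t by (auto simp: y_def dist_norm)
  have "\<kappa> * (t * norm v)\<^sup>2 \<le> \<Phi> y \<bullet> (y - \<theta>)"
    using monotone[OF yK] unfolding y(2) \<Phi>_def .
  also have "\<dots> = L (y - \<theta>) \<bullet> (y - \<theta>) + (\<Phi> y - L (y - \<theta>)) \<bullet> (y - \<theta>)"
    by (simp add: inner_diff_left)
  also have "\<dots> \<le> norm (L (y - \<theta>)) * norm (y - \<theta>) + norm (\<Phi> y - L (y - \<theta>)) * norm (y - \<theta>)"
    by (intro add_mono norm_cauchy_schwarz)
  also have "\<dots> \<le> norm (L (y - \<theta>)) * norm (y - \<theta>) + R * (norm (y - \<theta>))\<^sup>2 * norm (y - \<theta>)"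
    using linearization[OF yK] by (intro add_left_mono mult_right_mono) (auto simp: \<Phi>_def)
  also have "\<dots> = t\<^sup>2 * norm v * norm (L v) + R * (t * norm v) * (t * norm v)\<^sup>2"
    using t by (simp add: y linear_scale[OF L] power2_eq_square power3_eq_cube)
  also have "\<dots> \<le> t\<^sup>2 * norm v * norm (L v) + \<kappa> / 2 * (t * norm v)\<^sup>2"
  proof -
    have "R * (t * norm v) \<le> \<bar>R\<bar> * (t * norm v)" using t by (intro mult_right_mono) auto
    then show ?thesis using Rt by (intro add_left_mono mult_right_mono) auto
  qed
  finally have "(t\<^sup>2 * norm v) * (\<kappa> / 2 * norm v) \<le> (t\<^sup>2 * norm v) * norm (L v)"
    by (simp add: power2_eq_square algebra_simps)
  then show ?thesis using t v by (subst (asm) mult_le_cancel_left_pos) auto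
qed simp

section \<open>Mean squares of the four error sums\<close>

text \<open>The cross term of \<open>S n\<close> with the next increment has mean zero, so the mean
  squares of the increments add up, and each of them is bounded by a constant.\<close>

lemma linear_second_moment_S: "linear_second_moment M (\<lambda>n. S (n + 1))"
proof -
  let ?C = "2 * (1 + B) + 2 * (1 + B)\<^sup>2"
  \<comment> \<open>The factor n - 1 counts the summands of \<open>S n\<close>. Integrability is
    part of the induction because the cross term needs it.\<close>
  have "integrable M (\<lambda>\<omega>. (norm (S n \<omega>))\<^sup>2) \<and> (\<integral>\<omega>. (norm (S n \<omega>))\<^sup>2 \<partial>M) \<le> ?C * (real n - 1)"
    if "n \<ge> 1" for n
    using that
  proof (induction n rule: dec_induct)
    case base
    show ?case by (simp add: S_def)
  next
    case (step n)
    then have n: "n \<ge> 1" by simp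
    note [measurable] = Z_measurable[OF n] G_measurable[OF n] S_measurable[OF n]
    let ?e = "\<lambda>\<omega>. G n \<omega> - \<Phi> (Z n \<omega>)"
    have iS: "integrable M (\<lambda>\<omega>. (norm (S n \<omega>))\<^sup>2)" using step by simp
    have ie: "integrable M (\<lambda>\<omega>. (norm (?e \<omega>))\<^sup>2)" and le: "(\<integral>\<omega>. (norm (?e \<omega>))\<^sup>2 \<partial>M) \<le> ?C"
    proof -
      have b: "integrable M (\<lambda>\<omega>. 2 * (norm (G n \<omega>))\<^sup>2 + 2 * (1 + B)\<^sup>2)"
        using integrable_G2[OF n] by simp
      have pw: "(norm (?e \<omega>))\<^sup>2 \<le> 2 * (norm (G n \<omega>))\<^sup>2 + 2 * (1 + B)\<^sup>2" if "\<omega> \<in> space M" for \<omega>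
      proof -
        have "(norm (?e \<omega>))\<^sup>2 \<le> 2 * (norm (G n \<omega>))\<^sup>2 + 2 * (norm (\<Phi> (Z n \<omega>)))\<^sup>2"
          using norm_add_squared_le[of "G n \<omega>" "- \<Phi> (Z n \<omega>)"] by simp
        also have "(norm (\<Phi> (Z n \<omega>)))\<^sup>2 \<le> (1 + B)\<^sup>2"
          using norm_\<Phi>_le[OF Z_in_K[OF n that]] by (intro power_mono) auto
        finally show ?thesis by simp
      qed
      show i: "integrable M (\<lambda>\<omega>. (norm (?e \<omega>))\<^sup>2)"
        by (rule Bochner_Integration.integrable_bound[OF b])
           (use pw in \<open>auto intro!: AE_I2 order_trans[OF _ abs_ge_self]\<close>)
      have "(\<integral>\<omega>. (norm (?e \<omega>))\<^sup>2 \<partial>M) \<le> (\<integral>\<omega>. 2 * (norm (G n \<omega>))\<^sup>2 + 2 * (1 + B)\<^sup>2 \<partial>M)"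
        by (intro integral_mono i b pw)
      also have "\<dots> \<le> ?C" using integrable_G2[OF n] G2_le[OF n] by (simp add: prob_space)
      finally show "(\<integral>\<omega>. (norm (?e \<omega>))\<^sup>2 \<partial>M) \<le> ?C" .
    qed
    have product_integrable: "integrable M (\<lambda>\<omega>. S n \<omega> \<bullet> h \<omega>)"
      if h[measurable]: "h \<in> borel_measurable M" and ih: "integrable M (\<lambda>\<omega>. (norm (h \<omega>))\<^sup>2)" for h
    proof (rule Bochner_Integration.integrable_bound)
      show "integrable M (\<lambda>\<omega>. (norm (S n \<omega>))\<^sup>2 + (norm (h \<omega>))\<^sup>2)" using iS ih by simp
      show "AE \<omega> in M. norm (S n \<omega> \<bullet> h \<omega>) \<le> norm ((norm (S n \<omega>))\<^sup>2 + (norm (h \<omega>))\<^sup>2)"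
      proof (rule AE_I2)
        fix \<omega>
        have "norm (S n \<omega> \<bullet> h \<omega>) \<le> norm (S n \<omega>) * norm (h \<omega>)"
          by (simp only: real_norm_def Cauchy_Schwarz_ineq2)
        also have "\<dots> \<le> (norm (S n \<omega>))\<^sup>2 + (norm (h \<omega>))\<^sup>2"
        proof -
          have "0 \<le> norm (S n \<omega>) * norm (h \<omega>)" by simp
          then show ?thesis
            using sum_squares_bound[of "norm (S n \<omega>)" "norm (h \<omega>)"] by linarith
        qed
        also have "\<dots> \<le> norm ((norm (S n \<omega>))\<^sup>2 + (norm (h \<omega>))\<^sup>2)" by simp
        finally show "norm (S n \<omega> \<bullet> h \<omega>) \<le> norm ((norm (S n \<omega>))\<^sup>2 + (norm (h \<omega>))\<^sup>2)" .
      qed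
    qed measurable
    have iSG: "integrable M (\<lambda>\<omega>. snd (Z n \<omega>, S n \<omega>) \<bullet> G n \<omega>)"
      using product_integrable[OF _ integrable_G2[OF n]] by simp
    have snd_m: "snd \<in> borel_measurable (borel :: ('e \<times> 'e) measure)"
      by (intro borel_measurable_continuous_onI continuous_intros)
    have iSP: "integrable M (\<lambda>\<omega>. S n \<omega> \<bullet> \<Phi> (Z n \<omega>))"
      using integrable_inner_\<Phi>[OF n snd_m iSG] by simp
    have iSe: "integrable M (\<lambda>\<omega>. S n \<omega> \<bullet> ?e \<omega>)"
      using iSG iSP by (simp add: inner_diff_right)
    have e0: "(\<integral>\<omega>. S n \<omega> \<bullet> ?e \<omega> \<partial>M) = 0"
      using integral_inner_G[OF n snd_m iSG] iSG iSP by (simp add: inner_diff_right)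
    have sq: "(norm (S (Suc n) \<omega>))\<^sup>2 = (norm (S n \<omega>))\<^sup>2 + 2 * (S n \<omega> \<bullet> ?e \<omega>) + (norm (?e \<omega>))\<^sup>2" for \<omega>
    proof -
      have "S (Suc n) \<omega> = S n \<omega> + ?e \<omega>" using n by (simp add: S_def)
      then show ?thesis
        unfolding power2_norm_eq_inner by (simp add: inner_add_left inner_add_right inner_commute)
    qed
    have i: "integrable M (\<lambda>\<omega>. (norm (S (Suc n) \<omega>))\<^sup>2)"
      unfolding sq using iS ie iSe by simp
    have "(\<integral>\<omega>. (norm (S (Suc n) \<omega>))\<^sup>2 \<partial>M)
        = (\<integral>\<omega>. (norm (S n \<omega>))\<^sup>2 \<partial>M) + (\<integral>\<omega>. (norm (?e \<omega>))\<^sup>2 \<partial>M)"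
      unfolding sq using iS ie iSe e0 by simp
    also have "\<dots> \<le> ?C * (real n - 1) + ?C" using step.IH le by linarith
    also have "\<dots> = ?C * (real (Suc n) - 1)" by (simp add: algebra_simps)
    finally show ?case using i by simp
  qed
  from this[of "_ + 1"] show ?thesis
    unfolding linear_second_moment_def
    by (intro exI[of _ ?C] allI impI conjI S_measurable) auto
qed

text \<open>Abel summation moves the differences from the iterates to the weights 1 / gamma_k, which
  are of order k^alpha. The boundary term then has mean square of order n^(2 alpha) n^(-alpha) <= n.
  The increments of the weights have order k^(alpha - 1), which gives summands with mean square of
  order k^(alpha - 2) <= 1/k.\<close>

lemma linear_second_moment_iterates:
  "linear_second_moment M (\<lambda>n \<omega>. \<Sum>k=1..n. (1 / \<gamma> k) *\<^sub>R (Z k \<omega> - Z (k + 1) \<omega>))"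
proof -
  obtain D where D: "D > 0"
    "\<And>n. n \<ge> 1 \<Longrightarrow> (\<integral>\<omega>. (norm (Z n \<omega> - \<theta>))\<^sup>2 \<partial>M) \<le> D * real n powr - \<alpha>"
    using second_moment_rate by blast
  let ?first = "\<lambda>(n::nat) \<omega>. (1 / \<gamma> 1) *\<^sub>R (Z 1 \<omega> - \<theta>)"
  let ?last = "\<lambda>n \<omega>. (1 / \<gamma> (n + 1)) *\<^sub>R (Z (n + 1) \<omega> - \<theta>)"
  let ?mid = "\<lambda>k \<omega>. (1 / \<gamma> (k + 1) - 1 / \<gamma> k) *\<^sub>R (Z (k + 1) \<omega> - \<theta>)"
  have abel: "(\<Sum>k=1..n. (1 / \<gamma> k) *\<^sub>R (Z k \<omega> - Z (k + 1) \<omega>))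
      = ?first n \<omega> - ?last n \<omega> + (\<Sum>k=1..n. ?mid k \<omega>)" for n \<omega>
    by (induction n) (auto simp: algebra_simps)
  have first: "linear_second_moment M ?first"
    unfolding linear_second_moment_def
  proof (intro exI allI impI conjI)
    fix n :: nat assume "n \<ge> 1"
    show "?first n \<in> borel_measurable M" by measurable
    show "integrable M (\<lambda>\<omega>. (norm (?first n \<omega>))\<^sup>2)"
      using integrable_norm_Z_power[of 1 2] by (simp add: power_divide)
    \<comment> \<open>The mean square itself serves as the constant: it does not depend on n, and n
      >= 1.\<close>
    show "(\<integral>\<omega>. (norm (?first n \<omega>))\<^sup>2 \<partial>M) \<le> (\<integral>\<omega>. (norm (?first n \<omega>))\<^sup>2 \<partial>M) * real n"
      using \<open>n \<ge> 1\<close> mult_left_mono[of 1 "real n" "\<integral>\<omega>. (norm (?first n \<omega>))\<^sup>2 \<partial>M"]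
      by (simp add: integral_nonneg_AE)
  qed
  have last: "linear_second_moment M ?last"
    unfolding linear_second_moment_def
  proof (intro exI allI impI conjI)
    fix n :: nat assume n: "n \<ge> 1"
    show "?last n \<in> borel_measurable M" by measurable
    show "integrable M (\<lambda>\<omega>. (norm (?last n \<omega>))\<^sup>2)"
      using integrable_norm_Z_power[of "n + 1" 2] by (simp add: power_divide)
    define m where "m = n + 1"
    have m: "m \<ge> 1" by (simp add: m_def)
    have "(\<integral>\<omega>. (norm (?last n \<omega>))\<^sup>2 \<partial>M) = (1 / \<gamma> m)\<^sup>2 * (\<integral>\<omega>. (norm (Z m \<omega> - \<theta>))\<^sup>2 \<partial>M)"
      by (simp add: m_def power_divide)
    also have "\<dots> \<le> (1 / \<gamma> m)\<^sup>2 * (D * real m powr - \<alpha>)"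
      using D(2)[OF m] by (intro mult_left_mono) auto
    also have "\<dots> = D / c\<^sup>2 * real m powr \<alpha>"
      using m c by (simp add: \<gamma>_def powr_minus field_simps power2_eq_square)
    also have "\<dots> \<le> D / c\<^sup>2 * (2 * real n)"
    proof (intro mult_left_mono)
      have "real m powr \<alpha> \<le> real m powr 1" using m \<alpha> by (intro powr_mono) auto
      also have "\<dots> \<le> 2 * real n" using n by (simp add: m_def)
      finally show "real m powr \<alpha> \<le> 2 * real n" .
    qed (use D in auto)
    finally show "(\<integral>\<omega>. (norm (?last n \<omega>))\<^sup>2 \<partial>M) \<le> 2 * D / c\<^sup>2 * real n"
      by (simp add: mult_ac)
  qed
  have mid: "linear_second_moment M (\<lambda>n \<omega>. \<Sum>k=1..n. ?mid k \<omega>)"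
  proof (rule linear_second_moment_sum[where C="D / c\<^sup>2"])
    fix k :: nat assume k: "k \<ge> 1"
    show "?mid k \<in> borel_measurable M" by measurable
    show "integrable M (\<lambda>\<omega>. (norm (?mid k \<omega>))\<^sup>2)"
      using integrable_norm_Z_power[of "k + 1" 2] by (simp add: power_mult_distrib)
    define x where "x = real k"
    have x: "x \<ge> 1" using k by (simp add: x_def)
    have incr: "\<bar>1 / \<gamma> (k + 1) - 1 / \<gamma> k\<bar> \<le> x powr (\<alpha> - 1) / c"
    proof -
      have g: "1 / \<gamma> (k + 1) = (x + 1) powr \<alpha> / c" "1 / \<gamma> k = x powr \<alpha> / c"
        using x by (simp_all add: \<gamma>_def x_def powr_minus field_simps)
      have "x powr \<alpha> \<le> (x + 1) powr \<alpha>" using x \<alpha> by (intro powr_mono2) auto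
      \<comment> \<open>Factoring out x^alpha and using (1 + 1/x)^alpha <= 1 + 1/x bounds the
        increment by x^(alpha - 1).\<close>
      moreover have "(x + 1) powr \<alpha> = x powr \<alpha> * (1 + 1 / x) powr \<alpha>"
      proof -
        have "x + 1 = x * (1 + 1 / x)" using x by (simp add: distrib_left)
        then show ?thesis using x by (simp only: powr_mult)
      qed
      moreover have "x powr \<alpha> * (1 + 1 / x) powr \<alpha> \<le> x powr \<alpha> * (1 + 1 / x) powr 1"
        using x \<alpha> by (intro mult_left_mono powr_mono) auto
      moreover have "x powr \<alpha> * (1 + 1 / x) powr 1 = x powr \<alpha> + x powr (\<alpha> - 1)"
        using x by (simp add: powr_diff field_simps)
      ultimately have "\<bar>(x + 1) powr \<alpha> - x powr \<alpha>\<bar> \<le> x powr (\<alpha> - 1)" by linarith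
      then show ?thesis
        unfolding g using c by (simp add: divide_right_mono flip: diff_divide_distrib)
    qed
    have "(\<integral>\<omega>. (norm (?mid k \<omega>))\<^sup>2 \<partial>M)
        = \<bar>1 / \<gamma> (k + 1) - 1 / \<gamma> k\<bar>\<^sup>2 * (\<integral>\<omega>. (norm (Z (k + 1) \<omega> - \<theta>))\<^sup>2 \<partial>M)"
      by (simp add: power_mult_distrib)
    also have "\<dots> \<le> (x powr (\<alpha> - 1) / c)\<^sup>2 * (D * (x + 1) powr - \<alpha>)"
      using incr D(2)[of "k + 1"] by (intro mult_mono power_mono) (auto simp: x_def add.commute)
    also have "\<dots> \<le> (x powr (\<alpha> - 1) / c)\<^sup>2 * (D * x powr - \<alpha>)"
      using D x \<alpha> by (intro mult_left_mono powr_mono2') auto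
    also have "\<dots> = D / c\<^sup>2 * (x powr (\<alpha> - 1) * x powr (\<alpha> - 1) * x powr - \<alpha>)"
      by (simp add: power2_eq_square)
    also have "\<dots> = D / c\<^sup>2 * x powr (\<alpha> - 2)"
      using x by (simp flip: powr_add)
    also have "\<dots> \<le> D / c\<^sup>2 * x powr - 1"
      using D x \<alpha> by (intro mult_left_mono powr_mono) auto
    also have "\<dots> = D / c\<^sup>2 / real k" using x by (simp add: x_def powr_minus_divide)
    finally show "(\<integral>\<omega>. (norm (?mid k \<omega>))\<^sup>2 \<partial>M) \<le> D / c\<^sup>2 / real k" .
  qed
  show ?thesis
    unfolding abel by (intro linear_second_moment_add linear_second_moment_diff first last mid)
qed

text \<open>The remainder is quadratic, so its square is controlled by the fourth power of the
  error, whose mean is O(1/k).\<close>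

lemma linear_second_moment_linearization:
  "linear_second_moment M (\<lambda>n \<omega>. \<Sum>k=1..n. \<Phi> (Z k \<omega>) - L (Z k \<omega> - \<theta>))"
proof -
  obtain D where D: "D > 0"
    "\<And>n. n \<ge> 1 \<Longrightarrow> (\<integral>\<omega>. norm (Z n \<omega> - \<theta>) ^ 4 \<partial>M) \<le> D * (real n powr - \<alpha>)\<^sup>2"
    using fourth_moment_rate by blast
  have [measurable]: "L \<in> borel_measurable borel"
    using L by (intro borel_measurable_continuous_onI linear_continuous_on) (rule linear_conv_bounded_linear[THEN iffD1])
  show ?thesis
  proof (rule linear_second_moment_sum[where C="R\<^sup>2 * D"])
    fix k :: nat assume k: "k \<ge> 1"
    note [measurable] = Z_measurable[OF k]
    let ?d = "\<lambda>\<omega>. \<Phi> (Z k \<omega>) - L (Z k \<omega> - \<theta>)"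
    show "?d \<in> borel_measurable M" by measurable
    have pw: "(norm (?d \<omega>))\<^sup>2 \<le> R\<^sup>2 * norm (Z k \<omega> - \<theta>) ^ 4" if "\<omega> \<in> space M" for \<omega>
    proof -
      have "(norm (?d \<omega>))\<^sup>2 \<le> (R * (norm (Z k \<omega> - \<theta>))\<^sup>2)\<^sup>2"
        using linearization[OF Z_in_K[OF k that]] unfolding \<Phi>_def by (intro power_mono) auto
      then show ?thesis by (simp add: power_mult_distrib)
    qed
    have b: "integrable M (\<lambda>\<omega>. R\<^sup>2 * norm (Z k \<omega> - \<theta>) ^ 4)"
      using integrable_norm_Z_power[OF k] by simp
    show i: "integrable M (\<lambda>\<omega>. (norm (?d \<omega>))\<^sup>2)"
      by (rule Bochner_Integration.integrable_bound[OF b])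
         (use pw in \<open>auto intro!: AE_I2 order_trans[OF _ abs_ge_self]\<close>)
    have "(\<integral>\<omega>. (norm (?d \<omega>))\<^sup>2 \<partial>M) \<le> (\<integral>\<omega>. R\<^sup>2 * norm (Z k \<omega> - \<theta>) ^ 4 \<partial>M)"
      by (intro integral_mono i b pw)
    also have "\<dots> \<le> R\<^sup>2 * (D * (real k powr - \<alpha>)\<^sup>2)"
      using D(2)[OF k] by (simp add: mult_left_mono)
    also have "\<dots> \<le> R\<^sup>2 * (D * (1 / real k))"
      using powr_\<alpha>_squared_le[OF k] D by (intro mult_left_mono) auto
    finally show "(\<integral>\<omega>. (norm (?d \<omega>))\<^sup>2 \<partial>M) \<le> R\<^sup>2 * D / real k" by simp
  qed
qed

text \<open>The displacement caused by the projection; it vanishes whenever the unprojected step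
  stays in \<open>K\<close>.\<close>

definition r :: "nat \<Rightarrow> 'c \<Rightarrow> 'e" where
  "r n \<omega> = Z (n + 1) \<omega> - (Z n \<omega> - \<gamma> n *\<^sub>R G n \<omega>)"

text \<open>The projection acts only if \<open>Z n\<close> is far from \<open>\<theta>\<close> or the step \<open>\<gamma> n * norm (G n)\<close> is large.\<close>

lemma norm_r_le:
  assumes n: "n \<ge> 1" and \<omega>: "\<omega> \<in> space M"
  shows "(norm ((1 / \<gamma> n) *\<^sub>R r n \<omega>))\<^sup>2 \<le> 64 / \<rho> ^ 4 * (norm (Z n \<omega> - \<theta>) ^ 4 * (norm (G n \<omega>))\<^sup>2)
    + 16 / \<rho>\<^sup>2 * (\<gamma> n)\<^sup>2 * norm (G n \<omega>) ^ 4"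
proof (cases "Z n \<omega> - \<gamma> n *\<^sub>R G n \<omega> \<in> K")
  case True
  then have "r n \<omega> = 0" using Z_Suc[OF n \<omega>] proj_id by (simp add: r_def \<gamma>_def G_def)
  then show ?thesis using \<rho> by simp
next
  case False
  let ?y = "Z n \<omega> - \<gamma> n *\<^sub>R G n \<omega>"
  define t u where "t = norm (Z n \<omega> - \<theta>)" and "u = norm (G n \<omega>)"
  have tu: "t \<ge> 0" "u \<ge> 0" by (auto simp: t_def u_def)
  have \<gamma>: "\<gamma> n > 0" using \<gamma>_pos[OF n] .
  \<comment> \<open>Comparing with the projection of \<open>Z n\<close>, which is \<open>Z n\<close>
    itself, bounds the displacement by twice the step length, so dividing by gamma_n leaves no
    negative power of it.\<close>
  have "norm (r n \<omega>) = norm ((proj ?y - proj (Z n \<omega>)) + \<gamma> n *\<^sub>R G n \<omega>)"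
    using Z_Suc[OF n \<omega>] proj_id[OF Z_in_K[OF n \<omega>]] by (simp add: r_def \<gamma>_def G_def algebra_simps)
  also have "\<dots> \<le> norm (?y - Z n \<omega>) + \<gamma> n * u"
    using proj_nonexpansive[of ?y "Z n \<omega>"] \<gamma> unfolding u_def
    by (intro order_trans[OF norm_triangle_ineq] add_mono) auto
  also have "\<dots> = 2 * \<gamma> n * u" using \<gamma> by (simp add: u_def)
  finally have "norm ((1 / \<gamma> n) *\<^sub>R r n \<omega>) \<le> 2 * u" using \<gamma> by (simp add: divide_le_eq mult_ac)
  then have "(norm ((1 / \<gamma> n) *\<^sub>R r n \<omega>))\<^sup>2 \<le> (2 * u)\<^sup>2" by (intro power_mono) auto
  also have "\<dots> = 4 * u\<^sup>2 * 1" by simp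
  also have "\<dots> \<le> 4 * u\<^sup>2 * (16 / \<rho> ^ 4 * t ^ 4 + 4 / \<rho>\<^sup>2 * (\<gamma> n)\<^sup>2 * u\<^sup>2)"
  proof (intro mult_left_mono)
    have "?y \<notin> ball \<theta> \<rho>" using False \<rho> by auto
    then have "\<rho> \<le> norm (Z n \<omega> - \<theta> - \<gamma> n *\<^sub>R G n \<omega>)"
      by (simp add: dist_norm norm_minus_commute algebra_simps)
    also have "\<dots> \<le> t + \<gamma> n * u"
      using norm_triangle_ineq4[of "Z n \<omega> - \<theta>" "\<gamma> n *\<^sub>R G n \<omega>"] \<gamma> by (simp add: t_def u_def)
    \<comment> \<open>Leaving the ball of radius rho requires one of the two terms to reach rho / 2.
      The first is raised to the power 4 and the second to the power 2, matching the decay available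
      for the error and for gamma_n.\<close>
    finally consider "\<rho> / 2 \<le> t" | "\<rho> / 2 \<le> \<gamma> n * u" by linarith
    then show "1 \<le> 16 / \<rho> ^ 4 * t ^ 4 + 4 / \<rho>\<^sup>2 * (\<gamma> n)\<^sup>2 * u\<^sup>2"
    proof cases
      case 1
      then have "(\<rho> / 2) ^ 4 \<le> t ^ 4" using \<rho> by (intro power_mono) auto
      then have "1 \<le> 16 / \<rho> ^ 4 * t ^ 4" using \<rho> by (simp add: field_simps power_divide)
      moreover have "0 \<le> 4 / \<rho>\<^sup>2 * (\<gamma> n)\<^sup>2 * u\<^sup>2" by simp
      ultimately show ?thesis by linarith
    next
      case 2
      then have "(\<rho> / 2)\<^sup>2 \<le> (\<gamma> n * u)\<^sup>2" using \<rho> by (intro power_mono) auto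
      then have "1 \<le> 4 / \<rho>\<^sup>2 * (\<gamma> n)\<^sup>2 * u\<^sup>2" using \<rho> by (simp add: field_simps power_divide)
      moreover have "0 \<le> 16 / \<rho> ^ 4 * t ^ 4" by simp
      ultimately show ?thesis by linarith
    qed
  qed simp
  also have "\<dots> = 64 / \<rho> ^ 4 * (t ^ 4 * u\<^sup>2) + 16 / \<rho>\<^sup>2 * (\<gamma> n)\<^sup>2 * u ^ 4"
    by (simp add: algebra_simps power2_eq_square power4_eq_xxxx)
  finally show ?thesis unfolding t_def u_def .
qed

text \<open>In the bound \<open>norm_r_le\<close> the first term inherits the fourth-moment rate of
  the error through the weighted moment estimate, and the second carries gamma_k^2; both have mean
  O(1/k).\<close>

lemma linear_second_moment_projection:
  "linear_second_moment M (\<lambda>n \<omega>. \<Sum>k=1..n. (1 / \<gamma> k) *\<^sub>R r k \<omega>)"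
proof -
  obtain D where D: "D > 0"
    "\<And>n. n \<ge> 1 \<Longrightarrow> (\<integral>\<omega>. norm (Z n \<omega> - \<theta>) ^ 4 \<partial>M) \<le> D * (real n powr - \<alpha>)\<^sup>2"
    using fourth_moment_rate by blast
  obtain b where b: "b > 0" "\<And>y. y \<in> K \<Longrightarrow> norm (y - \<theta>) \<le> b" using K_bound by blast
  let ?C = "64 / \<rho> ^ 4 * ((1 + B) * D) + 16 / \<rho>\<^sup>2 * c\<^sup>2 * B"
  show ?thesis
  proof (rule linear_second_moment_sum[where C="?C"])
    fix k :: nat assume k: "k \<ge> 1"
    note [measurable] = Z_measurable[OF k] G_measurable[OF k]
    show "(\<lambda>\<omega>. (1 / \<gamma> k) *\<^sub>R r k \<omega>) \<in> borel_measurable M" unfolding r_def by measurable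
    let ?w = "\<lambda>y. norm (y - \<theta>) ^ 4"
    have w: "\<And>y. y \<in> K \<Longrightarrow> 0 \<le> ?w y" "\<And>y. y \<in> K \<Longrightarrow> ?w y \<le> b ^ 4"
      using b by (auto intro: power_mono)
    have i2: "integrable M (\<lambda>\<omega>. norm (Z k \<omega> - \<theta>) ^ 4 * (norm (G k \<omega>))\<^sup>2)"
      and le2: "(\<integral>\<omega>. norm (Z k \<omega> - \<theta>) ^ 4 * (norm (G k \<omega>))\<^sup>2 \<partial>M)
        \<le> (1 + B) * (\<integral>\<omega>. norm (Z k \<omega> - \<theta>) ^ 4 \<partial>M)"
      using integrable_weighted_G2[OF k, of ?w, OF _ w] weighted_G2_le[OF k, of ?w, OF _ w] by auto
    let ?b = "\<lambda>\<omega>. 64 / \<rho> ^ 4 * (norm (Z k \<omega> - \<theta>) ^ 4 * (norm (G k \<omega>))\<^sup>2)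
        + 16 / \<rho>\<^sup>2 * (\<gamma> k)\<^sup>2 * norm (G k \<omega>) ^ 4"
    have ib: "integrable M ?b"
      using i2 integrable_G4[OF k] by simp
    show i: "integrable M (\<lambda>\<omega>. (norm ((1 / \<gamma> k) *\<^sub>R r k \<omega>))\<^sup>2)"
      by (rule Bochner_Integration.integrable_bound[OF ib])
         (use norm_r_le[OF k] in \<open>auto intro!: AE_I2 order_trans[OF _ abs_ge_self] simp: r_def\<close>)
    have s: "(real k powr - \<alpha>)\<^sup>2 \<le> 1 / real k" by (rule powr_\<alpha>_squared_le[OF k])
    have "(\<integral>\<omega>. (norm ((1 / \<gamma> k) *\<^sub>R r k \<omega>))\<^sup>2 \<partial>M) \<le> (\<integral>\<omega>. ?b \<omega> \<partial>M)"
      by (intro integral_mono i ib norm_r_le k)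
    also have "\<dots> = 64 / \<rho> ^ 4 * (\<integral>\<omega>. norm (Z k \<omega> - \<theta>) ^ 4 * (norm (G k \<omega>))\<^sup>2 \<partial>M)
        + 16 / \<rho>\<^sup>2 * (\<gamma> k)\<^sup>2 * (\<integral>\<omega>. norm (G k \<omega>) ^ 4 \<partial>M)"
      using i2 integrable_G4[OF k] by (subst Bochner_Integration.integral_add) auto
    also have "\<dots> \<le> 64 / \<rho> ^ 4 * ((1 + B) * (D * (1 / real k))) + 16 / \<rho>\<^sup>2 * (c\<^sup>2 * (1 / real k)) * B"
    proof (intro add_mono mult_left_mono mult_mono)
      have "(\<integral>\<omega>. norm (Z k \<omega> - \<theta>) ^ 4 \<partial>M) \<le> D * (1 / real k)"
        using D(2)[OF k] mult_left_mono[OF s, of D] D(1) by linarith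
      then show "(\<integral>\<omega>. norm (Z k \<omega> - \<theta>) ^ 4 * (norm (G k \<omega>))\<^sup>2 \<partial>M) \<le> (1 + B) * (D * (1 / real k))"
        using le2 B_nonneg by (intro order_trans[OF le2] mult_left_mono) auto
      show "(\<gamma> k)\<^sup>2 \<le> c\<^sup>2 * (1 / real k)"
        using s unfolding \<gamma>_def power_mult_distrib by (intro mult_left_mono) auto
    qed (use G4_le[OF k] B_nonneg in auto)
    also have "\<dots> = ?C / real k" by (simp add: add_divide_distrib)
    finally show "(\<integral>\<omega>. (norm ((1 / \<gamma> k) *\<^sub>R r k \<omega>))\<^sup>2 \<partial>M) \<le> ?C / real k" .
  qed
qed

theorem averaged_iterates_rate:
  "\<exists>C>0. \<forall>n\<ge>1. (\<integral>\<omega>. (norm ((1 / real n) *\<^sub>R (\<Sum>k=1..n. Z k \<omega>) - \<theta>))\<^sup>2 \<partial>M) \<le> C / real n"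
proof -
  let ?T = "\<lambda>n \<omega>. \<Sum>k=1..n. Z k \<omega> - \<theta>"
  \<comment> \<open>By the definition of \<open>r\<close> the first two terms add up to
    \<open>G k\<close>; then \<open>\<Phi> (Z k)\<close> is subtracted and added.\<close>
  have "L (Z k \<omega> - \<theta>) = (1 / \<gamma> k) *\<^sub>R (Z k \<omega> - Z (k + 1) \<omega>) + (1 / \<gamma> k) *\<^sub>R r k \<omega>
      - (G k \<omega> - \<Phi> (Z k \<omega>)) - (\<Phi> (Z k \<omega>) - L (Z k \<omega> - \<theta>))" if "k \<ge> 1" for k \<omega>
    using \<gamma>_pos[OF that] by (simp add: r_def flip: scaleR_add_right)
  then have dec: "L (?T n \<omega>) = (\<Sum>k=1..n. (1 / \<gamma> k) *\<^sub>R (Z k \<omega> - Z (k + 1) \<omega>))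
      + (\<Sum>k=1..n. (1 / \<gamma> k) *\<^sub>R r k \<omega>) - S (n + 1) \<omega> - (\<Sum>k=1..n. \<Phi> (Z k \<omega>) - L (Z k \<omega> - \<theta>))" for n \<omega>
    unfolding linear_sum[OF L] S_def sum.distrib[symmetric] sum_subtractf[symmetric]
      atLeastLessThanSuc_atLeastAtMost Suc_eq_plus1[symmetric]
    by (intro sum.cong) auto
  have "linear_second_moment M (\<lambda>n \<omega>. L (?T n \<omega>))"
    unfolding dec
    by (intro linear_second_moment_add linear_second_moment_diff linear_second_moment_S
        linear_second_moment_iterates linear_second_moment_projection linear_second_moment_linearization)
  then obtain C where C: "\<And>n. n \<ge> 1 \<Longrightarrow> integrable M (\<lambda>\<omega>. (norm (L (?T n \<omega>)))\<^sup>2)"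
      "\<And>n. n \<ge> 1 \<Longrightarrow> (\<integral>\<omega>. (norm (L (?T n \<omega>)))\<^sup>2 \<partial>M) \<le> C * real n"
    unfolding linear_second_moment_def by blast
  have "(\<integral>\<omega>. (norm ((1 / real n) *\<^sub>R (\<Sum>k=1..n. Z k \<omega>) - \<theta>))\<^sup>2 \<partial>M)
      \<le> (1 + 4 / \<kappa>\<^sup>2 * \<bar>C\<bar>) / real n" if n: "n \<ge> 1" for n
  proof -
    have [measurable]: "(\<lambda>\<omega>. (1 / real n) *\<^sub>R (\<Sum>k=1..n. Z k \<omega>) - \<theta>) \<in> borel_measurable M"
      by (intro borel_measurable_diff borel_measurable_scaleR borel_measurable_sum) auto
    have pw: "(norm ((1 / real n) *\<^sub>R (\<Sum>k=1..n. Z k \<omega>) - \<theta>))\<^sup>2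
        \<le> 4 / \<kappa>\<^sup>2 / (real n)\<^sup>2 * (norm (L (?T n \<omega>)))\<^sup>2" for \<omega>
    proof -
      have "(1 / real n) *\<^sub>R (\<Sum>k=1..n. Z k \<omega>) - \<theta> = (1 / real n) *\<^sub>R ?T n \<omega>"
        using n by (simp add: sum_subtractf scaleR_right_diff_distrib sum_constant_scaleR)
      moreover have "(\<kappa> / 2 * norm (?T n \<omega>))\<^sup>2 \<le> (norm (L (?T n \<omega>)))\<^sup>2"
        using L_lower_bound \<kappa> by (intro power_mono) auto
      then have "(norm (?T n \<omega>))\<^sup>2 \<le> 4 / \<kappa>\<^sup>2 * (norm (L (?T n \<omega>)))\<^sup>2"
        using \<kappa> by (simp add: power_mult_distrib power_divide field_simps)
      then have "(1 / real n)\<^sup>2 * (norm (?T n \<omega>))\<^sup>2 \<le> (1 / real n)\<^sup>2 * (4 / \<kappa>\<^sup>2 * (norm (L (?T n \<omega>)))\<^sup>2)"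
        by (intro mult_left_mono) auto
      ultimately show ?thesis by (simp add: power_mult_distrib power_divide field_simps)
    qed
    have b: "integrable M (\<lambda>\<omega>. 4 / \<kappa>\<^sup>2 / (real n)\<^sup>2 * (norm (L (?T n \<omega>)))\<^sup>2)"
      using C(1)[OF n] by simp
    have i: "integrable M (\<lambda>\<omega>. (norm ((1 / real n) *\<^sub>R (\<Sum>k=1..n. Z k \<omega>) - \<theta>))\<^sup>2)"
      by (rule Bochner_Integration.integrable_bound[OF b])
         (use pw in \<open>auto intro!: AE_I2 order_trans[OF _ abs_ge_self]\<close>)
    have "(\<integral>\<omega>. (norm ((1 / real n) *\<^sub>R (\<Sum>k=1..n. Z k \<omega>) - \<theta>))\<^sup>2 \<partial>M)
        \<le> (\<integral>\<omega>. 4 / \<kappa>\<^sup>2 / (real n)\<^sup>2 * (norm (L (?T n \<omega>)))\<^sup>2 \<partial>M)"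
      by (intro integral_mono i b pw)
    also have "\<dots> = 4 / \<kappa>\<^sup>2 / (real n)\<^sup>2 * (\<integral>\<omega>. (norm (L (?T n \<omega>)))\<^sup>2 \<partial>M)" by simp
    also have "\<dots> \<le> 4 / \<kappa>\<^sup>2 / (real n)\<^sup>2 * (\<bar>C\<bar> * real n)"
      using C(2)[OF n] mult_right_mono[OF abs_ge_self[of C], of "real n"]
      by (intro mult_left_mono) auto
    also have "\<dots> = 4 / \<kappa>\<^sup>2 * \<bar>C\<bar> / real n" using n by (simp add: power2_eq_square)
    also have "\<dots> \<le> (1 + 4 / \<kappa>\<^sup>2 * \<bar>C\<bar>) / real n" by (intro divide_right_mono) auto
    finally show ?thesis .
  qed
  moreover have "1 + 4 / \<kappa>\<^sup>2 * \<bar>C\<bar> > 0" using \<kappa> by (simp add: add_pos_nonneg)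
  ultimately show ?thesis by blast
qed

end

section \<open>The Euclidean norm and its Hessian\<close>

lemma norm_scaleR_sgn: "norm x *\<^sub>R sgn x = (x :: 'e::real_normed_vector)"
  by (cases "x = 0") (simp_all add: sgn_div_norm)

text \<open>\<open>sgn a\<close> is a subgradient of the norm at a. This includes a = 0, where
  \<open>sgn 0 = 0\<close> is one of the subgradients, so no point has to be excluded.\<close>

lemma sgn_inner_le_norm_diff:
  fixes a h :: "'e::real_inner" shows "sgn a \<bullet> h \<le> norm (a + h) - norm a"
proof (cases "a = 0")
  case False
  have "(a \<bullet> (a + h)) / norm a \<le> norm (a + h)"
    using False norm_cauchy_schwarz[of a "a + h"] by (simp add: divide_le_eq mult.commute)
  moreover have "(a \<bullet> (a + h)) / norm a = norm a + sgn a \<bullet> h"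
    using False
    by (simp add: sgn_div_norm inner_add_right dot_square_norm power2_eq_square field_simps)
  ultimately show ?thesis by linarith
qed simp

lemma norm_diff_le_sgn_inner:
  fixes a h :: "'e::real_inner" shows "norm (a + h) - norm a \<le> sgn (a + h) \<bullet> h"
  using sgn_inner_le_norm_diff[of "a + h" "- h"] by simp

lemma sgn_monotone:
  fixes a h :: "'e::real_inner" shows "0 \<le> (sgn (a + h) - sgn a) \<bullet> h"
  using sgn_inner_le_norm_diff[of a h] norm_diff_le_sgn_inner[of a h] by (simp add: inner_diff_left)

lemma norm_sgn_le: "norm (sgn (x::'e::real_normed_vector)) \<le> 1"
  by (simp add: norm_sgn)

text \<open>The exact expansion of |a + h|^2 is combined with (|a + h| - |a|)^2 >= 0. No smallness
  of h is involved, so the bound survives when the segment from a to a + h passes through the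
  origin.\<close>

lemma norm_taylor:
  fixes a h :: "'e::real_inner" assumes "a \<noteq> 0"
  shows "norm (a + h) - norm a - sgn a \<bullet> h \<le> (norm h)\<^sup>2 / (2 * norm a)"
proof -
  define p q where "p = norm a" and "q = norm (a + h)"
  have p: "p > 0" using assms by (simp add: p_def)
  have ah: "a \<bullet> h = p * (sgn a \<bullet> h)" using assms by (simp add: sgn_div_norm p_def)
  have "q\<^sup>2 = p\<^sup>2 + 2 * (a \<bullet> h) + (norm h)\<^sup>2"
    unfolding p_def q_def power2_norm_eq_inner
    by (simp add: inner_add_left inner_add_right inner_commute)
  moreover have "0 \<le> (q - p)\<^sup>2" by simp
  ultimately have "2 * p * (q - p - sgn a \<bullet> h) \<le> (norm h)\<^sup>2"
    unfolding ah by (simp add: power2_eq_square algebra_simps)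
  then show ?thesis using p by (simp add: p_def q_def field_simps)
qed

text \<open>Factoring out 1 / |a| leaves an expression in \<open>sgn (a + h)\<close>, which is
  bounded by 1 even when a + h = 0. Both estimates that follow start from this identity.\<close>

lemma sgn_diff_eq:
  fixes a h :: "'e::real_inner" assumes "a \<noteq> 0"
  shows "sgn (a + h) - sgn a
    = (1 / norm a) *\<^sub>R ((norm a - norm (a + h)) *\<^sub>R sgn (a + h) + h)"
proof -
  have "(norm a - norm (a + h)) *\<^sub>R sgn (a + h) + h = norm a *\<^sub>R sgn (a + h) - a"
    using norm_scaleR_sgn[of "a + h"] by (simp add: scaleR_diff_left)
  then show ?thesis
    using assms by (simp add: scaleR_diff_right) (simp add: sgn_div_norm divide_inverse_commute)
qed

lemma norm_sgn_diff_le: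
  fixes a h :: "'e::real_inner" assumes "a \<noteq> 0"
  shows "norm (sgn (a + h) - sgn a) \<le> 2 * norm h / norm a"
proof -
  have "norm ((norm a - norm (a + h)) *\<^sub>R sgn (a + h) + h)
      \<le> \<bar>norm a - norm (a + h)\<bar> * norm (sgn (a + h)) + norm h"
    by (metis norm_scaleR norm_triangle_ineq)
  also have "\<dots> \<le> norm h * 1 + norm h"
    using norm_triangle_ineq3[of a "a + h"]
    by (intro add_right_mono mult_mono norm_sgn_le) auto
  finally have "norm ((norm a - norm (a + h)) *\<^sub>R sgn (a + h) + h) \<le> 2 * norm h" by simp
  then show ?thesis
    unfolding sgn_diff_eq[OF assms] using assms by (simp add: divide_right_mono)
qed

text \<open>Substituting \<open>sgn_diff_eq\<close> leaves, inside the factor 1 / |a|, the Taylor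
  remainder of the norm, at most |h|^2 / (2 |a|), and \<open>sgn a \<bullet> h\<close> times a
  difference of unit vectors, at most 2 |h|^2 / |a|. This is the origin of 5/2 = 1/2 + 2.\<close>

lemma sgn_taylor:
  fixes a h :: "'e::real_inner" assumes "a \<noteq> 0"
  shows "norm (sgn (a + h) - sgn a - (1 / norm a) *\<^sub>R (h - (sgn a \<bullet> h) *\<^sub>R sgn a))
    \<le> 5 / 2 * (norm h)\<^sup>2 / (norm a)\<^sup>2"
proof -
  define p q where "p = norm a" and "q = norm (a + h)"
  have p: "p > 0" using assms by (simp add: p_def)
  let ?c = "sgn a \<bullet> h"
  have "sgn (a + h) - sgn a - (1 / p) *\<^sub>R (h - ?c *\<^sub>R sgn a)
      = (1 / p) *\<^sub>R ((p - q) *\<^sub>R sgn (a + h) + h) - (1 / p) *\<^sub>R (h - ?c *\<^sub>R sgn a)"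
    by (simp only: sgn_diff_eq[OF assms] p_def q_def)
  also have "\<dots> = (1 / p) *\<^sub>R ((- (q - p - ?c)) *\<^sub>R sgn (a + h) - ?c *\<^sub>R (sgn (a + h) - sgn a))"
    by (simp add: algebra_simps)
  also have "norm \<dots> \<le> (1 / p) * ((norm h)\<^sup>2 / (2 * p) * 1 + norm h * (2 * norm h / p))"
  proof -
    have "\<bar>q - p - ?c\<bar> \<le> (norm h)\<^sup>2 / (2 * p)"
      using norm_taylor[OF assms, of h] sgn_inner_le_norm_diff[of a h] by (simp add: p_def q_def)
    then have 1: "norm ((- (q - p - ?c)) *\<^sub>R sgn (a + h)) \<le> (norm h)\<^sup>2 / (2 * p) * 1"
      unfolding norm_scaleR abs_minus_cancel
      using p by (intro mult_mono norm_sgn_le) auto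
    have "\<bar>?c\<bar> \<le> norm (sgn a) * norm h" by (rule Cauchy_Schwarz_ineq2)
    also have "\<dots> = norm h" using assms by (simp add: norm_sgn)
    finally have 2: "norm (?c *\<^sub>R (sgn (a + h) - sgn a)) \<le> norm h * (2 * norm h / p)"
      unfolding norm_scaleR using norm_sgn_diff_le[OF assms, of h] p
      by (intro mult_mono) (auto simp: p_def)
    show ?thesis
      unfolding norm_scaleR[of "1 / p"] using p 1 2
      by (intro mult_mono order_trans[OF norm_triangle_ineq4] add_mono) auto
  qed
  also have "\<dots> = 5 / 2 * (norm h)\<^sup>2 / p\<^sup>2" using p by (simp add: field_simps power2_eq_square)
  finally show ?thesis by (simp add: p_def)
qed

section \<open>The largest eigenvalue of a symmetric matrix\<close>

lemma symmetric_matrix_inner: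
  fixes A :: "real^'n^'n" assumes "transpose A = A"
  shows "x \<bullet> (A *v y) = (A *v x) \<bullet> y"
  by (metis assms dot_lmul_matrix transpose_matrix_vector)

text \<open>Eigenvectors for distinct eigenvalues are orthogonal, hence independent. Finiteness is
  what gives \<open>Max\<close> in \<open>lambda_max\<close> its meaning.\<close>

lemma finite_eigenvalues_symmetric:
  fixes A :: "real^'n^'n" assumes sym: "transpose A = A"
  shows "finite {l. \<exists>v. v \<noteq> 0 \<and> A *v v = l *\<^sub>R v}" (is "finite ?E")
proof -
  obtain f where f: "\<And>l. l \<in> ?E \<Longrightarrow> f l \<noteq> 0 \<and> A *v f l = l *\<^sub>R f l"
    using bchoice[of ?E "\<lambda>l v. v \<noteq> 0 \<and> A *v v = l *\<^sub>R v"] by blast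
  have orth: "f l \<bullet> f m = 0" if "l \<in> ?E" "m \<in> ?E" "l \<noteq> m" for l m
  proof -
    have "l * (f l \<bullet> f m) = m * (f l \<bullet> f m)"
      using symmetric_matrix_inner[OF sym, of "f l" "f m"] f that by simp
    then show ?thesis using that by simp
  qed
  have "inj_on f ?E"
  proof (rule inj_onI, rule ccontr)
    fix l m assume "l \<in> ?E" "m \<in> ?E" "f l = f m" "l \<noteq> m"
    then show False using orth[of l m] f[of m] by simp
  qed
  moreover have "pairwise orthogonal (f ` ?E)"
    unfolding pairwise_def orthogonal_def using orth by blast
  then have "independent (f ` ?E)"
    using f by (intro pairwise_orthogonal_independent) (metis (mono_tags, lifting) imageE)+
  then have "finite (f ` ?E)" by (rule finiteI_independent)
  ultimately show ?thesis by (rule finite_imageD[rotated])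
qed

text \<open>A maximizer u of the quadratic form on the compact unit sphere is an eigenvector, so the
  maximum is one of the eigenvalues over which \<open>Max\<close> ranges.\<close>

lemma rayleigh_le_lambda_max:
  fixes A :: "real^'n^'n" assumes sym: "transpose A = A"
  shows "v \<bullet> (A *v v) \<le> lambda_max A * (norm v)\<^sup>2"
proof -
  have "sphere (0::real^'n) 1 \<noteq> {}" by simp
  moreover have "continuous_on (sphere 0 1) (\<lambda>v::real^'n. v \<bullet> (A *v v))"
    by (intro continuous_intros linear_continuous_on) simp
  ultimately obtain u where u: "u \<in> sphere 0 1"
    and max: "\<And>x. x \<in> sphere 0 1 \<Longrightarrow> x \<bullet> (A *v x) \<le> u \<bullet> (A *v u)"
    using continuous_attains_sup[OF compact_sphere] by blast
  define l where "l = u \<bullet> (A *v u)"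
  have le: "x \<bullet> (A *v x) \<le> l * (norm x)\<^sup>2" for x
  proof (cases "x = 0")
    case False
    have "sgn x \<bullet> (A *v sgn x) \<le> l" using max[of "sgn x"] False by (simp add: l_def norm_sgn)
    moreover have "x \<bullet> (A *v x) = (norm x)\<^sup>2 * (sgn x \<bullet> (A *v sgn x))"
      using arg_cong[OF norm_scaleR_sgn[of x], of "\<lambda>y. y \<bullet> (A *v y)"]
      by (simp add: matrix_vector_mult_scaleR power2_eq_square)
    ultimately show ?thesis using False by (simp add: mult.commute)
  qed simp
  \<comment> \<open>w is the residual of the eigenvalue equation. Perturbing u in the direction w
    gives a nonnegative parabola in t that vanishes at 0 with slope 2 |w|^2, which forces w =
    0.\<close>
  define w where "w = l *\<^sub>R u - A *v u"
  define d where "d = w \<bullet> (l *\<^sub>R w - A *v w)"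
  have uw: "u \<bullet> w = 0" using u by (simp add: w_def l_def inner_diff_right dot_square_norm)
  have quad: "0 \<le> 2 * t * (norm w)\<^sup>2 + t\<^sup>2 * d" for t
  proof -
    let ?x = "u + t *\<^sub>R w"
    have "0 \<le> ?x \<bullet> (l *\<^sub>R ?x - A *v ?x)"
      using le[of ?x] by (simp add: inner_diff_right dot_square_norm)
    also have "l *\<^sub>R ?x - A *v ?x = w + t *\<^sub>R (l *\<^sub>R w - A *v w)"
      by (simp add: w_def algebra_simps matrix_vector_right_distrib matrix_vector_mult_scaleR)
    also have "?x \<bullet> (w + t *\<^sub>R (l *\<^sub>R w - A *v w))
        = u \<bullet> w + t * (u \<bullet> (l *\<^sub>R w - A *v w)) + t * (w \<bullet> w) + t\<^sup>2 * d"
      by (simp add: inner_add_left inner_add_right d_def power2_eq_square algebra_simps)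
    also have "u \<bullet> (l *\<^sub>R w - A *v w) = w \<bullet> w"
    proof -
      have "u \<bullet> (l *\<^sub>R w - A *v w) = l * (u \<bullet> w) - (A *v u) \<bullet> w"
        by (simp only: inner_diff_right inner_scaleR_right symmetric_matrix_inner[OF sym])
      also have "\<dots> = (l *\<^sub>R u - A *v u) \<bullet> w" by (simp only: inner_diff_left inner_scaleR_left)
      finally show ?thesis by (simp only: w_def[symmetric])
    qed
    finally show ?thesis by (simp add: uw dot_square_norm)
  qed
  have "w = 0"
  proof (rule ccontr)
    assume "w \<noteq> 0"
    define n where "n = (norm w)\<^sup>2"
    have n: "n > 0" using \<open>w \<noteq> 0\<close> by (simp add: n_def)
    \<comment> \<open>With this e the quadratic term e^2 d is at most e n, half of the size of the
      linear term, so t = -e contradicts \<open>quad\<close>.\<close>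
    define e where "e = n / (\<bar>d\<bar> + 1)"
    have e: "e > 0" using n by (simp add: e_def add_nonneg_pos)
    have "e * d \<le> e * (\<bar>d\<bar> + 1)" using e by (intro mult_left_mono) auto
    also have "\<dots> = n" by (simp add: e_def)
    finally have "e * (e * d) \<le> e * n" using e by (intro mult_left_mono) auto
    moreover have "0 \<le> 2 * (- e) * n + (- e)\<^sup>2 * d" using quad[of "- e"] by (simp add: n_def)
    ultimately have "e * n \<le> 0" by (simp add: power2_eq_square mult_ac)
    then show False using e n by (simp add: mult_le_0_iff)
  qed
  then have "A *v u = l *\<^sub>R u" by (simp add: w_def)
  moreover have "u \<noteq> 0" using u by auto
  ultimately have "l \<in> {l. \<exists>v. v \<noteq> 0 \<and> A *v v = l *\<^sub>R v}" by blast
  then have "l \<le> lambda_max A"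
    unfolding lambda_max_def using finite_eigenvalues_symmetric[OF sym] by (intro Max_ge)
  then show ?thesis using le[of v] mult_right_mono[of l "lambda_max A" "(norm v)\<^sup>2"] by simp
qed

section \<open>Finiteness of E(1 / |X - z|) for almost every z\<close>

text \<open>Summing over dyadic shells; the dimension enters through the volume of the balls.\<close>

lemma nn_integral_inverse_norm_ball:
  assumes "DIM('a::euclidean_space) \<ge> 2"
  shows "(\<integral>\<^sup>+w. ennreal (indicator (ball 0 1) w / norm w) \<partial>(lborel :: 'a measure)) < \<infinity>"
proof -
  have le_suminf: "F k \<le> (\<Sum>k. F k)" for F :: "nat \<Rightarrow> ennreal" and k
  proof -
    have "sum F {k} \<le> (\<Sum>k. F k)" by (rule sum_le_suminf) (auto intro: summableI)
    moreover have "sum F {k} = F k" by simp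
    ultimately show ?thesis by simp
  qed
  \<comment> \<open>On the shell 2^(-k-1) <= |w| < 2^(-k) the function 1 / |w| is at most 2^(k+1);
    replacing the shell by the ball only enlarges the bound.\<close>
  define f where "f k w = ennreal (2 ^ (k + 1)) * indicator (ball 0 (1 / 2 ^ k)) w" for k and w :: 'a
  have [measurable]: "f k \<in> borel_measurable borel" for k
  proof -
    have [measurable]: "ball (0::'a) (1 / 2 ^ k) \<in> sets borel" by simp
    show ?thesis unfolding f_def by measurable
  qed
  let ?v = "unit_ball_vol (real DIM('a))"
  have pw: "ennreal (indicator (ball 0 1) w / norm w) \<le> (\<Sum>k. f k w)" for w :: 'a
  proof (cases "w \<noteq> 0 \<and> norm w < 1")
    case True
    then obtain j :: nat where j: "(1 / 2) ^ j < norm w"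
      using real_arch_pow_inv[of "norm w" "1 / 2"] by auto
    define k where "k = (LEAST j. (1 / 2) ^ (j + 1) \<le> norm w)"
    have "(1 / 2 :: real) ^ (j + 1) \<le> (1 / 2) ^ j" by (intro power_decreasing) auto
    with j have "(1 / 2) ^ (j + 1) \<le> norm w" by linarith
    then have k1: "(1 / 2) ^ (k + 1) \<le> norm w"
      unfolding k_def by (rule LeastI)
    have k2: "norm w < (1 / 2) ^ k"
    proof (cases k)
      case (Suc i)
      then have "\<not> (1 / 2) ^ (i + 1) \<le> norm w"
        using not_less_Least[of i "\<lambda>j. (1 / 2) ^ (j + 1) \<le> norm w"] k_def by simp
      then show ?thesis using Suc by simp
    qed (use True in simp)
    have "1 \<le> norm w * 2 ^ (k + 1)" using k1 by (simp add: power_divide divide_le_eq)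
    then have "indicator (ball 0 1) w / norm w \<le> (2::real) ^ (k + 1)"
      using True by (simp add: divide_le_eq indicator_def mult.commute)
    then have "ennreal (indicator (ball 0 1) w / norm w) \<le> f k w"
      using k2 True by (simp add: f_def power_divide ennreal_leI del: power_Suc)
    also have "\<dots> \<le> (\<Sum>k. f k w)"
      by (rule le_suminf)
    finally show ?thesis .
  qed (auto simp: indicator_def)
  have "(\<integral>\<^sup>+w. ennreal (indicator (ball 0 1) w / norm w) \<partial>(lborel :: 'a measure))
      \<le> (\<integral>\<^sup>+w. (\<Sum>k. f k w) \<partial>lborel)"
    by (intro nn_integral_mono pw)
  also have "\<dots> = (\<Sum>k. \<integral>\<^sup>+w. f k w \<partial>lborel)"
    by (intro nn_integral_suminf) measurable
  also have "\<dots> \<le> (\<Sum>k. ennreal (2 * ?v * (1 / 2) ^ k))"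
  proof (intro suminf_le summableI)
    fix k
    have "(\<integral>\<^sup>+w. f k w \<partial>lborel) = ennreal (2 ^ (k + 1)) * emeasure lborel (ball (0::'a) (1 / 2 ^ k))"
      unfolding f_def by (subst nn_integral_cmult_indicator) auto
    also have "\<dots> = ennreal (2 ^ (k + 1) * (?v * (1 / 2 ^ k) ^ DIM('a)))"
      by (subst emeasure_ball) (auto simp: ennreal_mult'[symmetric])
    \<comment> \<open>Lowering the exponent from the dimension to 2 is enough: 2^(k+1) against
      4^(-k) leaves a geometric series.\<close>
    also have "\<dots> \<le> ennreal (2 ^ (k + 1) * (?v * (1 / 2 ^ k) ^ 2))"
      using assms by (intro ennreal_leI mult_left_mono power_decreasing) (auto simp: divide_le_eq)
    also have "2 ^ (k + 1) * (?v * (1 / 2 ^ k) ^ 2) = 2 * ?v * (1 / 2) ^ k"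
      by (simp add: power2_eq_square power_divide field_simps)
    finally show "(\<integral>\<^sup>+w. f k w \<partial>lborel) \<le> ennreal (2 * ?v * (1 / 2) ^ k)" .
  qed
  also have "\<dots> = ennreal (\<Sum>k. 2 * ?v * (1 / 2) ^ k)"
    by (intro suminf_ennreal2) (auto intro!: summable_mult summable_geometric)
  also have "\<dots> < \<infinity>" by simp
  finally show ?thesis .
qed

text \<open>By Tonelli, convolving P with the integrable kernel 1 / |w| on the unit ball gives a
  function with finite integral, hence finite almost everywhere. Where |x - z| >= 1, the integrand
  is at most 1.\<close>

lemma AE_finite_inverse_norm_integral:
  fixes P :: "'a::euclidean_space measure"
  assumes "prob_space P" and sets [measurable_cong, simp]: "sets P = sets borel"
    and dim: "DIM('a) \<ge> 2"
  shows "AE z in lborel. (\<integral>\<^sup>+x. ennreal (1 / norm (x - z)) \<partial>P) < \<infinity>"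
proof -
  interpret P: prob_space P by fact
  interpret PL: pair_sigma_finite P "lborel :: 'a measure" ..
  let ?k = "\<lambda>w::'a. ennreal (indicator (ball 0 1) w / norm w)"
  have [measurable]: "ball (0::'a) 1 \<in> sets borel" by simp
  have [measurable]: "?k \<in> borel_measurable borel" by measurable
  have shift: "(\<integral>\<^sup>+z. ?k (z - x) \<partial>lborel) = (\<integral>\<^sup>+w. ?k w \<partial>lborel)" for x
  proof -
    have "(\<integral>\<^sup>+w. ?k w \<partial>lborel) = (\<integral>\<^sup>+w. ?k w \<partial>distr lborel borel ((+) (- x)))"
      by (simp only: lborel_distr_plus)
    also have "\<dots> = (\<integral>\<^sup>+z. ?k (- x + z) \<partial>lborel)"
      by (subst nn_integral_distr) auto
    finally show ?thesis by simp
  qed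
  have "(\<integral>\<^sup>+z. (\<integral>\<^sup>+x. ?k (z - x) \<partial>P) \<partial>lborel) = (\<integral>\<^sup>+x. (\<integral>\<^sup>+z. ?k (z - x) \<partial>lborel) \<partial>P)"
    by (rule PL.Fubini') measurable
  also have "\<dots> = (\<integral>\<^sup>+w. ?k w \<partial>lborel)"
    unfolding shift by (simp add: P.emeasure_space_1)
  finally have "(\<integral>\<^sup>+z. (\<integral>\<^sup>+x. ?k (z - x) \<partial>P) \<partial>lborel) \<noteq> \<infinity>"
    using nn_integral_inverse_norm_ball[OF dim] by auto
  then have "AE z in lborel. (\<integral>\<^sup>+x. ?k (z - x) \<partial>P) \<noteq> \<infinity>"
    by (intro nn_integral_PInf_AE) measurable
  then show ?thesis
  proof (rule AE_mp, intro AE_I2 impI)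
    fix z assume fin: "(\<integral>\<^sup>+x. ?k (z - x) \<partial>P) \<noteq> \<infinity>"
    have "(\<integral>\<^sup>+x. ennreal (1 / norm (x - z)) \<partial>P) \<le> (\<integral>\<^sup>+x. 1 + ?k (z - x) \<partial>P)"
    proof (intro nn_integral_mono)
      fix x
      have "1 / norm (x - z) \<le> 1 + indicator (ball 0 1) (z - x) / norm (z - x)"
        by (cases "norm (z - x) < 1") (auto simp: indicator_def norm_minus_commute divide_le_eq)
      then have "ennreal (1 / norm (x - z)) \<le> ennreal (1 + indicator (ball 0 1) (z - x) / norm (z - x))"
        by (rule ennreal_leI)
      also have "\<dots> = 1 + ?k (z - x)" by (subst ennreal_plus) auto
      finally show "ennreal (1 / norm (x - z)) \<le> 1 + ?k (z - x)" .
    qed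
    also have "\<dots> = 1 + (\<integral>\<^sup>+x. ?k (z - x) \<partial>P)"
      by (subst nn_integral_add) (auto simp: P.emeasure_space_1)
    also have "\<dots> < \<infinity>" using fin by (simp add: less_top[symmetric])
    finally show "(\<integral>\<^sup>+x. ennreal (1 / norm (x - z)) \<partial>P) < \<infinity>" .
  qed
qed

text \<open>The second derivative of the norm at y as a quadratic form in h; division by zero gives
  it the value 0 at y = 0.\<close>

definition norm_hessian :: "'e::real_inner \<Rightarrow> 'e \<Rightarrow> real" where
  "norm_hessian h y = (norm h)\<^sup>2 / norm y - (y \<bullet> h)\<^sup>2 / norm y ^ 3"

lemma norm_hessian_minus: "norm_hessian h (x - y) = norm_hessian h (y - x)"
  by (simp add: norm_hessian_def norm_minus_commute inner_diff_left power2_commute)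

lemma norm_hessian_nonneg: "0 \<le> norm_hessian h y"
proof (cases "y = 0")
  case False
  have "(y \<bullet> h)\<^sup>2 \<le> (norm y)\<^sup>2 * (norm h)\<^sup>2"
    using Cauchy_Schwarz_ineq[of y h] by (simp add: power2_norm_eq_inner)
  then have "(y \<bullet> h)\<^sup>2 / norm y ^ 3 \<le> (norm y)\<^sup>2 * (norm h)\<^sup>2 / norm y ^ 3"
    by (intro divide_right_mono) auto
  also have "\<dots> = (norm h)\<^sup>2 / norm y"
    using False by (simp add: power2_eq_square power3_eq_cube)
  finally show ?thesis by (simp add: norm_hessian_def)
qed (simp add: norm_hessian_def)

lemma norm_hessian_le: "norm_hessian h y \<le> (norm h)\<^sup>2 / norm y"
  by (simp add: norm_hessian_def)

lemma has_real_derivative_sgn_inner: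
  fixes a h :: "'e::real_inner" assumes "a + t *\<^sub>R h \<noteq> 0"
  shows "((\<lambda>t. sgn (a + t *\<^sub>R h) \<bullet> h) has_real_derivative norm_hessian h (a + t *\<^sub>R h)) (at t)"
proof -
  let ?N = "\<lambda>t. (a + t *\<^sub>R h) \<bullet> (a + t *\<^sub>R h)"
  let ?D = "\<lambda>t. (a + t *\<^sub>R h) \<bullet> h"
  have eq: "(\<lambda>t. sgn (a + t *\<^sub>R h) \<bullet> h) = (\<lambda>t. ?D t / sqrt (?N t))"
    by (simp add: sgn_div_norm norm_eq_sqrt_inner divide_inverse_commute)
  have N: "?N t > 0" using assms by simp
  have N_eq: "?N = (\<lambda>t. a \<bullet> a + 2 * t * (a \<bullet> h) + t * t * (h \<bullet> h))"
    by (simp add: inner_add_left inner_add_right inner_commute[of a h] algebra_simps)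
  have D_eq: "?D = (\<lambda>t. a \<bullet> h + t * (h \<bullet> h))" by (simp add: inner_add_left)
  have dN: "(?N has_real_derivative 2 * ?D t) (at t)"
    unfolding N_eq unfolding inner_add_left inner_scaleR_left
    by (auto intro!: derivative_eq_intros simp: algebra_simps)
  have dD: "(?D has_real_derivative h \<bullet> h) (at t)"
    unfolding D_eq by (auto intro!: derivative_eq_intros)
  have dS: "((\<lambda>t. sqrt (?N t)) has_real_derivative inverse (sqrt (?N t)) / 2 * (2 * ?D t)) (at t)"
    by (rule DERIV_chain2[OF DERIV_real_sqrt[OF N] dN])
  have "((\<lambda>t. ?D t / sqrt (?N t)) has_real_derivative
      (h \<bullet> h * sqrt (?N t) - ?D t * (inverse (sqrt (?N t)) / 2 * (2 * ?D t)))
        / (sqrt (?N t) * sqrt (?N t))) (at t)"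
    by (rule DERIV_divide[OF dD dS]) (use N in simp)
  moreover have "(h \<bullet> h * sqrt (?N t) - ?D t * (inverse (sqrt (?N t)) / 2 * (2 * ?D t)))
        / (sqrt (?N t) * sqrt (?N t)) = norm_hessian h (a + t *\<^sub>R h)"
  proof -
    have "sqrt (?N t) = norm (a + t *\<^sub>R h)" by (simp add: norm_eq_sqrt_inner)
    then show ?thesis
      using assms by (simp only: norm_hessian_def power2_norm_eq_inner)
        (simp add: field_simps power2_eq_square power3_eq_cube)
  qed
  ultimately show ?thesis unfolding eq by simp
qed

lemma borel_measurable_sgn [measurable (raw)]:
  fixes f :: "'a \<Rightarrow> 'e::euclidean_space"
  shows "f \<in> borel_measurable M \<Longrightarrow> (\<lambda>x. sgn (f x)) \<in> borel_measurable M"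
  unfolding sgn_div_norm by measurable

lemma borel_measurable_norm_hessian [measurable (raw)]:
  fixes f g :: "'a \<Rightarrow> 'e::euclidean_space"
  assumes [measurable]: "f \<in> borel_measurable M" "g \<in> borel_measurable M"
  shows "(\<lambda>x. norm_hessian (f x) (g x)) \<in> borel_measurable M"
  unfolding norm_hessian_def by measurable

text \<open>Lebesgue measure is a constant multiple of its image under a nondegenerate affine map,
  so null sets correspond.\<close>

lemma AE_lborel_affine:
  fixes Q :: "'a::euclidean_space \<Rightarrow> bool"
  assumes "AE z in lborel. Q z" and [measurable]: "Measurable.pred borel Q" and "t \<noteq> 0"
  shows "AE h in lborel. Q (\<mu> + t *\<^sub>R h)"
proof -
  have "AE z in density (distr lborel borel (\<lambda>x. \<mu> + t *\<^sub>R x)) (\<lambda>_. ennreal (\<bar>t\<bar> ^ DIM('a))). Q z"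
    by (rule iffD1[OF arg_cong[OF lborel_affine[OF \<open>t \<noteq> 0\<close>, of \<mu>], of "\<lambda>M. AE z in M. Q z"] assms(1)])
  then have "AE z in distr lborel borel (\<lambda>x. \<mu> + t *\<^sub>R x). Q z"
    using \<open>t \<noteq> 0\<close> by (subst (asm) AE_density) auto
  then show ?thesis by (subst (asm) AE_distr_iff) auto
qed

text \<open>The line through 0 and x is a null set in dimension at least 2. Strict Cauchy-Schwarz
  expresses being off this line as a condition jointly measurable in x and h, which the later
  exchange of almost-everywhere quantifiers requires.\<close>

lemma AE_not_parallel:
  fixes x :: "'a::euclidean_space"
  assumes "DIM('a) \<ge> 2" "x \<noteq> 0"
  shows "AE h in lborel. (x \<bullet> h)\<^sup>2 < (norm x)\<^sup>2 * (norm h)\<^sup>2"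
proof -
  have "dim (span {x}) < DIM('a)" using assms by simp
  then have "negligible (span {x})" by (rule negligible_lowdim)
  then have "AE h in lebesgue. h \<notin> span {x}"
    unfolding negligible_iff_null_sets by (rule AE_not_in)
  moreover have "Measurable.pred borel (\<lambda>h. h \<notin> span {x})"
    using closed_span[of "{x}"] by (simp add: pred_def flip: Compl_eq)
  ultimately have "AE h in lborel. h \<notin> span {x}"
    by (subst (asm) AE_completion_iff) (auto simp: pred_def)
  then show ?thesis
  proof (rule AE_mp, intro AE_I2 impI)
    fix h assume h: "h \<notin> span {x}"
    have "(x \<bullet> h)\<^sup>2 \<le> (norm x)\<^sup>2 * (norm h)\<^sup>2"
      using Cauchy_Schwarz_ineq[of x h] by (simp add: power2_norm_eq_inner)
    moreover have "(x \<bullet> h)\<^sup>2 \<noteq> (norm x)\<^sup>2 * (norm h)\<^sup>2"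
    proof
      assume eq: "(x \<bullet> h)\<^sup>2 = (norm x)\<^sup>2 * (norm h)\<^sup>2"
      let ?w = "h - ((x \<bullet> h) / (x \<bullet> x)) *\<^sub>R x"
      have "?w \<bullet> ?w = h \<bullet> h - (x \<bullet> h)\<^sup>2 / (x \<bullet> x)"
        using assms(2)
        by (simp add: inner_diff_left inner_diff_right inner_commute power2_eq_square)
      also have "\<dots> = 0" using eq assms(2) by (simp add: power2_norm_eq_inner)
      finally have "h = ((x \<bullet> h) / (x \<bullet> x)) *\<^sub>R x" by simp
      then show False using h by (metis span_base span_mul singletonI)
    qed
    ultimately show "(x \<bullet> h)\<^sup>2 < (norm x)\<^sup>2 * (norm h)\<^sup>2" by simp
  qed
qed

section \<open>Increments of E|X - z| and of its gradient for an atomless law\<close>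

locale atomless_law = prob_space P for P :: "'a::euclidean_space measure" +
  assumes sets_P [measurable_cong, simp]: "sets P = sets borel"
    and atomless: "\<And>z. AE x in P. x \<noteq> z"
    and dim: "DIM('a) \<ge> 2"
begin

lemma integrable_sgn: "integrable P (\<lambda>x. sgn (f x))" if [measurable]: "f \<in> borel_measurable borel"
  for f :: "'a \<Rightarrow> 'a"
  by (rule integrable_const_bound[of _ 1]) (auto simp: norm_sgn)

lemma integrable_norm_increment: "integrable P (\<lambda>x. norm (z + h - x) - norm (z - x))"
proof (rule integrable_const_bound[of _ "norm h"])
  have "\<bar>norm (z + h - x) - norm (z - x)\<bar> \<le> norm h" for x
    using norm_triangle_ineq3[of "z + h - x" "z - x"] by simp
  then show "AE x in P. norm (norm (z + h - x) - norm (z - x)) \<le> norm h" by simp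
qed measurable

text \<open>The increment of the gradient of z -> E|X - z| between \<open>\<mu>\<close> and
  \<open>\<mu> + h\<close>, paired with h. As a single integral of a bounded function it makes sense
  without moments of P.\<close>

definition sgn_increment :: "'a \<Rightarrow> 'a \<Rightarrow> real" where
  "sgn_increment \<mu> h = (\<integral>x. (sgn (\<mu> + h - x) - sgn (\<mu> - x)) \<bullet> h \<partial>P)"

lemma integrable_sgn_increment: "integrable P (\<lambda>x. (sgn (\<mu> + h - x) - sgn (\<mu> - x)) \<bullet> k)"
  by (intro integrable_inner_left Bochner_Integration.integrable_diff integrable_sgn) measurable

text \<open>\<open>sgn\<close> is discontinuous only at 0, and an atomless law gives probability 0
  to the sample hitting \<open>\<mu> + h\<close>; dominated convergence with bound 1
  applies.\<close>

lemma continuous_on_sgn_increment: "continuous_on UNIV (sgn_increment \<mu>)"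
proof -
  have "isCont (\<lambda>h. \<integral>x. sgn (\<mu> + h - x) \<partial>P) h" for h
    unfolding continuous_at_sequentially
  proof (intro allI impI)
    fix u assume u: "u \<longlonglongrightarrow> h"
    have "(\<lambda>n. \<integral>x. sgn (\<mu> + u n - x) \<partial>P) \<longlonglongrightarrow> (\<integral>x. sgn (\<mu> + h - x) \<partial>P)"
    proof (rule integral_dominated_convergence[where w="\<lambda>_. 1"])
      show "AE x in P. (\<lambda>n. sgn (\<mu> + u n - x)) \<longlonglongrightarrow> sgn (\<mu> + h - x)"
        using atomless[of "\<mu> + h"] by eventually_elim (intro tendsto_intros u, simp)
    qed (auto simp: norm_sgn)
    then show "((\<lambda>h. \<integral>x. sgn (\<mu> + h - x) \<partial>P) \<circ> u) \<longlonglongrightarrow> (\<integral>x. sgn (\<mu> + h - x) \<partial>P)"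
      by (simp add: o_def)
  qed
  then have "continuous_on UNIV (\<lambda>h. \<integral>x. sgn (\<mu> + h - x) \<partial>P)"
    by (simp add: continuous_at_imp_continuous_on)
  moreover have "sgn_increment \<mu> h = ((\<integral>x. sgn (\<mu> + h - x) \<partial>P) - (\<integral>x. sgn (\<mu> - x) \<partial>P)) \<bullet> h" for h
    unfolding sgn_increment_def
    by (simp add: integrable_sgn flip: Bochner_Integration.integral_diff)
  ultimately show ?thesis
    by (auto intro!: continuous_intros)
qed

text \<open>For fixed nonzero t the map h -> mu + t h pulls null sets back to null sets, and Fubini
  exchanges the two quantifiers. The degenerate value t = 0 is itself a null set.\<close>

lemma AE_integrable_along_ray:
  "AE h in lborel. AE t in lborel. integrable P (\<lambda>x. 1 / norm (x - (\<mu> + t *\<^sub>R h)))"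
proof -
  let ?Q = "\<lambda>z. (\<integral>\<^sup>+x. ennreal (1 / norm (x - z)) \<partial>P) < \<infinity>"
  have "AE t in lborel. AE h in lborel. ?Q (\<mu> + t *\<^sub>R h)"
    using AE_lborel_singleton[of 0]
  proof eventually_elim
    case (elim t)
    then show ?case
      using AE_finite_inverse_norm_integral[OF prob_space_axioms sets_P dim]
      by (intro AE_lborel_affine) auto
  qed
  moreover have "{p \<in> space (lborel \<Otimes>\<^sub>M lborel). ?Q (\<mu> + fst p *\<^sub>R snd p)} \<in> sets (lborel \<Otimes>\<^sub>M lborel)"
    by measurable
  ultimately have "AE h in lborel. AE t in lborel. ?Q (\<mu> + t *\<^sub>R h)"
    using lborel_pair.AE_commute[of "\<lambda>t h. ?Q (\<mu> + t *\<^sub>R h)"] by blast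
  then show ?thesis
  proof eventually_elim
    case (elim h)
    then show ?case
    proof eventually_elim
      case (elim t)
      then show ?case by (intro integrableI_bounded) auto
    qed
  qed
qed

lemma AE_AE_not_parallel:
  "AE h in lborel. AE x in P. ((x - \<mu>) \<bullet> h)\<^sup>2 < (norm (x - \<mu>))\<^sup>2 * (norm h)\<^sup>2"
proof -
  interpret L: pair_sigma_finite P "lborel :: 'a measure" ..
  have "AE x in P. AE h in lborel. ((x - \<mu>) \<bullet> h)\<^sup>2 < (norm (x - \<mu>))\<^sup>2 * (norm h)\<^sup>2"
    using atomless[of \<mu>] by eventually_elim (intro AE_not_parallel dim, simp)
  moreover have "{p \<in> space (P \<Otimes>\<^sub>M lborel). ((fst p - \<mu>) \<bullet> snd p)\<^sup>2
      < (norm (fst p - \<mu>))\<^sup>2 * (norm (snd p))\<^sup>2} \<in> sets (P \<Otimes>\<^sub>M lborel)"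
    by measurable
  ultimately show ?thesis
    using L.AE_commute[of "\<lambda>x h. ((x - \<mu>) \<bullet> h)\<^sup>2 < (norm (x - \<mu>))\<^sup>2 * (norm h)\<^sup>2"] by blast
qed

text \<open>Integrating the Hessian of the norm along the segment from \<open>\<mu>\<close> to \<open>\<mu> + h\<close> only requires
  the bound at the points where the Hessian of \<open>z \<mapsto> E (norm (X - z))\<close> is an absolutely convergent
  integral. Almost every segment consists of such points up to a null set, and the remaining
  segments are reached by continuity.\<close>

lemma sgn_increment_le:
  assumes \<Lambda>: "\<Lambda> \<ge> 0" and R: "R > 0"
    and hess: "\<And>z h. z \<in> cball \<mu> R \<Longrightarrow> integrable P (\<lambda>x. 1 / norm (x - z)) \<Longrightarrow>
      (\<integral>x. norm_hessian h (x - z) \<partial>P) \<le> \<Lambda> * (norm h)\<^sup>2"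
    and h: "h \<in> cball 0 R"
  shows "sgn_increment \<mu> h \<le> \<Lambda> * (norm h)\<^sup>2"
proof -
  interpret L: pair_sigma_finite P "lborel :: real measure" ..
  have ae: "AE h in lborel. h \<in> cball 0 R \<longrightarrow> sgn_increment \<mu> h \<le> \<Lambda> * (norm h)\<^sup>2"
    using AE_integrable_along_ray[of \<mu>] AE_AE_not_parallel[of \<mu>]
  proof eventually_elim
    case (elim h)
    show ?case
    proof
    let ?q = "\<lambda>x t. norm_hessian h (\<mu> - x + t *\<^sub>R h)"
    \<comment> \<open>For almost every x the line through mu in direction h misses x. Then t ->
      sgn(mu - x + t h) . h is differentiable on the whole segment with nonnegative derivative, so
      the fundamental theorem of calculus applies.\<close>
    have ftc: "AE x in P. ennreal ((sgn (\<mu> + h - x) - sgn (\<mu> - x)) \<bullet> h)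
        = (\<integral>\<^sup>+t. ennreal (?q x t) * indicator {0..1} t \<partial>lborel)"
      using elim(2)
    proof eventually_elim
      case (elim x)
      \<comment> \<open>A zero would make x - mu a multiple of h, giving equality in the strict
        Cauchy-Schwarz inequality.\<close>
      have nz: "\<mu> - x + t *\<^sub>R h \<noteq> 0" for t
      proof
        assume "\<mu> - x + t *\<^sub>R h = 0"
        then have "x - \<mu> = t *\<^sub>R h" by (simp add: algebra_simps)
        then have "((x - \<mu>) \<bullet> h)\<^sup>2 = t\<^sup>2 * ((norm h)\<^sup>2 * (norm h)\<^sup>2)"
          and "(norm (x - \<mu>))\<^sup>2 * (norm h)\<^sup>2 = t\<^sup>2 * ((norm h)\<^sup>2 * (norm h)\<^sup>2)"
          by (simp_all add: dot_square_norm power_mult_distrib power2_eq_square[of "(norm h)\<^sup>2"])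
        with elim show False by simp
      qed
      have "(\<integral>\<^sup>+t. ennreal (?q x t) * indicator {0..1} t \<partial>lborel)
          = ennreal (sgn (\<mu> - x + 1 *\<^sub>R h) \<bullet> h - sgn (\<mu> - x + 0 *\<^sub>R h) \<bullet> h)"
        by (rule nn_integral_FTC_Icc)
           (auto intro!: has_real_derivative_sgn_inner nz norm_hessian_nonneg)
      also have "\<dots> = ennreal ((sgn (\<mu> + h - x) - sgn (\<mu> - x)) \<bullet> h)"
        by (simp add: inner_diff_left algebra_simps)
      finally show ?case ..
    qed
    have nonneg: "0 \<le> (sgn (\<mu> + h - x) - sgn (\<mu> - x)) \<bullet> h" for x
      using sgn_monotone[of "\<mu> - x" h] by (simp add: algebra_simps)
    assume hR: "h \<in> cball 0 R"
    have "ennreal (sgn_increment \<mu> h) = (\<integral>\<^sup>+x. ennreal ((sgn (\<mu> + h - x) - sgn (\<mu> - x)) \<bullet> h) \<partial>P)"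
      unfolding sgn_increment_def
      by (rule nn_integral_eq_integral[symmetric]) (auto intro!: integrable_sgn_increment nonneg)
    also have "\<dots> = (\<integral>\<^sup>+x. (\<integral>\<^sup>+t. ennreal (?q x t) * indicator {0..1} t \<partial>lborel) \<partial>P)"
      by (intro nn_integral_cong_AE ftc)
    \<comment> \<open>After exchanging t and x the Hessian bound is applied at mu + t h, a point of
      absolute convergence for almost every t.\<close>
    also have "\<dots> = (\<integral>\<^sup>+t. (\<integral>\<^sup>+x. ennreal (?q x t) * indicator {0..1} t \<partial>P) \<partial>lborel)"
      by (rule L.Fubini'[symmetric]) measurable
    also have "\<dots> \<le> (\<integral>\<^sup>+(t::real). ennreal (\<Lambda> * (norm h)\<^sup>2) * indicator {0..1} t \<partial>lborel)"
    proof (rule nn_integral_mono_AE)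
      show "AE t in lborel. (\<integral>\<^sup>+x. ennreal (?q x t) * indicator {0..1} t \<partial>P)
          \<le> ennreal (\<Lambda> * (norm h)\<^sup>2) * indicator {0..1} t"
        using elim(1)
      proof eventually_elim
        case (elim t)
        show ?case
        proof (cases "t \<in> {0..1}")
          case True
          let ?z = "\<mu> + t *\<^sub>R h"
          have "norm (t *\<^sub>R h) \<le> 1 * R"
            unfolding norm_scaleR using True hR by (intro mult_mono) auto
          then have z: "?z \<in> cball \<mu> R" by (simp add: dist_norm)
          have q: "?q x t = norm_hessian h (x - ?z)" for x
            using norm_hessian_minus[of h x ?z] by (simp add: algebra_simps)
          have "integrable P (\<lambda>x. norm_hessian h (x - ?z))"
          proof (rule Bochner_Integration.integrable_bound)
            show "integrable P (\<lambda>x. (norm h)\<^sup>2 * (1 / norm (x - ?z)))"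
              by (intro integrable_mult_right elim)
            show "AE x in P. norm (norm_hessian h (x - ?z)) \<le> norm ((norm h)\<^sup>2 * (1 / norm (x - ?z)))"
              using norm_hessian_nonneg[of h] norm_hessian_le[of h] by simp
          qed measurable
          then have "(\<integral>\<^sup>+x. ennreal (?q x t) \<partial>P) = ennreal (\<integral>x. norm_hessian h (x - ?z) \<partial>P)"
            unfolding q by (intro nn_integral_eq_integral) (auto intro: norm_hessian_nonneg)
          also have "\<dots> \<le> ennreal (\<Lambda> * (norm h)\<^sup>2)"
            by (intro ennreal_leI hess z elim)
          finally show ?thesis using True by simp
        qed simp
      qed
    qed
    also have "\<dots> = ennreal (\<Lambda> * (norm h)\<^sup>2)"
      by (subst nn_integral_cmult_indicator) auto
    finally show "sgn_increment \<mu> h \<le> \<Lambda> * (norm h)\<^sup>2"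
      using \<Lambda> by (simp add: ennreal_le_iff)
    qed
  qed
  let ?S = "{h. sgn_increment \<mu> h \<le> \<Lambda> * (norm h)\<^sup>2}"
  have closed: "closed ?S"
    by (intro closed_Collect_le continuous_intros continuous_on_sgn_increment)
  \<comment> \<open>The violations in the open ball form an open null set, which must be empty;
    closedness of \<open>?S\<close> then adds the bounding sphere.\<close>
  have "ball 0 R \<subseteq> ?S"
  proof (rule ccontr)
    let ?V = "ball 0 R - ?S"
    assume "\<not> ball 0 R \<subseteq> ?S"
    then have "?V \<noteq> {}" by blast
    moreover have "open ?V" using closed by (intro open_Diff) auto
    moreover have "AE h in lborel. h \<notin> ?V" using ae by eventually_elim auto
    then have "?V \<in> null_sets lborel"
      using \<open>open ?V\<close> by (subst AE_iff_null_sets) auto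
    then have "?V \<in> null_sets lebesgue" by (rule null_sets_completionI)
    then have "negligible ?V" by (simp add: negligible_iff_null_sets)
    ultimately show False using open_not_negligible by blast
  qed
  then have "closure (ball 0 R) \<subseteq> ?S" using closed by (rule closure_minimal)
  then show ?thesis using h R by auto
qed

text \<open>A discrete form of integrating t Lambda |h|^2 over [0, 1], whence the factor 1/2. The
  segment is cut into n pieces, convexity bounds each increment of the norm by the gradient at the
  far end of the piece, and the sum of the resulting bounds tends to Lambda / 2 |h|^2.\<close>

lemma norm_increment_le:
  assumes \<Lambda>: "\<Lambda> \<ge> 0"
    and le: "\<And>h. h \<in> cball 0 R \<Longrightarrow> sgn_increment \<mu> h \<le> \<Lambda> * (norm h)\<^sup>2"
    and h: "h \<in> cball 0 R"
  shows "(\<integral>x. norm (\<mu> + h - x) - norm (\<mu> - x) - sgn (\<mu> - x) \<bullet> h \<partial>P) \<le> \<Lambda> / 2 * (norm h)\<^sup>2"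
    (is "?I \<le> _")
proof -
  have bound: "?I \<le> \<Lambda> * (norm h)\<^sup>2 * ((real n + 1) / (2 * real n))" if n: "n \<ge> 1" for n :: nat
  proof -
    define k where "k i = (real (Suc i) / real n) *\<^sub>R h" for i
    \<comment> \<open>\<open>sgn_increment\<close> pairs with \<open>k i\<close>, which is (i + 1) /
      n times h; dividing by i + 1 leaves the pairing with the single step h / n.\<close>
    let ?s = "\<lambda>i x. (1 / real (Suc i)) * ((sgn (\<mu> + k i - x) - sgn (\<mu> - x)) \<bullet> k i)"
    have pw: "norm (\<mu> + h - x) - norm (\<mu> - x) - sgn (\<mu> - x) \<bullet> h \<le> (\<Sum>i<n. ?s i x)" for x
    proof -
      define f where "f i = norm (\<mu> - x + (real i / real n) *\<^sub>R h)" for i :: nat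
      have "norm (\<mu> + h - x) - norm (\<mu> - x) = f n - f 0"
        using n by (simp add: f_def algebra_simps)
      also have "\<dots> = (\<Sum>i<n. f (Suc i) - f i)" by (simp add: sum_lessThan_telescope)
      also have "\<dots> \<le> (\<Sum>i<n. sgn (\<mu> + k i - x) \<bullet> ((1 / real n) *\<^sub>R h))"
      proof (rule sum_mono)
        fix i
        have "\<mu> - x + (real i / real n) *\<^sub>R h + (1 / real n) *\<^sub>R h = \<mu> + k i - x"
          by (simp add: k_def add_divide_distrib scaleR_add_left algebra_simps)
        then have "norm (\<mu> + k i - x) - f i \<le> sgn (\<mu> + k i - x) \<bullet> ((1 / real n) *\<^sub>R h)"
          using norm_diff_le_sgn_inner[of "\<mu> - x + (real i / real n) *\<^sub>R h" "(1 / real n) *\<^sub>R h"]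
          by (simp only: f_def)
        moreover have "f (Suc i) = norm (\<mu> + k i - x)"
          by (simp add: f_def k_def algebra_simps)
        ultimately show "f (Suc i) - f i \<le> sgn (\<mu> + k i - x) \<bullet> ((1 / real n) *\<^sub>R h)"
          by simp
      qed
      also have "\<dots> = (\<Sum>i<n. ?s i x + (1 / real n) * (sgn (\<mu> - x) \<bullet> h))"
      proof (intro sum.cong refl)
        fix i
        let ?d = "sgn (\<mu> + k i - x) - sgn (\<mu> - x)"
        have "?d \<bullet> k i = real (Suc i) / real n * (?d \<bullet> h)"
          by (subst (2) k_def) (simp only: inner_scaleR_right)
        then have "?s i x = (1 / real n) * (?d \<bullet> h)" by (simp del: of_nat_Suc)
        then show "sgn (\<mu> + k i - x) \<bullet> ((1 / real n) *\<^sub>R h)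
            = ?s i x + (1 / real n) * (sgn (\<mu> - x) \<bullet> h)"
          by (simp add: inner_diff_left diff_divide_distrib)
      qed
      also have "\<dots> = (\<Sum>i<n. ?s i x) + sgn (\<mu> - x) \<bullet> h"
        using n by (simp add: sum.distrib)
      finally show ?thesis by simp
    qed
    have "?I \<le> (\<integral>x. (\<Sum>i<n. ?s i x) \<partial>P)"
      by (intro integral_mono pw Bochner_Integration.integrable_diff integrable_norm_increment
          integrable_inner_left integrable_sgn Bochner_Integration.integrable_sum
          integrable_mult_right integrable_sgn_increment) measurable
    also have "\<dots> = (\<Sum>i<n. (1 / real (Suc i)) * sgn_increment \<mu> (k i))"
      unfolding sgn_increment_def
      by (subst Bochner_Integration.integral_sum) (auto intro!: integrable_sgn_increment integrable_divide)
    also have "\<dots> \<le> (\<Sum>i<n. (1 / real (Suc i)) * (\<Lambda> * (norm (k i))\<^sup>2))"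
    proof (intro sum_mono mult_left_mono le)
      fix i assume "i \<in> {..<n}"
      then have "real (Suc i) / real n \<le> 1" by simp
      then have "norm (k i) \<le> 1 * norm h"
        unfolding k_def norm_scaleR by (intro mult_right_mono) auto
      then show "k i \<in> cball 0 R" using h by simp
    qed simp
    also have "\<dots> = (\<Sum>i<n. \<Lambda> * (norm h)\<^sup>2 / (real n)\<^sup>2 * real (Suc i))"
      by (intro sum.cong) (auto simp: k_def power_mult_distrib power_divide power2_eq_square)
    also have "\<dots> = \<Lambda> * (norm h)\<^sup>2 / (real n)\<^sup>2 * (\<Sum>i<n. real (Suc i))"
      by (simp add: sum_distrib_left)
    also have "(\<Sum>i<n. real (Suc i)) = real n * (real n + 1) / 2"
      by (induction n) (auto simp: field_simps)
    also have "\<Lambda> * (norm h)\<^sup>2 / (real n)\<^sup>2 * (real n * (real n + 1) / 2)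
        = \<Lambda> * (norm h)\<^sup>2 * ((real n + 1) / (2 * real n))"
      using n by (simp add: power2_eq_square)
    finally show ?thesis .
  qed
  have "(\<lambda>n. \<Lambda> * (norm h)\<^sup>2 * ((real n + 1) / (2 * real n))) \<longlonglongrightarrow> \<Lambda> * (norm h)\<^sup>2 * (1 / 2)"
  proof (intro tendsto_mult_left)
    show "(\<lambda>n. (real n + 1) / (2 * real n)) \<longlonglongrightarrow> 1 / 2" by real_asymp
  qed
  then have "?I \<le> \<Lambda> * (norm h)\<^sup>2 * (1 / 2)"
    by (rule LIMSEQ_le_const) (use bound in blast)
  then show ?thesis by simp
qed

end

section \<open>The matrix Gamma(z) as a quadratic form\<close>

lemma norm_outer: "norm (outer x y) = norm x * norm (y :: real^'n)"
proof -
  have "norm (outer x y $ i) = \<bar>x $ i\<bar> * norm y" for i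
  proof -
    have "outer x y $ i = x $ i *\<^sub>R y" by (simp add: outer_def vec_eq_iff)
    then show ?thesis by simp
  qed
  then show ?thesis
    by (simp add: norm_vec_def[of "outer x y"] norm_vec_def[of x] L2_set_left_distrib)
qed

lemma outer_vector_mult: "outer x y *v v = (y \<bullet> v) *\<^sub>R (x :: real^'n)"
  by (simp add: outer_def matrix_vector_mult_def vec_eq_iff inner_vec_def sum_distrib_left
      mult_ac)

lemma borel_measurable_outer [measurable (raw)]:
  fixes f g :: "'a \<Rightarrow> real^'n"
  assumes [measurable]: "f \<in> borel_measurable M" "g \<in> borel_measurable M"
  shows "(\<lambda>x. outer (f x) (g x)) \<in> borel_measurable M"
proof -
  have "continuous_on UNIV (\<lambda>p. outer (fst p) (snd p) :: real^'n^'n)"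
    unfolding outer_def by (intro continuous_intros)
  then have "(\<lambda>p. outer (fst p) (snd p)) \<in> borel_measurable (borel \<Otimes>\<^sub>M (borel :: (real^'n) measure))"
    by (simp add: borel_prod borel_measurable_continuous_onI)
  from measurable_compose[OF measurable_Pair[OF assms] this] show ?thesis by simp
qed

lemma bounded_linear_transpose: "bounded_linear (transpose :: real^'n^'n \<Rightarrow> real^'n^'n)"
  by (intro linear_conv_bounded_linear[THEN iffD1] linearI)
     (simp_all add: transpose_def vec_eq_iff)

lemma bounded_linear_matrix_form:
  "bounded_linear (\<lambda>A :: real^'n^'n. v \<bullet> (A *v v))"
  by (intro linear_conv_bounded_linear[THEN iffD1] linearI)
     (simp_all add: matrix_vector_mult_add_rdistrib inner_add_right scaleR_matrix_vector_assoc[symmetric])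

text \<open>Integrability of 1 / |x - z| makes the matrix-valued integrand integrable, so
  transposition and the quadratic form, being bounded linear, commute with the integral.\<close>

lemma
  fixes P :: "(real^'n) measure" and z :: "real^'n"
  assumes [measurable_cong]: "sets P = sets borel" and int: "integrable P (\<lambda>x. 1 / norm (x - z))"
  shows transpose_Gamma_mat: "transpose (Gamma_mat P (\<lambda>x. x) z) = Gamma_mat P (\<lambda>x. x) z"
    and Gamma_mat_form:
      "h \<bullet> (Gamma_mat P (\<lambda>x. x) z *v h) = (\<integral>x. norm_hessian h (x - z) \<partial>P)"
proof -
  let ?f = "\<lambda>x. (1 / norm (x - z)) *\<^sub>R
        (mat 1 - (1 / (norm (x - z))\<^sup>2) *\<^sub>R outer (x - z) (x - z)) :: real^'n^'n"
  have i: "integrable P ?f"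
  proof (rule Bochner_Integration.integrable_bound)
    show "integrable P (\<lambda>x. (norm (mat 1 :: real^'n^'n) + 1) * (1 / norm (x - z)))"
      by (intro integrable_mult_right int)
    show "AE x in P. norm (?f x) \<le> norm ((norm (mat 1 :: real^'n^'n) + 1) * (1 / norm (x - z)))"
    proof (rule AE_I2)
      fix x
      have "norm ((1 / (norm (x - z))\<^sup>2) *\<^sub>R outer (x - z) (x - z)) \<le> 1"
        by (simp add: norm_outer power2_eq_square)
      then have "norm (mat 1 - (1 / (norm (x - z))\<^sup>2) *\<^sub>R outer (x - z) (x - z))
          \<le> norm (mat 1 :: real^'n^'n) + 1"
        by (intro order_trans[OF norm_triangle_ineq4] add_left_mono)
      then have "norm (?f x) \<le> (1 / norm (x - z)) * (norm (mat 1 :: real^'n^'n) + 1)"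
        unfolding norm_scaleR by (intro mult_mono) auto
      then show "norm (?f x) \<le> norm ((norm (mat 1 :: real^'n^'n) + 1) * (1 / norm (x - z)))"
        by (simp add: mult.commute)
    qed
  qed measurable
  have "transpose (?f x) = ?f x" for x
    by (auto simp: outer_def transpose_def mat_def vec_eq_iff)
  then show "transpose (Gamma_mat P (\<lambda>x. x) z) = Gamma_mat P (\<lambda>x. x) z"
    unfolding Gamma_mat_def using integral_bounded_linear[OF bounded_linear_transpose i] by simp
  have "h \<bullet> (?f x *v h) = norm_hessian h (x - z)" for x
  proof -
    have "h \<bullet> (?f x *v h) = (1 / norm (x - z)) * (h \<bullet> h - (1 / (norm (x - z))\<^sup>2) * ((x - z) \<bullet> h)\<^sup>2)"
      by (simp add: matrix_vector_mult_diff_rdistrib outer_vector_mult inner_diff_right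
          power2_eq_square inner_commute flip: scaleR_matrix_vector_assoc)
    then show ?thesis
      by (simp add: norm_hessian_def dot_square_norm right_diff_distrib power3_eq_cube power2_eq_square)
  qed
  then show "h \<bullet> (Gamma_mat P (\<lambda>x. x) z *v h) = (\<integral>x. norm_hessian h (x - z) \<partial>P)"
    unfolding Gamma_mat_def using integral_bounded_linear[OF bounded_linear_matrix_form i, of h] by simp
qed

section \<open>The mean gradient of the loss and its linearization\<close>

lemma grad_loss_eq:
  "grad_loss x (z, a) = (z - x - a *\<^sub>R sgn (z - x), a - norm (z - x))"
  by (simp add: grad_loss_def sgn_div_norm divide_inverse_commute)

lemma grad_loss_measurable:
  "(\<lambda>(x, y). grad_loss x y) \<in> borel_measurable (borel \<Otimes>\<^sub>M (borel :: ((real^'n) \<times> real) measure))"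
proof -
  have "(\<lambda>p. grad_loss (fst p) (snd p))
      \<in> borel_measurable (borel \<Otimes>\<^sub>M (borel \<Otimes>\<^sub>M borel :: ((real^'n) \<times> real) measure))"
    unfolding grad_loss_def by measurable
  then show ?thesis by (simp add: borel_prod case_prod_beta')
qed

text \<open>\<open>direction\<close>, \<open>center\<close> and \<open>radius\<close> are what is
  retained of the polar representation; together they make the mean gradient vanish at
  \<open>(\<mu>, r\<^sub>0)\<close>. Independence of radius and direction is encoded in
  \<open>center\<close>.\<close>

locale spherical_law = atomless_law P for P :: "(real^'n) measure" +
  fixes \<mu> :: "real^'n" and r\<^sub>0 :: real and m :: "real^'n"
  assumes inverse_square: "integrable P (\<lambda>x. 1 / (norm (x - \<mu>))\<^sup>2)"
    and fourth: "integrable P (\<lambda>x. norm (x - \<mu>) ^ 4)"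
    and direction: "(\<integral>x. sgn (x - \<mu>) \<partial>P) = m"
    and center: "(\<integral>x. x - \<mu> \<partial>P) = r\<^sub>0 *\<^sub>R m"
    and radius: "(\<integral>x. norm (x - \<mu>) \<partial>P) = r\<^sub>0"
begin

lemma inverse_integrable: "integrable P (\<lambda>x. 1 / norm (x - \<mu>))"
proof (rule Bochner_Integration.integrable_bound)
  show "integrable P (\<lambda>x. 1 + 1 / (norm (x - \<mu>))\<^sup>2)" using inverse_square by simp
  show "AE x in P. norm (1 / norm (x - \<mu>)) \<le> norm (1 + 1 / (norm (x - \<mu>))\<^sup>2)"
  proof (rule AE_I2)
    fix x
    have "t \<le> 1 + t\<^sup>2" if "0 \<le> t" for t :: real
      using sum_squares_bound[of 1 t] that by simp
    from this[of "1 / norm (x - \<mu>)"]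
    show "norm (1 / norm (x - \<mu>)) \<le> norm (1 + 1 / (norm (x - \<mu>))\<^sup>2)"
      by (simp add: power_divide)
  qed
qed measurable

lemma norm_integrable: "integrable P (\<lambda>x. norm (x - \<mu>))"
proof (rule Bochner_Integration.integrable_bound)
  show "integrable P (\<lambda>x. 1 + norm (x - \<mu>) ^ 4)" using fourth by simp
  show "AE x in P. norm (norm (x - \<mu>)) \<le> norm (1 + norm (x - \<mu>) ^ 4)"
    using abs_le_one_plus_power4[of "norm (x - \<mu>)" for x] by simp
qed measurable

lemma diff_integrable: "integrable P (\<lambda>x. x - \<mu>)"
  using norm_integrable by (subst integrable_norm_iff[symmetric]) auto

lemma integral_sgn_minus: "(\<integral>x. sgn (\<mu> - x) \<partial>P) = - m"
proof -
  have "sgn (\<mu> - x) = - sgn (x - \<mu>)" for x by (metis minus_diff_eq sgn_minus)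
  then show ?thesis by (simp add: direction)
qed

lemma norm_grad_loss_le:
  "norm (grad_loss x (z, a)) \<le> 2 * norm (x - \<mu>) + 2 * (norm (z - \<mu>) + \<bar>a\<bar>)"
proof -
  have "norm (grad_loss x (z, a)) \<le> norm (z - x - a *\<^sub>R sgn (z - x)) + norm (a - norm (z - x))"
    unfolding grad_loss_eq by (rule norm_Pair_le)
  also have "norm (z - x - a *\<^sub>R sgn (z - x)) \<le> norm (z - x) + \<bar>a\<bar> * 1"
    unfolding norm_scaleR[symmetric]
    by (intro order_trans[OF norm_triangle_ineq4] add_left_mono)
       (simp add: mult_left_le norm_sgn_le)
  also have "norm (a - norm (z - x)) \<le> \<bar>a\<bar> + norm (z - x)"
    using norm_triangle_ineq4[of a "norm (z - x)"] by simp
  finally show ?thesis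
    using norm_triangle_ineq4[of "z - \<mu>" "x - \<mu>"] by simp
qed

lemma
  assumes "norm (z - \<mu>) + \<bar>a\<bar> \<le> b"
  shows integrable_grad_loss4: "integrable P (\<lambda>x. norm (grad_loss x (z, a)) ^ 4)"
    and grad_loss4_le: "(\<integral>x. norm (grad_loss x (z, a)) ^ 4 \<partial>P)
      \<le> (\<integral>x. 128 * norm (x - \<mu>) ^ 4 + 128 * b ^ 4 \<partial>P)"
proof -
  have [measurable]: "(\<lambda>x. grad_loss x (z, a)) \<in> borel_measurable borel"
    unfolding grad_loss_eq by measurable
  \<comment> \<open>Two applications of (s + t)^2 <= 2 s^2 + 2 t^2. With the factors 2 of
    \<open>norm_grad_loss_le\<close> this yields 8 * 2^4 = 128.\<close>
  have four: "(s + t) ^ 4 \<le> 8 * s ^ 4 + 8 * t ^ 4" for s t :: real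
  proof -
    have "(s + t)\<^sup>2 \<le> 2 * s\<^sup>2 + 2 * t\<^sup>2" using sum_squares_bound[of s t] by (simp add: power2_sum)
    then have "((s + t)\<^sup>2)\<^sup>2 \<le> (2 * s\<^sup>2 + 2 * t\<^sup>2)\<^sup>2" by (intro power_mono) auto
    also have "\<dots> = 4 * (s\<^sup>2 + t\<^sup>2)\<^sup>2" by algebra
    also have "\<dots> \<le> 4 * (2 * (s\<^sup>2)\<^sup>2 + 2 * (t\<^sup>2)\<^sup>2)"
      using sum_squares_bound[of "s\<^sup>2" "t\<^sup>2"] by (simp add: power2_sum)
    finally show ?thesis by simp
  qed
  have pw: "norm (grad_loss x (z, a)) ^ 4 \<le> 128 * norm (x - \<mu>) ^ 4 + 128 * b ^ 4" for x
  proof -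
    have "norm (grad_loss x (z, a)) ^ 4 \<le> (2 * norm (x - \<mu>) + 2 * b) ^ 4"
      using norm_grad_loss_le[of x z a] assms by (intro power_mono) auto
    also have "\<dots> \<le> 8 * (2 * norm (x - \<mu>)) ^ 4 + 8 * (2 * b) ^ 4" by (rule four)
    finally show ?thesis by (simp add: power_mult_distrib)
  qed
  have b: "integrable P (\<lambda>x. 128 * norm (x - \<mu>) ^ 4 + 128 * b ^ 4)" using fourth by simp
  show i: "integrable P (\<lambda>x. norm (grad_loss x (z, a)) ^ 4)"
    by (rule Bochner_Integration.integrable_bound[OF b])
       (use pw in \<open>auto intro!: order_trans[OF _ abs_ge_self]\<close>)
  show "(\<integral>x. norm (grad_loss x (z, a)) ^ 4 \<partial>P) \<le> (\<integral>x. 128 * norm (x - \<mu>) ^ 4 + 128 * b ^ 4 \<partial>P)"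
    by (intro integral_mono i b pw)
qed

lemma grad_loss_integrable: "integrable P (\<lambda>x. grad_loss x y)"
proof -
  obtain z a where y: "y = (z, a)" by (cases y)
  have [measurable]: "(\<lambda>x. grad_loss x (z, a)) \<in> borel_measurable borel"
    unfolding grad_loss_eq by measurable
  show ?thesis
    unfolding y
    by (rule Bochner_Integration.integrable_bound[of P "\<lambda>x. 1 + norm (grad_loss x (z, a)) ^ 4"])
       (use integrable_grad_loss4[OF order_refl, of z a]
         abs_le_one_plus_power4[of "norm (grad_loss x (z, a))" for x] in auto)
qed

text \<open>In the first component the mean of mu - X is -r0 m and cancels the contribution r0 m of
  the unit vector; in the second the radius is the mean distance to mu.\<close>

lemma grad_loss_zero: "(\<integral>x. grad_loss x (\<mu>, r\<^sub>0) \<partial>P) = 0"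
proof (rule prod_eqI)
  have sub: "integrable P (\<lambda>x. \<mu> - x)"
    using integrable_minus[OF diff_integrable] by simp
  have "fst (\<integral>x. grad_loss x (\<mu>, r\<^sub>0) \<partial>P) = (\<integral>x. \<mu> - x - r\<^sub>0 *\<^sub>R sgn (\<mu> - x) \<partial>P)"
    using integral_fst[OF grad_loss_integrable, of "(\<mu>, r\<^sub>0)"] by (simp add: grad_loss_eq)
  also have "\<dots> = (\<integral>x. \<mu> - x \<partial>P) - r\<^sub>0 *\<^sub>R (- m)"
    using sub integrable_sgn[of "\<lambda>x. \<mu> - x"] by (simp add: integral_sgn_minus)
  also have "(\<integral>x. \<mu> - x \<partial>P) = - (\<integral>x. x - \<mu> \<partial>P)"
    by (subst integral_minus[symmetric]) simp
  finally show "fst (\<integral>x. grad_loss x (\<mu>, r\<^sub>0) \<partial>P) = fst 0" by (simp add: center)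
  have "snd (\<integral>x. grad_loss x (\<mu>, r\<^sub>0) \<partial>P) = (\<integral>x. r\<^sub>0 - norm (x - \<mu>) \<partial>P)"
    using integral_snd[OF grad_loss_integrable, of "(\<mu>, r\<^sub>0)"]
    by (simp add: grad_loss_eq norm_minus_commute)
  also have "\<dots> = 0" using norm_integrable by (simp add: radius prob_space)
  finally show "snd (\<integral>x. grad_loss x (\<mu>, r\<^sub>0) \<partial>P) = snd 0" by simp
qed

text \<open>The derivative of \<open>grad_loss x\<close> at \<open>(\<mu>, r\<^sub>0)\<close> in
  direction v. Its mean is the Hessian of [A4] acting on v, written on pairs instead of vectors with
  a bordered index type.\<close>

definition grad_derivative :: "real^'n \<Rightarrow> (real^'n) \<times> real \<Rightarrow> (real^'n) \<times> real" where
  "grad_derivative x v =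
     (fst v - snd v *\<^sub>R sgn (\<mu> - x)
        - r\<^sub>0 *\<^sub>R ((1 / norm (\<mu> - x)) *\<^sub>R (fst v - (sgn (\<mu> - x) \<bullet> fst v) *\<^sub>R sgn (\<mu> - x))),
      snd v - sgn (\<mu> - x) \<bullet> fst v)"

lemma integrable_grad_derivative: "integrable P (\<lambda>x. grad_derivative x v)"
proof (rule Bochner_Integration.integrable_bound)
  let ?h = "fst v" and ?b = "snd v"
  show "integrable P (\<lambda>x. 2 * norm ?h + 2 * \<bar>?b\<bar> + \<bar>r\<^sub>0\<bar> * (2 * norm ?h) * (1 / norm (x - \<mu>)))"
    using inverse_integrable by (intro Bochner_Integration.integrable_add integrable_mult_right) auto
  show "AE x in P. norm (grad_derivative x v)
      \<le> norm (2 * norm ?h + 2 * \<bar>?b\<bar> + \<bar>r\<^sub>0\<bar> * (2 * norm ?h) * (1 / norm (x - \<mu>)))"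
  proof (rule AE_I2)
    fix x
    let ?s = "sgn (\<mu> - x)"
    have s: "norm ?s \<le> 1" by (rule norm_sgn_le)
    have sh: "\<bar>?s \<bullet> ?h\<bar> \<le> norm ?h"
      using Cauchy_Schwarz_ineq2[of ?s ?h] mult_right_mono[OF s, of "norm ?h"] by simp
    have "norm ((?s \<bullet> ?h) *\<^sub>R ?s) \<le> norm ?h * 1"
      unfolding norm_scaleR using s sh by (intro mult_mono) auto
    then have "norm (?h - (?s \<bullet> ?h) *\<^sub>R ?s) \<le> 2 * norm ?h"
      using norm_triangle_ineq4[of ?h "(?s \<bullet> ?h) *\<^sub>R ?s"] by simp
    then have 1: "norm (r\<^sub>0 *\<^sub>R ((1 / norm (\<mu> - x)) *\<^sub>R (?h - (?s \<bullet> ?h) *\<^sub>R ?s)))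
        \<le> \<bar>r\<^sub>0\<bar> * ((1 / norm (\<mu> - x)) * (2 * norm ?h))"
      unfolding norm_scaleR by (intro mult_mono) auto
    have 2: "norm (?b *\<^sub>R ?s) \<le> \<bar>?b\<bar> * 1"
      unfolding norm_scaleR using s by (intro mult_mono) auto
    have "norm (grad_derivative x v) \<le> norm (?h - ?b *\<^sub>R ?s
        - r\<^sub>0 *\<^sub>R ((1 / norm (\<mu> - x)) *\<^sub>R (?h - (?s \<bullet> ?h) *\<^sub>R ?s))) + norm (?b - ?s \<bullet> ?h)"
      unfolding grad_derivative_def by (rule norm_Pair_le)
    also have "\<dots> \<le> (norm ?h + \<bar>?b\<bar> + \<bar>r\<^sub>0\<bar> * ((1 / norm (\<mu> - x)) * (2 * norm ?h))) + (\<bar>?b\<bar> + norm ?h)"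
    proof (rule add_mono)
      show "norm (?h - ?b *\<^sub>R ?s - r\<^sub>0 *\<^sub>R ((1 / norm (\<mu> - x)) *\<^sub>R (?h - (?s \<bullet> ?h) *\<^sub>R ?s)))
          \<le> norm ?h + \<bar>?b\<bar> + \<bar>r\<^sub>0\<bar> * ((1 / norm (\<mu> - x)) * (2 * norm ?h))"
        using 1 2 norm_triangle_ineq4[of ?h "?b *\<^sub>R ?s"]
          norm_triangle_ineq4[of "?h - ?b *\<^sub>R ?s" "r\<^sub>0 *\<^sub>R ((1 / norm (\<mu> - x)) *\<^sub>R (?h - (?s \<bullet> ?h) *\<^sub>R ?s))"]
        by linarith
      show "norm (?b - ?s \<bullet> ?h) \<le> \<bar>?b\<bar> + norm ?h" using sh unfolding real_norm_def by linarith
    qed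
    also have "\<dots> = 2 * norm ?h + 2 * \<bar>?b\<bar> + \<bar>r\<^sub>0\<bar> * (2 * norm ?h) * (1 / norm (x - \<mu>))"
      by (simp add: norm_minus_commute)
    finally show "norm (grad_derivative x v)
        \<le> norm (2 * norm ?h + 2 * \<bar>?b\<bar> + \<bar>r\<^sub>0\<bar> * (2 * norm ?h) * (1 / norm (x - \<mu>)))"
      unfolding real_norm_def by (rule order_trans[OF _ abs_ge_self])
  qed
qed (unfold grad_derivative_def, measurable)

definition mean_derivative :: "(real^'n) \<times> real \<Rightarrow> (real^'n) \<times> real" where
  "mean_derivative v = (\<integral>x. grad_derivative x v \<partial>P)"

lemma linear_mean_derivative: "linear mean_derivative"
proof (rule linearI)
  have add: "grad_derivative x (v + w) = grad_derivative x v + grad_derivative x w" for x v w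
    by (simp add: grad_derivative_def inner_add_right algebra_simps)
  have scale: "grad_derivative x (c *\<^sub>R v) = c *\<^sub>R grad_derivative x v" for x c v
    by (simp add: grad_derivative_def algebra_simps)
  show "mean_derivative (v + w) = mean_derivative v + mean_derivative w" for v w
    unfolding mean_derivative_def add by (simp add: integrable_grad_derivative)
  show "mean_derivative (c *\<^sub>R v) = c *\<^sub>R mean_derivative v" for c v
    unfolding mean_derivative_def scale by simp
qed

text \<open>The remainder has three parts: the radius deviation times the increment of the unit
  vector, at most 2 |v|^2 / |x - mu|; r0 times the second-order remainder of the unit vector, with
  the constant of \<open>sgn_taylor\<close>; and the second-order remainder of the norm, at most
  |v|^2 / (2 |x - mu|). Hence 5/2 = 2 + 1/2 in the first coefficient.\<close>

lemma grad_loss_taylor: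
  assumes "x \<noteq> \<mu>"
  shows "norm (grad_loss x ((\<mu>, r\<^sub>0) + v) - grad_loss x (\<mu>, r\<^sub>0) - grad_derivative x v)
    \<le> (5 / 2 * (1 / norm (x - \<mu>)) + 5 / 2 * \<bar>r\<^sub>0\<bar> * (1 / (norm (x - \<mu>))\<^sup>2)) * (norm v)\<^sup>2"
proof -
  obtain h b where v: "v = (h, b)" by (cases v)
  define a where "a = \<mu> - x"
  have a: "a \<noteq> 0" using assms by (simp add: a_def)
  have p: "norm a > 0" "norm (x - \<mu>) = norm a" using a by (auto simp: a_def norm_minus_commute)
  have hv: "norm h \<le> norm v" "\<bar>b\<bar> \<le> norm v"
    using norm_fst_le[of h b] norm_snd_le[of b h] by (auto simp: v)
  have hb: "\<bar>b\<bar> * norm h \<le> (norm v)\<^sup>2" "(norm h)\<^sup>2 \<le> (norm v)\<^sup>2"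
    using mult_mono[OF hv(2,1)] hv(1) by (auto simp: power2_eq_square intro!: mult_mono)
  let ?T = "(1 / norm a) *\<^sub>R (h - (sgn a \<bullet> h) *\<^sub>R sgn a)"
  have zx: "\<mu> + h - x = a + h" "\<mu> - x = a" by (simp_all add: a_def)
  have eq: "grad_loss x ((\<mu>, r\<^sub>0) + v) - grad_loss x (\<mu>, r\<^sub>0) - grad_derivative x v
      = (- (b *\<^sub>R (sgn (a + h) - sgn a)) - r\<^sub>0 *\<^sub>R (sgn (a + h) - sgn a - ?T),
         - (norm (a + h) - norm a - sgn a \<bullet> h))"
    by (simp add: v grad_loss_eq grad_derivative_def zx) (simp add: algebra_simps a_def)
  have "norm (grad_loss x ((\<mu>, r\<^sub>0) + v) - grad_loss x (\<mu>, r\<^sub>0) - grad_derivative x v)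
      \<le> norm (- (b *\<^sub>R (sgn (a + h) - sgn a)) - r\<^sub>0 *\<^sub>R (sgn (a + h) - sgn a - ?T))
      + norm (- (norm (a + h) - norm a - sgn a \<bullet> h))"
    unfolding eq by (rule norm_Pair_le)
  also have "\<dots> \<le> (\<bar>b\<bar> * (2 * norm h / norm a) + \<bar>r\<^sub>0\<bar> * (5 / 2 * (norm h)\<^sup>2 / (norm a)\<^sup>2))
      + (norm h)\<^sup>2 / (2 * norm a)"
  proof (rule add_mono)
    have 1: "norm (b *\<^sub>R (sgn (a + h) - sgn a)) \<le> \<bar>b\<bar> * (2 * norm h / norm a)"
      unfolding norm_scaleR using norm_sgn_diff_le[OF a] by (intro mult_left_mono) auto
    have 2: "norm (r\<^sub>0 *\<^sub>R (sgn (a + h) - sgn a - ?T)) \<le> \<bar>r\<^sub>0\<bar> * (5 / 2 * (norm h)\<^sup>2 / (norm a)\<^sup>2)"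
      unfolding norm_scaleR using sgn_taylor[OF a] by (intro mult_left_mono) auto
    show "norm (- (b *\<^sub>R (sgn (a + h) - sgn a)) - r\<^sub>0 *\<^sub>R (sgn (a + h) - sgn a - ?T))
        \<le> \<bar>b\<bar> * (2 * norm h / norm a) + \<bar>r\<^sub>0\<bar> * (5 / 2 * (norm h)\<^sup>2 / (norm a)\<^sup>2)"
      using 1 2 by (intro order_trans[OF norm_triangle_ineq4] add_mono) (simp_all only: norm_minus_cancel)
    show "norm (- (norm (a + h) - norm a - sgn a \<bullet> h)) \<le> (norm h)\<^sup>2 / (2 * norm a)"
      using norm_taylor[OF a, of h] sgn_inner_le_norm_diff[of a h] by simp
  qed
  also have "\<dots> = 2 * (1 / norm a) * (\<bar>b\<bar> * norm h) + 5 / 2 * \<bar>r\<^sub>0\<bar> * (1 / (norm a)\<^sup>2) * (norm h)\<^sup>2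
      + 1 / 2 * (1 / norm a) * (norm h)\<^sup>2"
    by simp
  also have "\<dots> \<le> 2 * (1 / norm a) * (norm v)\<^sup>2 + 5 / 2 * \<bar>r\<^sub>0\<bar> * (1 / (norm a)\<^sup>2) * (norm v)\<^sup>2
      + 1 / 2 * (1 / norm a) * (norm v)\<^sup>2"
    using hb by (intro add_mono mult_left_mono) auto
  also have "\<dots> = (5 / 2 * (1 / norm a) + 5 / 2 * \<bar>r\<^sub>0\<bar> * (1 / (norm a)\<^sup>2)) * (norm v)\<^sup>2"
    using p(1) by (simp add: field_simps)
  finally show ?thesis unfolding p(2) .
qed

lemma mean_grad_loss_taylor:
  "norm ((\<integral>x. grad_loss x y \<partial>P) - mean_derivative (y - (\<mu>, r\<^sub>0)))
    \<le> (\<integral>x. 5 / 2 * (1 / norm (x - \<mu>)) + 5 / 2 * \<bar>r\<^sub>0\<bar> * (1 / (norm (x - \<mu>))\<^sup>2) \<partial>P)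
      * (norm (y - (\<mu>, r\<^sub>0)))\<^sup>2"
proof -
  let ?v = "y - (\<mu>, r\<^sub>0)"
  let ?d = "\<lambda>x. grad_loss x y - grad_loss x (\<mu>, r\<^sub>0) - grad_derivative x ?v"
  let ?c = "\<lambda>x. 5 / 2 * (1 / norm (x - \<mu>)) + 5 / 2 * \<bar>r\<^sub>0\<bar> * (1 / (norm (x - \<mu>))\<^sup>2)"
  have c: "integrable P ?c"
    by (intro Bochner_Integration.integrable_add integrable_mult_right inverse_integrable inverse_square)
  have d: "integrable P ?d"
    by (intro Bochner_Integration.integrable_diff grad_loss_integrable integrable_grad_derivative)
  have "(\<integral>x. grad_loss x y \<partial>P) - mean_derivative ?v = (\<integral>x. ?d x \<partial>P)"
    unfolding mean_derivative_def
    by (simp add: grad_loss_integrable integrable_grad_derivative grad_loss_zero)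
  also have "norm \<dots> \<le> (\<integral>x. norm (?d x) \<partial>P)" by (rule integral_norm_bound)
  also have "\<dots> \<le> (\<integral>x. ?c x * (norm ?v)\<^sup>2 \<partial>P)"
  proof (rule integral_mono_AE)
    show "AE x in P. norm (?d x) \<le> ?c x * (norm ?v)\<^sup>2"
      using atomless[of \<mu>]
    proof eventually_elim
      case (elim x)
      from grad_loss_taylor[OF this, of ?v] show ?case by simp
    qed
  qed (use d c in auto)
  also have "\<dots> = (\<integral>x. ?c x \<partial>P) * (norm ?v)\<^sup>2" by simp
  finally show ?thesis .
qed

text \<open>Subtracting the vanishing mean gradient at \<open>(\<mu>, r\<^sub>0)\<close> and
  expanding isolates the two nonlinear quantities, \<open>sgn_increment\<close> and the Taylor
  remainder of the mean distance. The mixed term b (m . h) occurs once in each component, hence the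
  factor 2.\<close>

lemma mean_grad_loss_inner:
  "(\<integral>x. grad_loss x (\<mu> + h, r\<^sub>0 + b) \<partial>P) \<bullet> (h, b)
    = (norm h)\<^sup>2 + b\<^sup>2 + 2 * b * (m \<bullet> h) - (r\<^sub>0 + b) * sgn_increment \<mu> h
      - b * (\<integral>x. norm (\<mu> + h - x) - norm (\<mu> - x) - sgn (\<mu> - x) \<bullet> h \<partial>P)"
proof -
  let ?D = "\<lambda>x. norm (\<mu> + h - x) - norm (\<mu> - x) - sgn (\<mu> - x) \<bullet> h"
  let ?S = "\<lambda>x. (sgn (\<mu> + h - x) - sgn (\<mu> - x)) \<bullet> h"
  have iD: "integrable P ?D"
    by (intro Bochner_Integration.integrable_diff[OF integrable_norm_increment]
        integrable_inner_left integrable_sgn) measurable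
  have iS: "integrable P ?S" by (rule integrable_sgn_increment)
  have i_s: "integrable P (\<lambda>x. sgn (\<mu> - x) \<bullet> h)"
    by (intro integrable_inner_left integrable_sgn) measurable
  have lin: "(\<integral>x. k - c1 * f1 x - c2 * f2 x - c3 * f3 x \<partial>P)
      = k - c1 * (\<integral>x. f1 x \<partial>P) - c2 * (\<integral>x. f2 x \<partial>P) - c3 * (\<integral>x. f3 x \<partial>P)"
    if "integrable P f1" "integrable P f2" "integrable P f3"
    for k c1 c2 c3 :: real and f1 f2 f3 :: "real^'n \<Rightarrow> real"
    using that by (simp add: prob_space)
  have pw: "(grad_loss x (\<mu> + h, r\<^sub>0 + b) - grad_loss x (\<mu>, r\<^sub>0)) \<bullet> (h, b)
      = (norm h)\<^sup>2 + b\<^sup>2 - 2 * b * (sgn (\<mu> - x) \<bullet> h) - (r\<^sub>0 + b) * ?S x - b * ?D x" for x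
    by (simp add: grad_loss_eq inner_diff_left inner_add_left power2_norm_eq_inner
        power2_eq_square[of b] algebra_simps)
  have "(\<integral>x. grad_loss x (\<mu> + h, r\<^sub>0 + b) \<partial>P) \<bullet> (h, b)
      = (\<integral>x. (grad_loss x (\<mu> + h, r\<^sub>0 + b) - grad_loss x (\<mu>, r\<^sub>0)) \<bullet> (h, b) \<partial>P)"
    using grad_loss_integrable by (simp add: grad_loss_zero)
  also have "\<dots> = (\<integral>x. (norm h)\<^sup>2 + b\<^sup>2 - 2 * b * (sgn (\<mu> - x) \<bullet> h) - (r\<^sub>0 + b) * ?S x - b * ?D x \<partial>P)"
    unfolding pw ..
  also have "\<dots> = (norm h)\<^sup>2 + b\<^sup>2 - 2 * b * (\<integral>x. sgn (\<mu> - x) \<bullet> h \<partial>P)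
      - (r\<^sub>0 + b) * (\<integral>x. ?S x \<partial>P) - b * (\<integral>x. ?D x \<partial>P)"
    by (rule lin[OF i_s iS iD])
  also have "(\<integral>x. sgn (\<mu> - x) \<bullet> h \<partial>P) = - (m \<bullet> h)"
    using integrable_sgn[of "\<lambda>x. \<mu> - x"] by (simp add: integral_sgn_minus)
  finally show ?thesis unfolding sgn_increment_def by simp
qed

text \<open>Young's inequality with weight A splits the mixed term between b^2 and |h|^2. The
  gradient increment costs at most Lambda (r0 + R_r) |h|^2 and the Taylor remainder at most Lambda
  R_r / 2 |h|^2; together they account for the 3/2 in [A3].\<close>

lemma mean_grad_loss_monotone:
  assumes A: "(norm m)\<^sup>2 < A" "A < 1"
    and R: "R\<^sub>\<mu> > 0" "R\<^sub>r > 0" and \<Lambda>: "\<Lambda> \<ge> 0"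
    and small: "\<Lambda> * (r\<^sub>0 + 3 / 2 * R\<^sub>r) < 1 - (norm m)\<^sup>2 / A"
    and hess: "\<And>z h. z \<in> cball \<mu> R\<^sub>\<mu> \<Longrightarrow> integrable P (\<lambda>x. 1 / norm (x - z)) \<Longrightarrow>
      (\<integral>x. norm_hessian h (x - z) \<partial>P) \<le> \<Lambda> * (norm h)\<^sup>2"
  obtains \<kappa> where "\<kappa> > 0"
    "\<And>y. y \<in> cball \<mu> R\<^sub>\<mu> \<times> cball r\<^sub>0 R\<^sub>r \<Longrightarrow> snd y > 0 \<Longrightarrow>
      (\<integral>x. grad_loss x y \<partial>P) \<bullet> (y - (\<mu>, r\<^sub>0)) \<ge> \<kappa> * (norm (y - (\<mu>, r\<^sub>0)))\<^sup>2"
proof -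
  \<comment> \<open>These are the coefficients left for b^2 and for |h|^2; the second is positive by
    \<open>small\<close>.\<close>
  define \<kappa> where "\<kappa> = min (1 - A) (1 - (norm m)\<^sup>2 / A - \<Lambda> * (r\<^sub>0 + 3 / 2 * R\<^sub>r))"
  have A0: "A > 0" using A(1) by (rule le_less_trans[rotated]) simp
  have "\<kappa> > 0" using A small by (simp add: \<kappa>_def)
  moreover have "(\<integral>x. grad_loss x y \<partial>P) \<bullet> (y - (\<mu>, r\<^sub>0)) \<ge> \<kappa> * (norm (y - (\<mu>, r\<^sub>0)))\<^sup>2"
    if y: "y \<in> cball \<mu> R\<^sub>\<mu> \<times> cball r\<^sub>0 R\<^sub>r" "snd y > 0" for y
  proof -
    define h b where "h = fst y - \<mu>" and "b = snd y - r\<^sub>0"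
    have yhb: "y = (\<mu> + h, r\<^sub>0 + b)" by (simp add: h_def b_def)
    have h: "h \<in> cball 0 R\<^sub>\<mu>" and b: "\<bar>b\<bar> \<le> R\<^sub>r" and a: "r\<^sub>0 + b > 0"
      using y by (auto simp: yhb dist_norm)
    let ?D = "\<integral>x. norm (\<mu> + h - x) - norm (\<mu> - x) - sgn (\<mu> - x) \<bullet> h \<partial>P"
    have S: "sgn_increment \<mu> k \<le> \<Lambda> * (norm k)\<^sup>2" if "k \<in> cball 0 R\<^sub>\<mu>" for k
      by (rule sgn_increment_le[OF \<Lambda> R(1) _ that]) (rule hess)
    have D: "?D \<le> \<Lambda> / 2 * (norm h)\<^sup>2" by (rule norm_increment_le[OF \<Lambda> S h])
    have D0: "0 \<le> ?D"
    proof (rule integral_nonneg_AE, rule AE_I2)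
      fix x
      show "0 \<le> norm (\<mu> + h - x) - norm (\<mu> - x) - sgn (\<mu> - x) \<bullet> h"
        using sgn_inner_le_norm_diff[of "\<mu> - x" h] by (simp add: algebra_simps)
    qed
    have "(r\<^sub>0 + b) * sgn_increment \<mu> h \<le> (r\<^sub>0 + b) * (\<Lambda> * (norm h)\<^sup>2)"
      using S[OF h] a by (intro mult_left_mono) auto
    also have "\<dots> \<le> (r\<^sub>0 + R\<^sub>r) * (\<Lambda> * (norm h)\<^sup>2)"
      using b \<Lambda> by (intro mult_right_mono) auto
    finally have 1: "(r\<^sub>0 + b) * sgn_increment \<mu> h \<le> (r\<^sub>0 + R\<^sub>r) * (\<Lambda> * (norm h)\<^sup>2)" .
    \<comment> \<open>\<open>?D\<close> is nonnegative by convexity of the norm, so b may be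
      replaced by \<open>R\<^sub>r\<close> whatever its sign.\<close>
    have "b * ?D \<le> R\<^sub>r * ?D" using b D0 by (intro mult_right_mono) auto
    also have "\<dots> \<le> R\<^sub>r * (\<Lambda> / 2 * (norm h)\<^sup>2)" using D R by (intro mult_left_mono) auto
    finally have 2: "b * ?D \<le> R\<^sub>r * (\<Lambda> / 2 * (norm h)\<^sup>2)" .
    have 3: "- (A * b\<^sup>2 + (norm m)\<^sup>2 / A * (norm h)\<^sup>2) \<le> 2 * b * (m \<bullet> h)"
    proof -
      have "- (2 * b * (m \<bullet> h)) \<le> 2 * \<bar>b\<bar> * (norm m * norm h)"
      proof -
        have "- (2 * b * (m \<bullet> h)) \<le> \<bar>2 * b * (m \<bullet> h)\<bar>" by simp
        also have "\<dots> = 2 * \<bar>b\<bar> * \<bar>m \<bullet> h\<bar>" by (simp add: abs_mult)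
        also have "\<dots> \<le> 2 * \<bar>b\<bar> * (norm m * norm h)"
          by (intro mult_left_mono Cauchy_Schwarz_ineq2) auto
        finally show ?thesis .
      qed
      moreover have "0 \<le> (A * \<bar>b\<bar> - norm m * norm h)\<^sup>2 / A" using A0 by simp
      then have "2 * \<bar>b\<bar> * (norm m * norm h) \<le> A * b\<^sup>2 + (norm m)\<^sup>2 / A * (norm h)\<^sup>2"
        using A0 by (simp add: power2_diff power_mult_distrib field_simps)
          (simp add: power2_eq_square)
      ultimately show ?thesis by linarith
    qed
    have "\<kappa> * (norm (y - (\<mu>, r\<^sub>0)))\<^sup>2 = \<kappa> * (norm h)\<^sup>2 + \<kappa> * b\<^sup>2"
      by (simp add: yhb norm_Pair algebra_simps)
    also have "\<dots> \<le> (1 - (norm m)\<^sup>2 / A - \<Lambda> * (r\<^sub>0 + 3 / 2 * R\<^sub>r)) * (norm h)\<^sup>2 + (1 - A) * b\<^sup>2"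
      by (intro add_mono mult_right_mono) (auto simp: \<kappa>_def)
    also have "\<dots> = (norm h)\<^sup>2 + b\<^sup>2 - (A * b\<^sup>2 + (norm m)\<^sup>2 / A * (norm h)\<^sup>2)
        - (r\<^sub>0 + R\<^sub>r) * (\<Lambda> * (norm h)\<^sup>2) - R\<^sub>r * (\<Lambda> / 2 * (norm h)\<^sup>2)"
      by (simp add: algebra_simps)
    also have "\<dots> \<le> (norm h)\<^sup>2 + b\<^sup>2 + 2 * b * (m \<bullet> h) - (r\<^sub>0 + b) * sgn_increment \<mu> h - b * ?D"
      using 1 2 3 by linarith
    also have "\<dots> = (\<integral>x. grad_loss x y \<partial>P) \<bullet> (y - (\<mu>, r\<^sub>0))"
      using mean_grad_loss_inner[of h b] by (simp add: yhb)
    finally show ?thesis .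
  qed
  ultimately show ?thesis using that by blast
qed

end

section \<open>The rate for truncated spherical distributions\<close>

text \<open>E(W U) = E(W) E(U) will be obtained coordinate by coordinate from the rule for real
  variables. The preimage families are stable under intersection, so independence passes to the
  generated sigma-algebras.\<close>

lemma (in prob_space) indep_var_component:
  fixes W :: "'a \<Rightarrow> real" and U :: "'a \<Rightarrow> real^'n"
  assumes [measurable]: "W \<in> borel_measurable M" "U \<in> borel_measurable M"
    and indep: "indep_set {W -` A \<inter> space M | A. A \<in> sets borel} {U -` B \<inter> space M | B. B \<in> sets borel}"
  shows "indep_var borel W borel (\<lambda>\<omega>. U \<omega> $ i)"
proof -
  let ?W = "{W -` A \<inter> space M | A. A \<in> sets borel}"
  let ?U = "{(\<lambda>\<omega>. U \<omega> $ i) -` A \<inter> space M | A. A \<in> sets borel}"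
  have [measurable]: "(\<lambda>x :: real^'n. x $ i) \<in> borel_measurable borel"
    by (intro borel_measurable_continuous_onI continuous_intros)
  have "?U \<subseteq> {U -` B \<inter> space M | B. B \<in> sets borel}"
  proof
    fix C assume "C \<in> ?U"
    then obtain A where A: "A \<in> sets borel" "C = (\<lambda>\<omega>. U \<omega> $ i) -` A \<inter> space M" by blast
    then have "(\<lambda>x. x $ i) -` A \<in> sets (borel :: (real^'n) measure)"
      using measurable_sets[of "\<lambda>x :: real^'n. x $ i" borel borel A] by simp
    moreover have "C = U -` ((\<lambda>x. x $ i) -` A) \<inter> space M" using A by auto
    ultimately show "C \<in> {U -` B \<inter> space M | B. B \<in> sets borel}" by blast
  qed
  then have "indep_set ?W ?U"
    using indep unfolding indep_sets2_eq by (meson subset_iff)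
  moreover have "Int_stable {f -` A \<inter> space M | A. A \<in> sets borel}" for f :: "'a \<Rightarrow> real"
  proof (rule Int_stableI)
    fix a b assume "a \<in> {f -` A \<inter> space M | A. A \<in> sets borel}" "b \<in> {f -` A \<inter> space M | A. A \<in> sets borel}"
    then obtain A B where "A \<in> sets borel" "a = f -` A \<inter> space M" "B \<in> sets borel" "b = f -` B \<inter> space M"
      by blast
    then have "a \<inter> b = f -` (A \<inter> B) \<inter> space M" "A \<inter> B \<in> sets borel" by auto
    then show "a \<inter> b \<in> {f -` A \<inter> space M | A. A \<in> sets borel}" by blast
  qed
  ultimately have "indep_set (sigma_sets (space M) ?W) (sigma_sets (space M) ?U)"
    by (intro indep_set_sigma_sets)
  then show ?thesis unfolding indep_var_eq by simp
qed

lemma (in prob_space) AE_norm_uniform_on_sphere: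
  fixes U :: "'a \<Rightarrow> 'e::euclidean_space"
  assumes "\<Omega> \<in> sets borel" "\<Omega> \<subseteq> sphere 0 1" and [measurable]: "U \<in> borel_measurable M"
    and U: "distr M borel U = uniform_measure sphere_surface \<Omega>"
  shows "AE \<omega> in M. norm (U \<omega>) = 1"
proof -
  have "emeasure (distr M borel U) (- \<Omega>) = 0"
    unfolding U using assms(1) by (subst emeasure_uniform_measure) auto
  then have "- \<Omega> \<in> null_sets (distr M borel U)"
    using assms(1) by (intro null_setsI) auto
  then have "AE x in distr M borel U. x \<notin> - \<Omega>" by (rule AE_not_in)
  then have "AE \<omega> in M. U \<omega> \<notin> - \<Omega>"
    using assms(1) by (subst (asm) AE_distr_iff) auto
  then show ?thesis
    by eventually_elim (use assms(2) in auto)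
qed

text \<open>Almost surely W = |X - mu| / r and U = sgn(X - mu). An atom of X would thus be an atom
  of W, which has a density. Independence factors E(W U), which gives \<open>center\<close>.\<close>

lemma (in prob_space) spherical_law_distr:
  fixes W :: "'a \<Rightarrow> real" and U X :: "'a \<Rightarrow> real^'n" and r r\<^sub>0 :: real
  assumes "CARD('n) \<ge> 2" and r: "r > 0" and W: "AE \<omega> in M. W \<omega> > 0"
    and dist: "distributed M lborel W f"
    and U_meas: "U \<in> borel_measurable M" and U: "AE \<omega> in M. norm (U \<omega>) = 1"
    and indep: "indep_set {W -` A \<inter> space M | A. A \<in> sets borel} {U -` B \<inter> space M | B. B \<in> sets borel}"
    and X: "\<And>\<omega>. \<omega> \<in> space M \<Longrightarrow> X \<omega> = \<mu> + (r * W \<omega>) *\<^sub>R U \<omega>"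
    and r\<^sub>0: "r\<^sub>0 = r * expectation W"
    and inverse_square: "integrable M (\<lambda>\<omega>. 1 / (norm (X \<omega> - \<mu>))\<^sup>2)"
    and fourth: "integrable M (\<lambda>\<omega>. norm (X \<omega> - \<mu>) ^ 4)"
  shows "X \<in> borel_measurable M"
    and "spherical_law (distr M borel X) \<mu> r\<^sub>0 (\<integral>\<omega>. U \<omega> \<partial>M)"
proof -
  note [measurable] = U_meas
  have [measurable]: "W \<in> borel_measurable M"
    using distributed_measurable[OF dist] by simp
  show X_meas [measurable]: "X \<in> borel_measurable M"
    using X by (subst measurable_cong[where g="\<lambda>\<omega>. \<mu> + (r * W \<omega>) *\<^sub>R U \<omega>"]) auto
  let ?P = "distr M borel X"
  interpret P: prob_space ?P by (rule prob_space_distr) fact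
  have polar: "AE \<omega> in M. W \<omega> = norm (X \<omega> - \<mu>) / r \<and> sgn (X \<omega> - \<mu>) = U \<omega>"
    using W U AE_space
  proof eventually_elim
    case (elim \<omega>)
    have eq: "X \<omega> - \<mu> = (r * W \<omega>) *\<^sub>R U \<omega>" and pos: "r * W \<omega> > 0"
      using elim X r by auto
    have norm_eq: "norm (X \<omega> - \<mu>) = r * W \<omega>" using eq pos elim by simp
    have "sgn (X \<omega> - \<mu>) = (inverse (r * W \<omega>) * (r * W \<omega>)) *\<^sub>R U \<omega>"
      unfolding sgn_div_norm norm_eq unfolding eq scaleR_scaleR ..
    also have "\<dots> = U \<omega>" using pos by (subst left_inverse) auto
    finally show ?case using norm_eq r by simp
  qed
  have W_ne: "AE \<omega> in M. W \<omega> \<noteq> w" for w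
  proof -
    have "AE x in density lborel f. x \<noteq> w"
      using AE_lborel_singleton[of w] distributed_borel_measurable[OF dist]
      by (subst AE_density) auto
    then have "AE x in distr M lborel W. x \<noteq> w"
      unfolding distributed_distr_eq_density[OF dist] .
    then show ?thesis by (subst (asm) AE_distr_iff) auto
  qed
  have norm_int: "integrable M (\<lambda>\<omega>. norm (X \<omega> - \<mu>))"
  proof (rule Bochner_Integration.integrable_bound)
    show "integrable M (\<lambda>\<omega>. 1 + norm (X \<omega> - \<mu>) ^ 4)" using fourth by simp
    show "AE \<omega> in M. norm (norm (X \<omega> - \<mu>)) \<le> norm (1 + norm (X \<omega> - \<mu>) ^ 4)"
      using abs_le_one_plus_power4[of "norm (X \<omega> - \<mu>)" for \<omega>] by simp
  qed measurable
  have W_eq: "AE \<omega> in M. W \<omega> = norm (X \<omega> - \<mu>) / r" using polar by eventually_elim simp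
  have W_int: "integrable M W"
    using integrable_cong_AE[OF _ _ W_eq] norm_int by simp
  have U_int: "integrable M U"
    by (rule integrable_const_bound[of _ 1]) (use U in \<open>auto elim: AE_mp\<close>)
  show "spherical_law ?P \<mu> r\<^sub>0 (\<integral>\<omega>. U \<omega> \<partial>M)"
  proof (unfold_locales)
    show "sets ?P = sets borel" by simp
    show "AE x in ?P. x \<noteq> z" for z
    proof -
      have "AE \<omega> in M. X \<omega> \<noteq> z"
        using W_ne[of "norm (z - \<mu>) / r"] W_eq by eventually_elim auto
      then show ?thesis by (subst AE_distr_iff) auto
    qed
    show "DIM(real^'n) \<ge> 2" using assms(1) by simp
    show "integrable ?P (\<lambda>x. 1 / (norm (x - \<mu>))\<^sup>2)"
      using inverse_square by (subst integrable_distr_eq) auto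
    show "integrable ?P (\<lambda>x. norm (x - \<mu>) ^ 4)"
      using fourth by (subst integrable_distr_eq) auto
    have "(\<integral>x. sgn (x - \<mu>) \<partial>?P) = (\<integral>\<omega>. sgn (X \<omega> - \<mu>) \<partial>M)"
      by (subst integral_distr) auto
    also have "\<dots> = (\<integral>\<omega>. U \<omega> \<partial>M)"
      using polar by (intro integral_cong_AE) auto
    finally show "(\<integral>x. sgn (x - \<mu>) \<partial>?P) = (\<integral>\<omega>. U \<omega> \<partial>M)" .
    have "(\<integral>x. norm (x - \<mu>) \<partial>?P) = (\<integral>\<omega>. norm (X \<omega> - \<mu>) \<partial>M)"
      by (subst integral_distr) auto
    also have "\<dots> = (\<integral>\<omega>. r * W \<omega> \<partial>M)"
      using W_eq r by (intro integral_cong_AE) (auto elim: AE_mp)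
    finally show "(\<integral>x. norm (x - \<mu>) \<partial>?P) = r\<^sub>0" by (simp add: r\<^sub>0)
    have "(\<integral>x. x - \<mu> \<partial>?P) = (\<integral>\<omega>. X \<omega> - \<mu> \<partial>M)"
      by (subst integral_distr) auto
    also have "\<dots> = r\<^sub>0 *\<^sub>R (\<integral>\<omega>. U \<omega> \<partial>M)"
    proof (rule vec_eq_iff[THEN iffD2], rule allI)
      fix i
      have X_int: "integrable M (\<lambda>\<omega>. X \<omega> - \<mu>)"
        using norm_int by (subst integrable_norm_iff[symmetric]) auto
      have Ui: "integrable M (\<lambda>\<omega>. U \<omega> $ i)"
        by (rule integrable_bounded_linear[OF bounded_linear_vec_nth U_int])
      have "(\<integral>\<omega>. X \<omega> - \<mu> \<partial>M) $ i = (\<integral>\<omega>. (X \<omega> - \<mu>) $ i \<partial>M)"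
        by (rule integral_bounded_linear[OF bounded_linear_vec_nth X_int, symmetric])
      also have "\<dots> = (\<integral>\<omega>. r * (W \<omega> * U \<omega> $ i) \<partial>M)"
        by (intro Bochner_Integration.integral_cong refl) (simp add: X)
      also have "\<dots> = r * (expectation W * (\<integral>\<omega>. U \<omega> $ i \<partial>M))"
        using indep_var_lebesgue_integral[OF indep_var_component[OF _ _ indep] W_int Ui] by simp
      also have "(\<integral>\<omega>. U \<omega> $ i \<partial>M) = (\<integral>\<omega>. U \<omega> \<partial>M) $ i"
        by (rule integral_bounded_linear[OF bounded_linear_vec_nth U_int])
      finally show "(\<integral>\<omega>. X \<omega> - \<mu> \<partial>M) $ i = (r\<^sub>0 *\<^sub>R (\<integral>\<omega>. U \<omega> \<partial>M)) $ i"
        by (simp add: r\<^sub>0)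
    qed
    finally show "(\<integral>x. x - \<mu> \<partial>?P) = r\<^sub>0 *\<^sub>R (\<integral>\<omega>. U \<omega> \<partial>M)" .
  qed
qed

lemma Gamma_mat_distr:
  assumes [measurable]: "X \<in> borel_measurable M"
  shows "Gamma_mat (distr M borel X) (\<lambda>x. x) z = Gamma_mat M X z"
  unfolding Gamma_mat_def by (subst integral_distr) auto

theorem theorem4p3:
  fixes N :: "'b measure" and M :: "'c measure"
    and \<mu> :: "real^'n" and r r_star :: real
    and W :: "'b \<Rightarrow> real" and U X0 :: "'b \<Rightarrow> real^'n" and \<Omega> :: "(real^'n) set"
    and R\<^sub>\<mu> R\<^sub>r :: real
    and \<theta> :: "(real^'n) \<times> real" and K :: "((real^'n) \<times> real) set"
    and \<pi> :: "(real^'n) \<times> real \<Rightarrow> (real^'n) \<times> real"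
    and X :: "nat \<Rightarrow> 'c \<Rightarrow> real^'n"
    and c\<^sub>\<gamma> \<alpha> :: real and \<gamma> :: "nat \<Rightarrow> real"
    and \<theta>\<^sub>1 :: "(real^'n) \<times> real"
    and \<theta>_hat \<theta>_bar :: "nat \<Rightarrow> 'c \<Rightarrow> (real^'n) \<times> real"
  \<comment> \<open>model\<close>
  assumes "CARD('n) \<ge> 2"
    and "prob_space N"
    and "r > 0"
    and "AE \<omega> in N. W \<omega> > 0"
    and "\<exists>f. distributed N lborel W f \<and>
             (CARD('n) = 2 \<longrightarrow> (\<exists>B::real. \<forall>w. f w \<le> ennreal B))"
    and "\<Omega> \<in> sets borel" and "\<Omega> \<subseteq> sphere 0 1" and "emeasure sphere_surface \<Omega> > 0"
    and "U \<in> borel_measurable N" and "distr N borel U = uniform_measure sphere_surface \<Omega>"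
    and "prob_space.indep_set N {W -` A \<inter> space N | A. A \<in> sets borel}
                                  {U -` B \<inter> space N | B. B \<in> sets borel}"
    and "\<And>\<omega>. \<omega> \<in> space N \<Longrightarrow> X0 \<omega> = \<mu> + (r * W \<omega>) *\<^sub>R U \<omega>"
    and "r_star = r * (\<integral>\<omega>. W \<omega> \<partial>N)"
    and "\<theta> = (\<mu>, r_star)"
  \<comment> \<open>A1, A2, A3, A4 and the moment condition\<close>
    and "integrable N (\<lambda>\<omega>. 1 / (norm (X0 \<omega> - \<mu>))\<^sup>2)"
    and "integrable N (\<lambda>\<omega>. (norm (X0 \<omega> - \<mu>))\<^sup>2)"
    and "R\<^sub>\<mu> > 0" and "R\<^sub>r > 0"
    and "\<exists>A. (norm (\<integral>\<omega>. U \<omega> \<partial>N))\<^sup>2 < A \<and> A < 1 \<and>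
             (SUP z\<in>cball \<mu> R\<^sub>\<mu>. ereal (lambda_max (Gamma_mat N X0 z)))
               < ereal ((1 - (norm (\<integral>\<omega>. U \<omega> \<partial>N))\<^sup>2 / A) / (r_star + 3 / 2 * R\<^sub>r))"
    and "positive_definite (Gamma_theta N X0 \<theta>)"
    and "integrable N (\<lambda>\<omega>. norm (X0 \<omega> - \<mu>) ^ 12)"
  \<comment> \<open>compact set and projection\<close>
    and "compact K" and "convex K"
    and "K \<subseteq> UNIV \<times> {0<..}" and "K \<subseteq> cball \<mu> R\<^sub>\<mu> \<times> cball r_star R\<^sub>r"
    and "\<theta> \<in> K - frontier K"
    and "\<And>y. \<pi> y \<in> K"
    and "\<And>y. y \<in> K \<Longrightarrow> \<pi> y = y"
    and "\<And>y y'. norm (\<pi> y - \<pi> y') \<le> norm (y - y')"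
    and "\<And>y. y \<notin> K \<Longrightarrow> \<pi> y \<in> frontier K"
  \<comment> \<open>sample and algorithm\<close>
    and "prob_space M"
    and "prob_space.indep_vars M (\<lambda>_. borel) X {1..}"
    and "\<And>n. n \<ge> 1 \<Longrightarrow> distr M borel (X n) = distr N borel X0"
    and "c\<^sub>\<gamma> > 0" and "1 / 2 < \<alpha>" and "\<alpha> < 1"
    and "\<And>n. n \<ge> 1 \<Longrightarrow> \<gamma> n = c\<^sub>\<gamma> * real n powr (- \<alpha>)"
    and "\<theta>\<^sub>1 \<in> K"
    and "\<And>\<omega>. \<omega> \<in> space M \<Longrightarrow> \<theta>_hat 1 \<omega> = \<theta>\<^sub>1"
    and "\<And>n \<omega>. n \<ge> 1 \<Longrightarrow> \<omega> \<in> space M \<Longrightarrow>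
           \<theta>_hat (n + 1) \<omega> = \<pi> (\<theta>_hat n \<omega> - \<gamma> n *\<^sub>R grad_loss (X (n + 1) \<omega>) (\<theta>_hat n \<omega>))"
    and "\<And>n \<omega>. n \<ge> 1 \<Longrightarrow> \<omega> \<in> space M \<Longrightarrow>
           \<theta>_bar n \<omega> = (1 / real n) *\<^sub>R (\<Sum>k=1..n. \<theta>_hat k \<omega>)"
  shows "\<exists>C>0. \<forall>n\<ge>1. (\<integral>\<omega>. (norm (\<theta>_bar n \<omega> - \<theta>))\<^sup>2 \<partial>M) \<le> C / real n"
proof -
  have card: "CARD('n) \<ge> 2" and N: "prob_space N" and r: "r > 0" and W: "AE \<omega> in N. W \<omega> > 0"
    by (fact assms)+
  interpret N: prob_space N by (rule N)
  obtain f where f: "distributed N lborel W f" using assms(5) by blast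
  have U1: "AE \<omega> in N. norm (U \<omega>) = 1"
    using assms(6,7,9,10) by (rule N.AE_norm_uniform_on_sphere)
  let ?m = "\<integral>\<omega>. U \<omega> \<partial>N" and ?P = "distr N borel X0"
  have fourth: "integrable N (\<lambda>\<omega>. norm (X0 \<omega> - \<mu>) ^ 4)"
    if [measurable]: "X0 \<in> borel_measurable N"
  proof (rule Bochner_Integration.integrable_bound)
    show "integrable N (\<lambda>\<omega>. 1 + norm (X0 \<omega> - \<mu>) ^ 12)" using assms(21) by simp
    have "t ^ 4 \<le> 1 + t ^ 12" if "0 \<le> t" for t :: real
    proof (cases "t \<le> 1")
      case True
      then have "t ^ 4 \<le> 1" using that by (intro power_le_one)
      moreover have "0 \<le> t ^ 12" using that by simp
      ultimately show ?thesis by linarith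
    next
      case False
      then have "t ^ 4 \<le> t ^ 12" by (intro power_increasing) auto
      then show ?thesis by linarith
    qed
    from this[of "norm (X0 \<omega> - \<mu>)" for \<omega>]
    show "AE \<omega> in N. norm (norm (X0 \<omega> - \<mu>) ^ 4) \<le> norm (1 + norm (X0 \<omega> - \<mu>) ^ 12)" by simp
  qed measurable
  have "W \<in> borel_measurable N" using distributed_measurable[OF f] by simp
  then have "(\<lambda>\<omega>. \<mu> + (r * W \<omega>) *\<^sub>R U \<omega>) \<in> borel_measurable N"
    using assms(9) by measurable
  then have X0_meas [measurable]: "X0 \<in> borel_measurable N"
    using assms(12) by (simp cong: measurable_cong)
  interpret S: spherical_law ?P \<mu> r_star ?m
    by (rule N.spherical_law_distr(2)[OF card r W f assms(9) U1 assms(11,12,13,15) fourth[OF X0_meas]])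
  have \<theta>: "\<theta> = (\<mu>, r_star)" by (fact assms)
  have "\<theta> \<in> K" using assms(26) by blast
  \<comment> \<open>Positivity of the mean radius is read off from theta lying in \<open>K\<close>,
    whose second components are positive.\<close>
  then have r_star: "r_star > 0" using assms(24) by (auto simp: \<theta>)
  obtain A where A: "(norm ?m)\<^sup>2 < A" "A < 1"
    and sup: "(SUP z\<in>cball \<mu> R\<^sub>\<mu>. ereal (lambda_max (Gamma_mat N X0 z)))
      < ereal ((1 - (norm ?m)\<^sup>2 / A) / (r_star + 3 / 2 * R\<^sub>r))"
    using assms(19) by blast
  \<comment> \<open>A real number strictly between the two sides of [A3] replaces the supremum over
    extended reals; the gap above it becomes part of the monotonicity constant.\<close>
  obtain \<Lambda> where \<Lambda>: "(SUP z\<in>cball \<mu> R\<^sub>\<mu>. ereal (lambda_max (Gamma_mat N X0 z))) < ereal \<Lambda>"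
    "\<Lambda> < (1 - (norm ?m)\<^sup>2 / A) / (r_star + 3 / 2 * R\<^sub>r)"
    using ereal_dense2[OF sup] by auto
  \<comment> \<open>Integrability at z makes \<open>Gamma_mat\<close> a convergent integral, so its
    largest eigenvalue controls the quadratic form.\<close>
  have hess: "(\<integral>x. norm_hessian h (x - z) \<partial>?P) \<le> \<Lambda> * (norm h)\<^sup>2"
    if z: "z \<in> cball \<mu> R\<^sub>\<mu>" and int: "integrable ?P (\<lambda>x. 1 / norm (x - z))" for z h
  proof -
    have "ereal (lambda_max (Gamma_mat N X0 z)) < ereal \<Lambda>"
      using \<Lambda>(1) z by (rule le_less_trans[OF SUP_upper, rotated])
    then have "lambda_max (Gamma_mat ?P (\<lambda>x. x) z) \<le> \<Lambda>"
      by (simp add: Gamma_mat_distr)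
    then have "lambda_max (Gamma_mat ?P (\<lambda>x. x) z) * (norm h)\<^sup>2 \<le> \<Lambda> * (norm h)\<^sup>2"
      by (intro mult_right_mono) auto
    then show ?thesis
      using rayleigh_le_lambda_max[OF transpose_Gamma_mat[OF S.sets_P int], of h]
      by (simp add: Gamma_mat_form[OF S.sets_P int])
  qed
  \<comment> \<open>Testing \<open>hess\<close> at mu, where E(1 / |X - mu|) is finite, with a unit
    vector.\<close>
  have "\<Lambda> \<ge> 0"
  proof -
    obtain i :: 'n where True by blast
    have "0 \<le> (\<integral>x. norm_hessian (axis i 1) (x - \<mu>) \<partial>?P)"
      by (intro integral_nonneg_AE AE_I2 norm_hessian_nonneg)
    also have "\<dots> \<le> \<Lambda> * (norm (axis i (1::real)))\<^sup>2"
      using assms(17) by (intro hess S.inverse_integrable) auto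
    finally show ?thesis by (simp add: norm_axis_1)
  qed
  have "r_star + 3 / 2 * R\<^sub>r > 0" using r_star assms(18) by simp
  then have small: "\<Lambda> * (r_star + 3 / 2 * R\<^sub>r) < 1 - (norm ?m)\<^sup>2 / A"
    using \<Lambda>(2) by (simp only: pos_less_divide_eq)
  obtain \<kappa> where \<kappa>: "\<kappa> > 0"
    "\<And>y. y \<in> cball \<mu> R\<^sub>\<mu> \<times> cball r_star R\<^sub>r \<Longrightarrow> snd y > 0 \<Longrightarrow>
      (\<integral>x. grad_loss x y \<partial>?P) \<bullet> (y - (\<mu>, r_star)) \<ge> \<kappa> * (norm (y - (\<mu>, r_star)))\<^sup>2"
    using S.mean_grad_loss_monotone[OF A assms(17,18) \<open>\<Lambda> \<ge> 0\<close> small hess] by blast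
  \<comment> \<open>A closed set minus its frontier is its interior, which provides the ball of
    radius rho.\<close>
  have "closed K" using assms(22) by (rule compact_imp_closed)
  then have "\<theta> \<in> interior K"
    using assms(26) by (auto simp: frontier_def)
  then obtain \<rho> where \<rho>: "\<rho> > 0" "ball \<theta> \<rho> \<subseteq> K"
    unfolding mem_interior by blast
  \<comment> \<open>A bound for |z - mu| + |a| over all (z, a) in \<open>K\<close>, which makes the
    fourth-moment bound for the gradient uniform.\<close>
  define b where "b = R\<^sub>\<mu> + (r_star + R\<^sub>r)"
  have K_b: "norm (fst y - \<mu>) + \<bar>snd y\<bar> \<le> b" if "y \<in> K" for y
    using assms(25) that r_star by (force simp: b_def dist_norm norm_minus_commute)
  have grad4: "integrable ?P (\<lambda>x. norm (grad_loss x y) ^ 4)"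
    "(\<integral>x. norm (grad_loss x y) ^ 4 \<partial>?P) \<le> (\<integral>x. 128 * norm (x - \<mu>) ^ 4 + 128 * b ^ 4 \<partial>?P)"
    if "y \<in> K" for y
    using S.integrable_grad_loss4[OF K_b[OF that]] S.grad_loss4_le[OF K_b[OF that]] by simp_all
  interpret M: prob_space M by (fact assms)
  interpret RM: projected_robbins_monro M ?P X grad_loss S.mean_derivative K \<theta> \<pi> c\<^sub>\<gamma> \<alpha> \<kappa>
    "\<integral>x. 128 * norm (x - \<mu>) ^ 4 + 128 * b ^ 4 \<partial>?P" \<rho>
    "\<integral>x. 5 / 2 * (1 / norm (x - \<mu>)) + 5 / 2 * \<bar>r_star\<bar> * (1 / (norm (x - \<mu>))\<^sup>2) \<partial>?P" \<theta>\<^sub>1 \<theta>_hat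
  proof unfold_locales
    show "bounded K" using assms(22) by (rule compact_imp_bounded)
    show "(\<integral>x. grad_loss x y \<partial>?P) \<bullet> (y - \<theta>) \<ge> \<kappa> * (norm (y - \<theta>))\<^sup>2" if "y \<in> K" for y
      unfolding \<theta> using assms(24,25) that by (intro \<kappa>(2)) auto
    show "norm ((\<integral>x. grad_loss x y \<partial>?P) - S.mean_derivative (y - \<theta>))
        \<le> (\<integral>x. 5 / 2 * (1 / norm (x - \<mu>)) + 5 / 2 * \<bar>r_star\<bar> * (1 / (norm (x - \<mu>))\<^sup>2) \<partial>?P)
          * (norm (y - \<theta>))\<^sup>2" for y
      unfolding \<theta> by (rule S.mean_grad_loss_taylor)
    show "\<theta>_hat (n + 1) \<omega> = \<pi> (\<theta>_hat n \<omega>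
        - (c\<^sub>\<gamma> * real n powr - \<alpha>) *\<^sub>R grad_loss (X (n + 1) \<omega>) (\<theta>_hat n \<omega>))"
      if "n \<ge> 1" "\<omega> \<in> space M" for n \<omega>
      using assms(37,40) that by simp
  qed (fact assms(27,28,29,32,33,34,35,36,38,39) grad4 \<rho> \<kappa>(1) grad_loss_measurable
      linear_add[OF S.linear_mean_derivative] linear_scale[OF S.linear_mean_derivative])+
  obtain C where C: "C > 0" "\<And>n. n \<ge> 1 \<Longrightarrow>
      (\<integral>\<omega>. (norm ((1 / real n) *\<^sub>R (\<Sum>k=1..n. \<theta>_hat k \<omega>) - \<theta>))\<^sup>2 \<partial>M) \<le> C / real n"
    using RM.averaged_iterates_rate by blast
  have "(\<integral>\<omega>. (norm (\<theta>_bar n \<omega> - \<theta>))\<^sup>2 \<partial>M)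
      = (\<integral>\<omega>. (norm ((1 / real n) *\<^sub>R (\<Sum>k=1..n. \<theta>_hat k \<omega>) - \<theta>))\<^sup>2 \<partial>M)" if "n \<ge> 1" for n
    using assms(41) that by (intro Bochner_Integration.integral_cong refl) simp
  then show ?thesis using C by (intro exI[of _ C]) simp
qed

end
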